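(* Let $\alpha\in(0,2)$ and let $X_1,X_2,\dots$ be i.i.d. random variables with $n^{-1/\alpha}\Sigma_n\Longrightarrow S_{\alpha,0}$ as $n\to\infty$, where $\Sigma_k=X_1+\dots+X_k$ ($\Sigma_0=0$). Let $r>0$, $\alpha'\in\mathbb R\setminus\{0\}$, and for each $n\in\mathbb N$ let $N_{r,\alpha',1/n^{\alpha'}}$ have the generalized negative binomial distribution with parameters $r,\alpha',\mu=n^{-\alpha'}$, independent of $X_1,X_2,\dots$. Then $$\lim_{n\to\infty}\sup_{x\ge0}\big|\mathsf P\big(\Sigma_{N_{r,\alpha',1/n^{\alpha'}}}<n^{1/\alpha}x\big)-H(x;r,\alpha,\alpha')\big|=0,$$ where $$H(x;r,\alpha,\alpha')=\mathsf P\big(S_{\alpha,0}G_{r,1}^{1/(\alpha\alpha')}<x\big)=\int_0^\infty\Phi\Big(\frac{x}{\sqrt{2z}}\Big)\,dA(z;r,\alpha/2,\alpha'),\quad x\in\mathbb R,$$ with $S_{\alpha,0}$, $G_{r,1}$ independent and $A(z;r,\beta,\alpha')=\mathsf P\big(S_{\beta,1}G_{r,1}^{1/(\beta\alpha')}<z\big)$ ($S_{\beta,1}$, $G_{r,1}$ independent). If $r\in(0,1)$ and $\alpha'\in(0,1]$, then $H(\cdot;r,\alpha,\alpha')$ is infinitely divisible and $$S_{\alpha,0}G_{r,1}^{1/(\alpha\alpha')}\stackrel{d}{=}\frac{\Lambda}{Z_{r,1}^{1/(\alpha\alpha')}}\sqrt{\frac{S_{\alpha/2,1}}{S_{\alpha\alpha'/2,1}}}.$$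 If, in addition, $\alpha'=1$, then $$S_{\alpha,0}G_{r,1}^{1/\alpha}\stackrel{d}{=}\frac{\Lambda\sqrt{R_{\alpha/2}}}{Z_{r,1}^{1/\alpha}}\stackrel{d}{=}\frac{X\sqrt{2M_{\alpha/2}}}{Z_{r,1}^{1/\alpha}}\stackrel{d}{=}\frac{L_\alpha}{Z_{r,1}^{1/\alpha}},$$ where in all terms the factors are independent.
   Context: $S_{\alpha,0}$ ($0<\alpha\le2$) has the symmetric strictly stable characteristic function $e^{-|t|^{\alpha}}$; for $0<\beta\le1$, $S_{\beta,1}$ has characteristic function $\exp\{-|t|^{\beta}\exp(-\tfrac12 i\pi\beta\,\mathrm{sign}\,t)\}$ (degenerate at $1$ if $\beta=1$). $\Phi$ is the standard normal distribution function and $X$ a standard normal random variable. The generalized gamma density is $g^*(x;r,\alpha,\lambda)=\frac{|\alpha|\lambda^r}{\Gamma(r)}x^{\alpha r-1}e^{-\lambda x^{\alpha}}$, $x\ge0$; $N_{r,\alpha,\mu}$ has the generalized negative binomial distribution $\mathsf P(N_{r,\alpha,\mu}=k)=\frac1{k!}\int_0^\infty e^{-z}z^kg^*(z;r,\alpha,\mu)dz$. $G_{s,1}$ is gamma with density $\frac1{\Gamma(s)}x^{s-1}e^{-x}$. $Z_{r,1}=(G_{r,1}+G_{1-r,1})/G_{r,1}$ with independent gamma factors. $\Lambda$ has Laplace density $\frac12e^{-|x|}$. $R_{\beta}=S_{\beta,1}/S'_{\beta,1}$ is the ratio of two independent copies of $S_{\beta,1}$. $M_\beta$ has the Mittag-Leffler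 distribution with Laplace transform $1/(1+s^{\beta})$. $L_\alpha$ has the Linnik distribution with characteristic function $1/(1+|t|^{\alpha})$. *)

theory Defs
  imports "HOL-Probability.Probability"
begin

text \<open>Symmetric strictly stable law S_{alpha,0}: characteristic function exp(-|t|^alpha).
  (Unique by Levy's uniqueness theorem; exists for 0 < alpha \<le> 2.)\<close>
definition stable_sym :: "real \<Rightarrow> real measure" where
  "stable_sym \<alpha> = (SOME \<mu>. real_distribution \<mu> \<and>
      (\<forall>t. char \<mu> t = complex_of_real (exp (- (\<bar>t\<bar> powr \<alpha>)))))"

definition stable_pos :: "real \<Rightarrow> real measure" where
  "stable_pos \<beta> = (SOME \<mu>. real_distribution \<mu> \<and>
      (\<forall>t. char \<mu> t = exp (- (complex_of_real (\<bar>t\<bar> powr \<beta>)) *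
              exp (- \<i> * complex_of_real (pi * \<beta> * sgn t / 2)))))"

definition gamma_distr :: "real \<Rightarrow> real measure" where
  "gamma_distr s = density lborel
     (\<lambda>x. ennreal (if 0 < x then x powr (s - 1) * exp (- x) / Gamma s else 0))"

definition laplace_distr :: "real measure" where
  "laplace_distr = density lborel (\<lambda>x. ennreal (exp (- \<bar>x\<bar>) / 2))"

definition std_normal_distr :: "real measure" where
  "std_normal_distr = density lborel (\<lambda>x. ennreal (std_normal_density x))"

definition Phi :: "real \<Rightarrow> real" where
  "Phi x = measure std_normal_distr {..x}"

definition mittag_leffler :: "real \<Rightarrow> real measure" where
  "mittag_leffler \<beta> = (SOME \<mu>. real_distribution \<mu> \<and> (AE x in \<mu>. 0 \<le> x) \<and>
      (\<forall>s\<ge>0. (\<integral>x. exp (- s * x) \<partial>\<mu>) = 1 / (1 + s powr \<beta>)))"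

definition linnik :: "real \<Rightarrow> real measure" where
  "linnik \<alpha> = (SOME \<mu>. real_distribution \<mu> \<and>
      (\<forall>t. char \<mu> t = complex_of_real (1 / (1 + \<bar>t\<bar> powr \<alpha>))))"

definition gen_gamma_density :: "real \<Rightarrow> real \<Rightarrow> real \<Rightarrow> real \<Rightarrow> real" where
  "gen_gamma_density r \<alpha> lam x =
     \<bar>\<alpha>\<bar> * lam powr r / Gamma r * x powr (\<alpha> * r - 1) * exp (- lam * x powr \<alpha>)"

definition gen_negbin_pmf :: "real \<Rightarrow> real \<Rightarrow> real \<Rightarrow> nat \<Rightarrow> real" where
  "gen_negbin_pmf r \<alpha> \<mu> k =
     (1 / fact k) * (LINT z:{0<..}|lborel. exp (- z) * z ^ k * gen_gamma_density r \<alpha> \<mu> z)"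

fun conv_pow :: "real measure \<Rightarrow> nat \<Rightarrow> real measure" where
  "conv_pow \<nu> 0 = return borel 0"
| "conv_pow \<nu> (Suc n) = convolution \<nu> (conv_pow \<nu> n)"

definition inf_divisible :: "real measure \<Rightarrow> bool" where
  "inf_divisible \<mu> \<longleftrightarrow> (\<forall>n::nat. n \<ge> 1 \<longrightarrow>
      (\<exists>\<nu>. real_distribution \<nu> \<and> \<mu> = conv_pow \<nu> n))"

definition law_H :: "real \<Rightarrow> real \<Rightarrow> real \<Rightarrow> real measure" where
  "law_H r \<alpha> \<alpha>' = distr (stable_sym \<alpha> \<Otimes>\<^sub>M gamma_distr r) borel
      (\<lambda>(s, g). s * g powr (1 / (\<alpha> * \<alpha>')))"

definition H_fun :: "real \<Rightarrow> real \<Rightarrow> real \<Rightarrow> real \<Rightarrow> real" where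
  "H_fun x r \<alpha> \<alpha>' = measure (law_H r \<alpha> \<alpha>') {..<x}"

definition law_A :: "real \<Rightarrow> real \<Rightarrow> real \<Rightarrow> real measure" where
  "law_A r \<beta> \<alpha>' = distr (stable_pos \<beta> \<Otimes>\<^sub>M gamma_distr r) borel
      (\<lambda>(s, g). s * g powr (1 / (\<beta> * \<alpha>')))"

end

theory Submission
  imports Defs
begin

text \<open>
  All laws are compared through characteristic functions. The one-sided stable law is obtained as the
  weak limit of normalized sums of Sibuya variables, whose generating function 1 - (1 - z)^\<beta> gives the
  characteristic function and the Laplace transform at the same time; the symmetric stable law is then
  the normal variance mixture X \<surd>(2 S) over it.

  The product representations rest on two facts about an exponential variable W: (W / S)^\<gamma> has the
  law of W for an independent one-sided \<gamma>-stable S, and W G / (G + G') has the law of G for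
  independent gamma variables G, G' of shapes r and 1 - r. They exhibit the limit law as a scale
  mixture of Laplace laws, with characteristic function E (1 / (1 + t^2 V)).

  For infinite divisibility let V be bounded away from 0. With \<phi> = c / (c + t^2) and c large, that
  function is \<phi> times a power series in \<phi> whose coefficients are the moments E (p (1 - p)^k) with
  p = 1 / (c V). They are log-convex, so by Kaluza's theorem the series is a constant divided by
  1 - F(\<phi>) with F having nonnegative coefficients, and the binomial series of (1 - F)^(-1/n) is a
  mixture of characteristic functions. General V is reached by Levy's continuity theorem.

  For the limit theorem, conditioning on the index and the uniform convergence of the normalized
  partial sums reduce the random sum to the variable S (N / n)^(1/\<alpha>), whose characteristic function
  is the probability generating function of N.
\<close>

section \<open>Gamma, Laplace and convolution laws\<close>

text \<open>The stable, Mittag-Leffler and Linnik laws are selected by \<open>SOME\<close>, so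
  nothing is known about them before a law with the prescribed transform has been built. This forces
  a continuity theorem that produces its limit law, and a witness for each of the four laws.

  The restrictions r < 1 and \<alpha>' \<le> 1 come from one chain. Let B = 1 / Z be the beta
  variable G_r / (G_r + G_{1-r}); then G_r has the law of W B, which asks for 1 - r > 0. Next W is
  replaced by (W / S')^\<gamma> with \<gamma> = \<alpha> \<alpha>' / 2, which asks for \<gamma> < 1.
  Given the other factors, the remaining W turns exp(-u W) into 1 / (1 + u), the characteristic
  function of a Laplace variable at sqrt u. As \<alpha> < 2, both stable indices stay below 1 and
  the degenerate law S_{1,1} never occurs.

  The infinite divisibility is a variance-mixture form of the Goldie-Steutel phenomenon and holds
  for every mixing law on the half-line; the gamma and stable factors matter only for reaching the
  mixture form. The parameter 1 / (c V) is a probability only where c V \<ge> 1, hence the detour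
  over V bounded away from 0.\<close>

lemma std_normal_distr_eq: "std_normal_distr = std_normal_distribution"
  by (simp add: std_normal_distr_def)

lemma real_distribution_std_normal_distr: "real_distribution std_normal_distr"
  unfolding std_normal_distr_eq by (rule real_dist_normal_dist)

lemma char_std_normal_distr: "char std_normal_distr t = complex_of_real (exp (- (t\<^sup>2 / 2)))"
  unfolding std_normal_distr_eq char_std_normal_distribution by simp

lemma real_distribution_density:
  fixes f :: "real \<Rightarrow> ennreal"
  assumes [measurable]: "f \<in> borel_measurable borel" and "(\<integral>\<^sup>+x. f x \<partial>lborel) = 1"
  shows "real_distribution (density lborel f)"
proof -
  have "prob_space (density lborel f)"
    by (rule prob_spaceI) (use assms in \<open>simp add: emeasure_density\<close>)
  thus ?thesis
    by (intro real_distribution.intro) (auto simp: real_distribution_axioms_def)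
qed

definition gamma_pdf :: "real \<Rightarrow> real \<Rightarrow> real" where
  "gamma_pdf s x = (if 0 < x then x powr (s - 1) * exp (- x) / Gamma s else 0)"

lemma gamma_distr_eq: "gamma_distr s = density lborel (gamma_pdf s)"
  unfolding gamma_distr_def gamma_pdf_def ..

lemma measurable_gamma_pdf [measurable]: "gamma_pdf s \<in> borel_measurable borel"
  unfolding gamma_pdf_def[abs_def] by measurable

lemma gamma_pdf_nonneg: "0 < s \<Longrightarrow> 0 \<le> gamma_pdf s x"
  unfolding gamma_pdf_def by (auto intro!: mult_nonneg_nonneg divide_nonneg_nonneg Gamma_real_nonneg)

lemma nn_integral_lborel_scale:
  fixes f :: "real \<Rightarrow> ennreal"
  assumes "f \<in> borel_measurable borel" "c \<noteq> 0"
  shows "(\<integral>\<^sup>+x. f x \<partial>lborel) = ennreal \<bar>c\<bar> * (\<integral>\<^sup>+x. f (c * x) \<partial>lborel)"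
  using nn_integral_real_affine[OF assms, of 0] by simp

text \<open>Substitution of a x in Euler's integral. As a nonnegative integral it yields finiteness
  and value at once: it normalizes the gamma law, gives its Laplace transform and, for s = 1,
  handles exponentials on the half-line.\<close>

lemma nn_integral_Gamma_scaled:
  fixes s a :: real
  assumes s: "0 < s" and a: "0 < a"
  shows "(\<integral>\<^sup>+x. ennreal (if 0 < x then x powr (s - 1) * exp (- a * x) else 0) \<partial>lborel) =
    ennreal (Gamma s * a powr (- s))"
proof -
  have *: "(\<integral>\<^sup>+x. ennreal (if 0 < x then x powr (s - 1) * exp (- x) else 0) \<partial>lborel) = ennreal (Gamma s)"
    unfolding Gamma_conv_nn_integral_real[OF s]
    by (intro nn_integral_cong_AE)
       (use AE_lborel_singleton[of 0] in eventually_elim, auto simp: indicator_def exp_minus field_simps)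
  have "ennreal (Gamma s) = ennreal a * (\<integral>\<^sup>+x. ennreal (if 0 < a * x then (a * x) powr (s - 1) * exp (- a * x) else 0) \<partial>lborel)"
    unfolding *[symmetric]
    by (subst nn_integral_lborel_scale[where c = a]) (use a in \<open>auto cong: if_cong\<close>)
  also have "\<dots> = ennreal (a powr s) * (\<integral>\<^sup>+x. ennreal (if 0 < x then x powr (s - 1) * exp (- a * x) else 0) \<partial>lborel)"
  proof -
    have "ennreal a * (\<integral>\<^sup>+x. ennreal (if 0 < a * x then (a * x) powr (s - 1) * exp (- a * x) else 0) \<partial>lborel) =
      (\<integral>\<^sup>+x. ennreal a * ennreal (if 0 < a * x then (a * x) powr (s - 1) * exp (- a * x) else 0) \<partial>lborel)"
      by (subst nn_integral_cmult) auto
    also have "\<dots> = (\<integral>\<^sup>+x. ennreal (a powr s) * ennreal (if 0 < x then x powr (s - 1) * exp (- a * x) else 0) \<partial>lborel)"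
    proof (intro nn_integral_cong)
      fix x :: real
      have "a * (a powr (s - 1)) = a powr s"
        using a powr_add[of a 1 "s - 1"] by simp
      thus "ennreal a * ennreal (if 0 < a * x then (a * x) powr (s - 1) * exp (- a * x) else 0) =
        ennreal (a powr s) * ennreal (if 0 < x then x powr (s - 1) * exp (- a * x) else 0)"
        using a by (auto simp: powr_mult zero_less_mult_iff ennreal_mult'[symmetric])
    qed
    also have "\<dots> = ennreal (a powr s) * (\<integral>\<^sup>+x. ennreal (if 0 < x then x powr (s - 1) * exp (- a * x) else 0) \<partial>lborel)"
      by (subst nn_integral_cmult) auto
    finally show ?thesis .
  qed
  finally have "ennreal (a powr (- s)) * ennreal (Gamma s) = ennreal (a powr (- s)) * ennreal (a powr s) *
    (\<integral>\<^sup>+x. ennreal (if 0 < x then x powr (s - 1) * exp (- a * x) else 0) \<partial>lborel)"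
    by (simp add: mult.assoc)
  moreover have "ennreal (a powr (- s)) * ennreal (a powr s) = 1"
    using a by (simp add: ennreal_mult'[symmetric] powr_minus)
  ultimately show ?thesis
    using a s by (simp add: ennreal_mult'[symmetric] mult.commute Gamma_real_nonneg)
qed

lemma real_distribution_gamma_distr:
  assumes s: "0 < s" shows "real_distribution (gamma_distr s)"
  unfolding gamma_distr_eq
proof (rule real_distribution_density)
  have "(\<integral>\<^sup>+x. ennreal (gamma_pdf s x) \<partial>lborel) =
    (\<integral>\<^sup>+x. ennreal (1 / Gamma s) * ennreal (if 0 < x then x powr (s - 1) * exp (- 1 * x) else 0) \<partial>lborel)"
    using s by (intro nn_integral_cong) (auto simp: gamma_pdf_def ennreal_mult'[symmetric] Gamma_real_pos less_imp_le)
  also have "\<dots> = ennreal (1 / Gamma s) * ennreal (Gamma s * 1 powr (- s))"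
    using s by (subst nn_integral_cmult) (auto simp: nn_integral_Gamma_scaled[of s 1, simplified])
  also have "\<dots> = 1"
    using Gamma_real_pos[OF s] by (simp add: ennreal_mult'[symmetric])
  finally show "(\<integral>\<^sup>+x. ennreal (gamma_pdf s x) \<partial>lborel) = 1" .
qed simp

lemma AE_gamma_distr_pos: "AE x in gamma_distr s. 0 < x"
  unfolding gamma_distr_eq by (subst AE_density) (auto simp: gamma_pdf_def)

lemma gamma_distr_laplace:
  assumes s: "0 < s" and l: "0 \<le> l"
  shows "(\<integral>x. exp (- l * x) \<partial>gamma_distr s) = (1 + l) powr (- s)"
proof -
  have "(\<integral>\<^sup>+x. ennreal (exp (- l * x)) \<partial>gamma_distr s) =
    (\<integral>\<^sup>+x. ennreal (gamma_pdf s x) * ennreal (exp (- l * x)) \<partial>lborel)"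
    unfolding gamma_distr_eq by (subst nn_integral_density) auto
  also have "\<dots> = (\<integral>\<^sup>+x. ennreal (1 / Gamma s) * ennreal (if 0 < x then x powr (s - 1) * exp (- (1 + l) * x) else 0) \<partial>lborel)"
    using Gamma_real_pos[OF s]
    by (intro nn_integral_cong) (auto simp: gamma_pdf_def ennreal_mult'[symmetric] mult_exp_exp algebra_simps)
  also have "\<dots> = ennreal (1 / Gamma s) * ennreal (Gamma s * (1 + l) powr (- s))"
    using s l by (subst nn_integral_cmult) (auto simp: nn_integral_Gamma_scaled[of s "1 + l", simplified])
  also have "\<dots> = ennreal ((1 + l) powr (- s))"
    using Gamma_real_pos[OF s] l by (simp add: ennreal_mult'[symmetric])
  finally show ?thesis
    by (subst integral_eq_nn_integral) (auto simp: gamma_distr_eq)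
qed

text \<open>Both sides are the expectation of exp(i t X Y) for independent X and Y. With a normal
  \<nu> this turns a Gaussian average of a characteristic function into an expectation under
  \<mu>.\<close>

lemma char_swap:
  assumes "real_distribution \<mu>" "real_distribution \<nu>"
  shows "(\<integral>y. char \<mu> (t * y) \<partial>\<nu>) = (\<integral>x. char \<nu> (t * x) \<partial>\<mu>)"
proof -
  interpret \<mu>: real_distribution \<mu> by fact
  interpret \<nu>: real_distribution \<nu> by fact
  interpret P: pair_prob_space \<mu> \<nu> ..
  have "(\<integral>y. \<integral>x. iexp (t * y * x) \<partial>\<mu> \<partial>\<nu>) = (\<integral>x. \<integral>y. iexp (t * y * x) \<partial>\<nu> \<partial>\<mu>)"
    by (rule P.Fubini_integral, rule P.integrable_const_bound[where B = 1]) (auto simp: split_beta')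
  thus ?thesis unfolding char_def by (simp add: mult_ac)
qed

text \<open>Conditioning on the second coordinate. Every product in the theorem has this shape, with
  one factor of known characteristic function and the remaining factors collected in f y.\<close>

lemma char_scale_mixture:
  assumes "real_distribution \<mu>" "prob_space K" and [measurable]: "f \<in> borel_measurable K"
  shows "char (distr (\<mu> \<Otimes>\<^sub>M K) borel (\<lambda>(x, y). x * f y)) t = (\<integral>y. char \<mu> (t * f y) \<partial>K)"
proof -
  interpret \<mu>: real_distribution \<mu> by fact
  interpret K: prob_space K by fact
  interpret P: pair_prob_space \<mu> K ..
  have *: "(\<lambda>(x, y). x * f y) \<in> borel_measurable (\<mu> \<Otimes>\<^sub>M K)"
    by measurable
  have "char (distr (\<mu> \<Otimes>\<^sub>M K) borel (\<lambda>(x, y). x * f y)) t = (\<integral>z. iexp (t * (fst z * f (snd z))) \<partial>(\<mu> \<Otimes>\<^sub>M K))"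
    unfolding char_def using * by (subst integral_distr) (auto simp: split_beta')
  also have "\<dots> = (\<integral>y. \<integral>x. iexp (t * (x * f y)) \<partial>\<mu> \<partial>K)"
    by (subst P.integral_snd) (auto intro!: P.integrable_const_bound[where B = 1] simp: split_beta')
  also have "\<dots> = (\<integral>y. char \<mu> (t * f y) \<partial>K)"
    unfolding char_def by (simp add: mult_ac)
  finally show ?thesis .
qed

lemma real_distribution_pair_distr:
  fixes f :: "_ \<Rightarrow> real"
  assumes "prob_space \<mu>" "prob_space K" and "f \<in> borel_measurable (\<mu> \<Otimes>\<^sub>M K)"
  shows "real_distribution (distr (\<mu> \<Otimes>\<^sub>M K) borel f)"
proof -
  interpret \<mu>: prob_space \<mu> by fact
  interpret K: prob_space K by fact
  interpret P: pair_prob_space \<mu> K ..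
  show ?thesis using assms by simp
qed

lemma char_convolution:
  assumes "real_distribution \<mu>" "real_distribution \<nu>"
  shows "char (convolution \<mu> \<nu>) t = char \<mu> t * char \<nu> t"
proof -
  interpret \<mu>: real_distribution \<mu> by fact
  interpret \<nu>: real_distribution \<nu> by fact
  interpret P: pair_prob_space \<mu> \<nu> ..
  have "char (convolution \<mu> \<nu>) t = (\<integral>z. iexp (t * (fst z + snd z)) \<partial>(\<mu> \<Otimes>\<^sub>M \<nu>))"
    unfolding char_def convolution_def by (subst integral_distr) (auto simp: split_beta')
  also have "\<dots> = (\<integral>x. \<integral>y. iexp (t * (x + y)) \<partial>\<nu> \<partial>\<mu>)"
    by (subst P.integral_fst'[symmetric]) (auto intro!: P.integrable_const_bound[where B = 1] simp: split_beta')
  also have "\<dots> = (\<integral>x. \<integral>y. iexp (t * x) * iexp (t * y) \<partial>\<nu> \<partial>\<mu>)"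
    by (simp add: distrib_left exp_add)
  also have "\<dots> = char \<mu> t * char \<nu> t"
    unfolding char_def by simp
  finally show ?thesis .
qed

lemma real_distribution_convolution:
  assumes "real_distribution \<mu>" "real_distribution \<nu>"
  shows "real_distribution (convolution \<mu> \<nu>)"
proof -
  interpret \<mu>: real_distribution \<mu> by fact
  interpret \<nu>: real_distribution \<nu> by fact
  show ?thesis unfolding convolution_def
    by (rule real_distribution_pair_distr) (auto intro: \<mu>.prob_space_axioms \<nu>.prob_space_axioms)
qed

lemma real_distribution_return: "real_distribution (return borel x)"
  by (intro real_distribution.intro prob_space_return) (auto simp: real_distribution_axioms_def)

lemma real_distribution_conv_pow:
  "real_distribution \<nu> \<Longrightarrow> real_distribution (conv_pow \<nu> n)"
  by (induction n) (auto intro: real_distribution_return real_distribution_convolution)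

lemma char_conv_pow:
  "real_distribution \<nu> \<Longrightarrow> char (conv_pow \<nu> n) t = char \<nu> t ^ n"
proof (induction n)
  case 0
  show ?case by (simp add: char_def integral_return)
next
  case (Suc n)
  thus ?case by (simp add: char_convolution real_distribution_conv_pow)
qed

section \<open>The Laplace law and its characteristic function\<close>

lemma nn_integral_laplace_density:
  "(\<integral>\<^sup>+x. ennreal (exp (- \<bar>x\<bar>) / 2) \<partial>lborel) = 1"
proof -
  let ?f = "\<lambda>x::real. ennreal (if 0 < x then x powr (1 - 1) * exp (- 1 * x) else 0)"
  have f: "(\<integral>\<^sup>+x. ?f x \<partial>lborel) = 1"
    using nn_integral_Gamma_scaled[of 1 1] by simp
  hence g: "(\<integral>\<^sup>+x. ?f (- x) \<partial>lborel) = 1"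
    by (subst (asm) nn_integral_lborel_scale[where c = "-1"]) (simp_all cong: if_cong)
  have "(\<integral>\<^sup>+x. ennreal (exp (- \<bar>x\<bar>) / 2) \<partial>lborel) = (\<integral>\<^sup>+x. ennreal (1/2) * (?f x + ?f (- x)) \<partial>lborel)"
  proof (intro nn_integral_cong_AE)
    show "AE x in lborel. ennreal (exp (- \<bar>x\<bar>) / 2) = ennreal (1/2) * (?f x + ?f (- x))"
      using AE_lborel_singleton[of 0]
    proof eventually_elim
      fix x :: real assume "x \<noteq> 0"
      hence "?f x + ?f (- x) = ennreal (exp (- \<bar>x\<bar>))" by auto
      moreover have "ennreal (1/2) * ennreal (exp (- \<bar>x\<bar>)) = ennreal (exp (- \<bar>x\<bar>) / 2)"
        by (subst ennreal_mult'[symmetric]) auto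
      ultimately show "ennreal (exp (- \<bar>x\<bar>) / 2) = ennreal (1/2) * (?f x + ?f (- x))" by simp
    qed
  qed
  also have "\<dots> = ennreal (1/2) * (1 + 1)"
    by (subst nn_integral_cmult, simp, subst nn_integral_add) (simp_all only: f g, auto)
  also have "\<dots> = ennreal (1/2) * ennreal 2"
    by simp
  also have "\<dots> = 1"
    by (subst ennreal_mult'[symmetric]) auto
  finally show ?thesis .
qed

lemma real_distribution_laplace_distr: "real_distribution laplace_distr"
  unfolding laplace_distr_def by (rule real_distribution_density) (auto simp: nn_integral_laplace_density)

text \<open>The antiderivative exp(x a) / a vanishes at infinity because Re a < 0. Complex a is
  essential: the two halves of the Laplace density lead to the rates i t - 1 and - i t - 1.\<close>

lemma has_bochner_integral_exp_halfline:
  assumes "Re a < 0"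
  shows "has_bochner_integral lborel (\<lambda>x. indicator {0<..} x *\<^sub>R exp (complex_of_real x * a)) (- 1 / a)"
proof -
  have a: "a \<noteq> 0" using assms by auto
  have ein: "einterval 0 \<infinity> = {0<..}" by (auto simp: einterval_def)
  have int: "set_integrable lborel {0<..} (\<lambda>x. exp (complex_of_real x * a))"
    unfolding set_integrable_def
  proof (rule integrableI_bounded)
    have "(\<integral>\<^sup>+x. ennreal (norm (indicator {0<..} x *\<^sub>R exp (complex_of_real x * a))) \<partial>lborel) =
      (\<integral>\<^sup>+x. ennreal (if 0 < x then x powr (1 - 1) * exp (- (- Re a) * x) else 0) \<partial>lborel)"
      by (intro nn_integral_cong) (auto simp: indicator_def mult.commute)
    also have "\<dots> = ennreal (Gamma 1 * (- Re a) powr (- 1))"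
      using assms by (intro nn_integral_Gamma_scaled) auto
    finally show "(\<integral>\<^sup>+x. ennreal (norm (indicator {0<..} x *\<^sub>R exp (complex_of_real x * a))) \<partial>lborel) < \<infinity>"
      by simp
  qed simp
  have deriv: "((\<lambda>x. exp (complex_of_real x * a) / a) has_vector_derivative exp (complex_of_real x * a)) (at x)" for x
  proof -
    have "((\<lambda>z. exp (z * a) / a) has_field_derivative exp (complex_of_real x * a)) (at (complex_of_real x))"
      using a by (auto intro!: derivative_eq_intros)
    from has_vector_derivative_real_field[OF this] show ?thesis by (simp add: comp_def)
  qed
  have "(LBINT x=0..\<infinity>. exp (complex_of_real x * a)) = 0 - 1 / a"
  proof (rule interval_integral_FTC_integrable[where F = "\<lambda>x. exp (complex_of_real x * a) / a"])
    show "set_integrable lborel (einterval 0 \<infinity>) (\<lambda>x. exp (complex_of_real x * a))"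
      using int by (simp add: ein)
    have "((\<lambda>x. exp (complex_of_real x * a) / a) \<longlongrightarrow> exp (complex_of_real 0 * a) / a) (at_right 0)"
      by (intro tendsto_intros a)
    thus "(((\<lambda>x. exp (complex_of_real x * a) / a) \<circ> real_of_ereal) \<longlongrightarrow> 1 / a) (at_right 0)"
      by (auto simp: ereal_tendsto_simps zero_ereal_def)
    have "filterlim (\<lambda>x. Re a * x) at_bot at_top"
      by (rule filterlim_tendsto_neg_mult_at_bot[OF tendsto_const assms filterlim_ident])
    hence "((\<lambda>x. exp (x * Re a)) \<longlongrightarrow> 0) at_top"
      by (intro filterlim_compose[OF exp_at_bot]) (simp add: mult.commute)
    hence "((\<lambda>x. norm (exp (complex_of_real x * a))) \<longlongrightarrow> 0) at_top" by simp
    hence "((\<lambda>x. exp (complex_of_real x * a)) \<longlongrightarrow> 0) at_top" by (rule tendsto_norm_zero_cancel)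
    hence "((\<lambda>x. exp (complex_of_real x * a) / a) \<longlongrightarrow> 0) at_top" using tendsto_divide[OF _ tendsto_const a] by fastforce
    thus "(((\<lambda>x. exp (complex_of_real x * a) / a) \<circ> real_of_ereal) \<longlongrightarrow> 0) (at_left \<infinity>)"
      by (auto simp: ereal_tendsto_simps)
  qed (auto intro!: deriv)
  hence "(LBINT x:{0<..}. exp (complex_of_real x * a)) = - 1 / a"
    by (simp add: interval_lebesgue_integral_def ein)
  thus ?thesis
    using int by (simp add: has_bochner_integral_iff set_integrable_def set_lebesgue_integral_def)
qed

lemma char_laplace_distr: "char laplace_distr t = complex_of_real (1 / (1 + t\<^sup>2))"
proof -
  define h where "h t x = indicator {0<..} x *\<^sub>R exp (complex_of_real x * (\<i> * t - 1))" for t x :: real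
  have h: "has_bochner_integral lborel (h t) (1 / (1 - \<i> * t))" for t
  proof -
    have "1 / (1 - \<i> * t) = - 1 / (\<i> * t - 1)"
      by (metis minus_diff_eq minus_divide_left minus_divide_right)
    thus ?thesis unfolding h_def using has_bochner_integral_exp_halfline[of "\<i> * t - 1"] by simp
  qed
  \<comment> \<open>The left half of the density is the right half reflected, which also changes the
    sign of t.\<close>
  have h': "has_bochner_integral lborel (\<lambda>x. h (- t) (- x)) (1 / (1 + \<i> * t))"
    using lborel_has_bochner_integral_real_affine_iff[of "-1" "h (- t)" "1 / (1 + \<i> * t)" 0] h[of "- t"] by simp
  have "char laplace_distr t = (\<integral>x. (exp (- \<bar>x\<bar>) / 2) *\<^sub>R iexp (t * x) \<partial>lborel)"
    unfolding char_def laplace_distr_def by (subst integral_density) auto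
  also have "\<dots> = (\<integral>x. (1 / 2) *\<^sub>R (h t x + h (- t) (- x)) \<partial>lborel)"
  proof (rule integral_cong_AE, goal_cases)
    case 3
    show ?case
      using AE_lborel_singleton[of 0]
    proof eventually_elim
      fix x :: real assume "x \<noteq> 0"
      hence "h t x + h (- t) (- x) = exp (complex_of_real (- \<bar>x\<bar>) + \<i> * complex_of_real (t * x))"
        by (cases "x > 0") (simp_all add: h_def algebra_simps)
      also have "\<dots> = exp (- \<bar>x\<bar>) *\<^sub>R iexp (t * x)"
        by (simp only: exp_add exp_of_real scaleR_conv_of_real)
      finally show "(exp (- \<bar>x\<bar>) / 2) *\<^sub>R iexp (t * x) = (1 / 2) *\<^sub>R (h t x + h (- t) (- x))"
        by simp
    qed
  qed (auto simp: h_def)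
  also have "\<dots> = (1 / 2) *\<^sub>R (1 / (1 - \<i> * t) + 1 / (1 + \<i> * t))"
    using has_bochner_integral_add[OF h[of t] h'] by (simp add: has_bochner_integral_iff)
  also have "\<dots> = complex_of_real (1 / (1 + t\<^sup>2))"
  proof -
    have "1 - \<i> * t \<noteq> 0" "1 + \<i> * t \<noteq> 0" by (auto simp: complex_eq_iff)
    hence "(1 / (1 - \<i> * t) + 1 / (1 + \<i> * t)) = 2 / ((1 - \<i> * t) * (1 + \<i> * t))"
      by (simp add: field_simps)
    also have "(1 - \<i> * t) * (1 + \<i> * t) = complex_of_real (1 + t\<^sup>2)"
      by (simp add: algebra_simps power2_eq_square)
    finally show ?thesis by (simp add: scaleR_conv_of_real)
  qed
  finally show ?thesis .
qed

section \<open>Levy's continuity theorem with existence of the limit law\<close>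

text \<open>The truncation inequality for tightness, with a Gaussian weight: by
  \<open>char_swap\<close> the average on the right is E exp(-(x/j)^2 / 2), and the exponential is
  at most 1/2 as soon as |x| \<ge> 2 j. The factor 2 compensates this 1/2.\<close>

lemma gaussian_tail_bound:
  assumes "real_distribution \<mu>" and j: "0 < (j::real)"
  shows "measure \<mu> {x. 2 * j \<le> \<bar>x\<bar>} \<le> 2 * (1 - Re (\<integral>y. char \<mu> (y / j) \<partial>std_normal_distr))"
proof -
  interpret \<mu>: real_distribution \<mu> by fact
  have "(\<integral>y. char \<mu> (1 / j * y) \<partial>std_normal_distr) = (\<integral>x. char std_normal_distr (1 / j * x) \<partial>\<mu>)"
    by (rule char_swap[OF assms(1) real_distribution_std_normal_distr])
  also have "\<dots> = complex_of_real (\<integral>x. exp (- ((x / j)\<^sup>2 / 2)) \<partial>\<mu>)"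
    unfolding char_std_normal_distr by simp
  finally have *: "Re (\<integral>y. char \<mu> (y / j) \<partial>std_normal_distr) = (\<integral>x. exp (- ((x / j)\<^sup>2 / 2)) \<partial>\<mu>)"
    by simp
  have int: "integrable \<mu> (\<lambda>x. exp (- ((x / j)\<^sup>2 / 2)))"
    by (rule \<mu>.integrable_const_bound[where B = 1]) auto
  have "(\<integral>x. indicator {x. 2 * j \<le> \<bar>x\<bar>} x \<partial>\<mu>) \<le> (\<integral>x. 2 * (1 - exp (- ((x / j)\<^sup>2 / 2))) \<partial>\<mu>)"
  proof (rule integral_mono)
    fix x :: real
    show "indicator {x. 2 * j \<le> \<bar>x\<bar>} x \<le> 2 * (1 - exp (- ((x / j)\<^sup>2 / 2)))"
    proof (cases "2 * j \<le> \<bar>x\<bar>")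
      case True
      have "2 \<le> \<bar>x / j\<bar>" using True j by (simp add: field_simps)
      hence "2\<^sup>2 \<le> \<bar>x / j\<bar>\<^sup>2" by (intro power_mono) auto
      hence "4 \<le> (x / j)\<^sup>2" unfolding power2_abs by simp
      hence "- ((x / j)\<^sup>2 / 2) \<le> - 1" by linarith
      hence "exp (- ((x / j)\<^sup>2 / 2)) \<le> exp (- 1)" by simp
      also have "exp (- 1) \<le> (1 / 2 :: real)"
        using exp_ge_add_one_self[of 1] by (simp add: exp_minus field_simps)
      finally show ?thesis using True by simp
    qed auto
  qed (use int in \<open>auto intro!: \<mu>.integrable_const_bound[where B = 1]\<close>)
  also have "\<dots> = 2 * (1 - (\<integral>x. exp (- ((x / j)\<^sup>2 / 2)) \<partial>\<mu>))"
    using int by (simp add: \<mu>.prob_space[simplified])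
  finally show ?thesis unfolding * by simp
qed

lemma real_distribution_tight_single:
  assumes "real_distribution \<mu>" "0 < e"
  shows "eventually (\<lambda>k::nat. measure \<mu> {x. real k \<le> \<bar>x\<bar>} < e) sequentially"
proof -
  interpret \<mu>: real_distribution \<mu> by fact
  have "(\<lambda>k. measure \<mu> {x. real k \<le> \<bar>x\<bar>}) \<longlonglongrightarrow> measure \<mu> (\<Inter>k::nat. {x. real k \<le> \<bar>x\<bar>})"
    by (rule \<mu>.finite_Lim_measure_decseq) (auto simp: decseq_def)
  moreover have "(\<Inter>k::nat. {x. real k \<le> \<bar>x\<bar>}) = {}"
    by (auto simp: set_eq_iff not_le intro!: reals_Archimedean2)
  ultimately show ?thesis using \<open>0 < e\<close> by (simp add: order_tendstoD(2))
qed

text \<open>Tightness comes from the Gaussian tail bound: for a fixed scale it passes to the limit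
  in n, and the limiting bound becomes small as the scale grows. A convergent subsequence then
  supplies M with characteristic function \<phi>, after which the whole sequence converges to
  M.\<close>

theorem levy_continuity_exists:
  assumes \<mu>: "\<And>n. real_distribution (\<mu> n)"
    and lim: "\<And>t. (\<lambda>n. char (\<mu> n) t) \<longlonglongrightarrow> \<phi> t"
    and cont: "isCont \<phi> 0"
  shows "\<exists>M. real_distribution M \<and> char M = \<phi> \<and> weak_conv_m \<mu> M"
proof -
  interpret \<mu>: real_distribution "\<mu> n" for n by (rule \<mu>)
  interpret N: real_distribution std_normal_distr by (rule real_distribution_std_normal_distr)
  have \<phi>0: "\<phi> 0 = 1"
    using lim[of 0] by (simp add: \<mu>.char_zero LIMSEQ_const_iff)
  have \<phi>_le: "norm (\<phi> t) \<le> 1" for t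
    by (rule LIMSEQ_le_const2[OF tendsto_norm[OF lim]]) (auto intro: \<mu>.cmod_char_le_1)
  have \<phi>_meas [measurable]: "\<phi> \<in> borel_measurable borel"
    by (rule borel_measurable_LIMSEQ_metric[OF _ lim]) (rule \<mu>.char_measurable)
  have char_meas [measurable]: "char (\<mu> n) \<in> borel_measurable borel" for n
    by (rule \<mu>.char_measurable)
  have tail_n: "(\<lambda>n. \<integral>y. char (\<mu> n) (y / j) \<partial>std_normal_distr) \<longlonglongrightarrow> (\<integral>y. \<phi> (y / j) \<partial>std_normal_distr)" for j :: real
    by (rule integral_dominated_convergence[where w = "\<lambda>_. 1"])
       (auto intro!: lim \<mu>.cmod_char_le_1)
  \<comment> \<open>Here continuity at 0 enters: the rescaled arguments tend to 0, where \<phi>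
    equals 1.\<close>
  have tail_j: "(\<lambda>j. \<integral>y. \<phi> (y / real (Suc j)) \<partial>std_normal_distr) \<longlonglongrightarrow> (\<integral>y. 1 \<partial>std_normal_distr)"
  proof (rule integral_dominated_convergence[where w = "\<lambda>_. 1"])
    show "AE y in std_normal_distr. (\<lambda>j. \<phi> (y / real (Suc j))) \<longlonglongrightarrow> 1"
    proof (rule AE_I2)
      fix y :: real
      have "(\<lambda>j. y * inverse (real (Suc j))) \<longlonglongrightarrow> y * 0"
        by (intro tendsto_intros LIMSEQ_inverse_real_of_nat)
      hence "(\<lambda>j. y / real (Suc j)) \<longlonglongrightarrow> 0"
        by (simp add: divide_inverse)
      thus "(\<lambda>j. \<phi> (y / real (Suc j))) \<longlonglongrightarrow> 1"
        using isCont_tendsto_compose[OF cont] \<phi>0 by simp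
    qed
  qed (auto intro!: \<phi>_le)
  have tight: "tight \<mu>"
    unfolding tight_def
  proof (intro conjI allI impI \<mu>)
    fix e :: real assume e: "0 < e"
    have "(\<lambda>j. 2 * (1 - Re (\<integral>y. \<phi> (y / real (Suc j)) \<partial>std_normal_distr))) \<longlonglongrightarrow> 2 * (1 - Re (\<integral>y. 1 \<partial>std_normal_distr))"
      by (intro tendsto_intros tail_j)
    hence "(\<lambda>j. 2 * (1 - Re (\<integral>y. \<phi> (y / real (Suc j)) \<partial>std_normal_distr))) \<longlonglongrightarrow> 0"
      using N.prob_space by simp
    from eventually_happens[OF order_tendstoD(2)[OF this e]]
    obtain j where j: "2 * (1 - Re (\<integral>y. \<phi> (y / real (Suc j)) \<partial>std_normal_distr)) < e"
      by auto
    have "(\<lambda>n. 2 * (1 - Re (\<integral>y. char (\<mu> n) (y / real (Suc j)) \<partial>std_normal_distr)))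
      \<longlonglongrightarrow> 2 * (1 - Re (\<integral>y. \<phi> (y / real (Suc j)) \<partial>std_normal_distr))"
      by (intro tendsto_intros tail_n)
    from order_tendstoD(2)[OF this j] obtain n0 where
      n0: "\<And>n. n \<ge> n0 \<Longrightarrow> 2 * (1 - Re (\<integral>y. char (\<mu> n) (y / real (Suc j)) \<partial>std_normal_distr)) < e"
      by (auto simp: eventually_sequentially)
    \<comment> \<open>The Gaussian bound controls only n \<ge> n0; the finitely many earlier laws
      are tight one at a time.\<close>
    have "eventually (\<lambda>k. \<forall>n\<in>{..<n0}. measure (\<mu> n) {x. real k \<le> \<bar>x\<bar>} < e) sequentially"
      by (intro eventually_ball_finite ballI real_distribution_tight_single \<mu> e) auto
    from eventually_happens'[OF sequentially_bot this]
    obtain k where k: "\<And>n. n < n0 \<Longrightarrow> measure (\<mu> n) {x. real k \<le> \<bar>x\<bar>} < e"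
      by blast
    define b where "b = max (real k) (2 * real (Suc j))"
    have tail: "measure (\<mu> n) {x. b \<le> \<bar>x\<bar>} < e" for n
    proof (cases "n < n0")
      case True
      have "measure (\<mu> n) {x. b \<le> \<bar>x\<bar>} \<le> measure (\<mu> n) {x. real k \<le> \<bar>x\<bar>}"
        by (rule \<mu>.finite_measure_mono) (auto simp: b_def)
      with k[OF True] show ?thesis by simp
    next
      case False
      have "measure (\<mu> n) {x. b \<le> \<bar>x\<bar>} \<le> measure (\<mu> n) {x. 2 * real (Suc j) \<le> \<bar>x\<bar>}"
        by (rule \<mu>.finite_measure_mono) (auto simp: b_def)
      also have "\<dots> \<le> 2 * (1 - Re (\<integral>y. char (\<mu> n) (y / real (Suc j)) \<partial>std_normal_distr))"
        by (rule gaussian_tail_bound[OF \<mu>]) simp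
      finally show ?thesis using n0[of n] False by simp
    qed
    have "1 - e < measure (\<mu> n) {- b<..b}" for n
    proof -
      have "1 - measure (\<mu> n) {x. b \<le> \<bar>x\<bar>} = measure (\<mu> n) (space (\<mu> n) - {x. b \<le> \<bar>x\<bar>})"
        by (rule \<mu>.prob_compl[symmetric]) auto
      also have "\<dots> \<le> measure (\<mu> n) {- b<..b}"
        by (rule \<mu>.finite_measure_mono) (auto simp: abs_real_def not_le split: if_splits)
      finally show ?thesis using tail[of n] by simp
    qed
    moreover have "- b < b" by (auto simp: b_def)
    ultimately show "\<exists>a b. a < b \<and> (\<forall>n. 1 - e < measure (\<mu> n) {a<..b})" by blast
  qed
  obtain r M where r: "strict_mono r" and M: "real_distribution M" and "weak_conv_m (\<mu> \<circ> id \<circ> r) M"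
    using tight_imp_convergent_subsubsequence[OF tight strict_mono_id] by blast
  hence conv: "weak_conv_m (\<lambda>n. \<mu> (r n)) M" by (simp add: comp_def)
  have char_M: "char M t = \<phi> t" for t
  proof (rule LIMSEQ_unique)
    show "(\<lambda>n. char (\<mu> (r n)) t) \<longlonglongrightarrow> char M t"
      by (rule levy_continuity1[OF _ M conv]) (rule \<mu>)
    show "(\<lambda>n. char (\<mu> (r n)) t) \<longlonglongrightarrow> \<phi> t"
      using LIMSEQ_subseq_LIMSEQ[OF lim r] by (simp add: comp_def)
  qed
  moreover have "weak_conv_m \<mu> M"
    by (rule levy_continuity[OF \<mu> M]) (simp add: char_M lim)
  ultimately show ?thesis using M by blast
qed

section \<open>Sibuya coefficients\<close>

text \<open>With g u = Ln (1 + u) / u, extended by g 0 = 1 to a function continuous at 0, the power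
  equals exp (x n * g (x n / n)) once |x n / n| < 1. The value at 0 also covers the indices with x n
  = 0.\<close>

lemma complex_tendsto_exp_limit:
  fixes x :: "nat \<Rightarrow> complex"
  assumes x: "x \<longlonglongrightarrow> l"
  shows "(\<lambda>n. (1 + x n / of_nat n) ^ n) \<longlonglongrightarrow> exp l"
proof -
  define g where "g u = (if u = 0 then 1 else Ln (1 + u) / u)" for u :: complex
  have "((\<lambda>u. Ln (1 + u)) has_field_derivative 1) (at 0)"
    by (auto intro!: derivative_eq_intros)
  hence "(\<lambda>u. Ln (1 + u) / u) \<midarrow>0\<rightarrow> 1"
    by (simp add: has_field_derivative_iff)
  hence "g \<midarrow>0\<rightarrow> 1"
    by (rule Lim_transform_eventually) (auto simp: g_def eventually_at_filter)
  hence g: "isCont g 0" by (simp add: isCont_def g_def)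
  have "(\<lambda>n. x n * (1 / of_nat n)) \<longlonglongrightarrow> l * 0"
    by (intro tendsto_mult x lim_1_over_n)
  hence u: "(\<lambda>n. x n / of_nat n) \<longlonglongrightarrow> 0" by simp
  have "(\<lambda>n. exp (x n * g (x n / of_nat n))) \<longlonglongrightarrow> exp (l * g 0)"
    by (intro tendsto_intros x isCont_tendsto_compose[OF g] u)
  hence "(\<lambda>n. exp (x n * g (x n / of_nat n))) \<longlonglongrightarrow> exp l" by (simp add: g_def)
  moreover have "eventually (\<lambda>n. exp (x n * g (x n / of_nat n)) = (1 + x n / of_nat n) ^ n) sequentially"
    using tendstoD[OF u zero_less_one] eventually_gt_at_top[of 0]
  proof eventually_elim
    case (elim n)
    define v where "v = x n / of_nat n"
    have v: "norm v < 1" using elim(1) by (simp add: v_def)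
    hence nz: "1 + v \<noteq> 0" by (auto simp: add_eq_0_iff)
    have "Ln (1 + v) = v * g v" by (simp add: g_def)
    moreover have "x n = of_nat n * v" using elim by (simp add: v_def)
    ultimately have "x n * g v = of_nat n * Ln (1 + v)" by simp
    hence "exp (x n * g v) = (1 + v) ^ n" using nz by (simp add: exp_of_nat_mult)
    thus ?case by (simp add: v_def)
  qed
  ultimately show ?thesis by (rule Lim_transform_eventually)
qed

lemma gbinomial_of_real:
  "complex_of_real a gchoose k = complex_of_real (a gchoose k)"
  by (simp add: gbinomial_prod_rev)

text \<open>The Sibuya distribution, given by the Taylor coefficients of 1 - (1 - z)^\<beta>. Its
  tail is regularly varying with index \<beta>, which places its sums in the domain of attraction of
  the one-sided \<beta>-stable law.\<close>

definition sibuya_coeff :: "real \<Rightarrow> nat \<Rightarrow> real" where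
  "sibuya_coeff \<beta> k = (if k = 0 then 0 else - ((- 1) ^ k * (\<beta> gchoose k)))"

context
  fixes \<beta> :: real
  assumes \<beta>: "0 < \<beta>" "\<beta> < 1"
begin

text \<open>Consecutive coefficients have the ratio (k - \<beta>) / (k + 1), positive for k \<ge> 1
  because \<beta> < 1; the recursion starts from the value \<beta> at k = 1.\<close>

lemma sibuya_coeff_nonneg: "0 \<le> sibuya_coeff \<beta> k"
proof -
  have "0 \<le> sibuya_coeff \<beta> (Suc k)" for k
  proof (induction k)
    case 0
    show ?case using \<beta> by (simp add: sibuya_coeff_def)
  next
    case (Suc k)
    have "sibuya_coeff \<beta> (Suc (Suc k)) = sibuya_coeff \<beta> (Suc k) * ((real (Suc k) - \<beta>) / real (Suc (Suc k)))"
      by (simp add: sibuya_coeff_def gbinomial_prod_rev field_simps)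
    thus ?case using Suc \<beta> by simp
  qed
  thus ?thesis by (cases k) (auto simp: sibuya_coeff_def)
qed

lemma sibuya_coeff_sums:
  assumes "norm (w::complex) < 1"
  shows "(\<lambda>k. of_real (sibuya_coeff \<beta> k) * w ^ k) sums (1 - (1 - w) powr of_real \<beta>)"
proof -
  have "(\<lambda>k. (of_real \<beta> gchoose k) * (- w) ^ k) sums (1 + (- w)) powr of_real \<beta>"
    by (rule gen_binomial_complex) (use assms in simp)
  hence "(\<lambda>k. (if k = 0 then 1 else 0) - (of_real \<beta> gchoose k) * (- w) ^ k) sums (1 - (1 + (- w)) powr of_real \<beta>)"
    by (intro sums_diff) (use sums_single[of 0 "\<lambda>_. 1 :: complex"] in auto)
  moreover have "(if k = 0 then 1 else 0) - (of_real \<beta> gchoose k) * (- w) ^ k = of_real (sibuya_coeff \<beta> k) * w ^ k" for k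
    by (auto simp: sibuya_coeff_def gbinomial_of_real power_minus[of w])
  ultimately show ?thesis by simp
qed

text \<open>For x < 1 the partial sums are bounded by 1 - (1 - x)^\<beta> \<le> 1. Each partial sum
  is a polynomial in x, so the bound survives x -> 1 without any asymptotics of the
  coefficients.\<close>

lemma sibuya_coeff_summable: "summable (sibuya_coeff \<beta>)"
proof (rule summableI_nonneg_bounded)
  fix n
  have le: "(\<Sum>k<n. sibuya_coeff \<beta> k * x ^ k) \<le> 1" if x: "0 < x" "x < 1" for x
  proof -
    have "(\<lambda>k. complex_of_real (sibuya_coeff \<beta> k * x ^ k)) sums complex_of_real (1 - (1 - x) powr \<beta>)"
      using sibuya_coeff_sums[of "of_real x"] x powr_of_real[of "1 - x" \<beta>] by simp
    hence "(\<lambda>k. sibuya_coeff \<beta> k * x ^ k) sums (1 - (1 - x) powr \<beta>)"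
      by (rule sums_of_real_iff[THEN iffD1])
    hence "(\<Sum>k<n. sibuya_coeff \<beta> k * x ^ k) \<le> 1 - (1 - x) powr \<beta>"
      using x by (intro sum_le_suminf[of "\<lambda>k. sibuya_coeff \<beta> k * x ^ k" "{..<n}", THEN order_trans])
        (auto simp: sums_iff sibuya_coeff_nonneg)
    thus ?thesis by (smt (verit) powr_ge_zero)
  qed
  have "((\<lambda>x. \<Sum>k<n. sibuya_coeff \<beta> k * x ^ k) \<longlongrightarrow> (\<Sum>k<n. sibuya_coeff \<beta> k * 1 ^ k)) (at_left 1)"
    by (intro tendsto_intros)
  moreover have "eventually (\<lambda>x. (\<Sum>k<n. sibuya_coeff \<beta> k * x ^ k) \<le> 1) (at_left (1::real))"
    using eventually_at_left_real[of 0 1] by (auto elim!: eventually_mono intro: le)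
  ultimately have "(\<Sum>k<n. sibuya_coeff \<beta> k * 1 ^ k) \<le> 1"
    by (rule tendsto_upperbound) simp
  thus "(\<Sum>k<n. sibuya_coeff \<beta> k) \<le> 1" by simp
qed (rule sibuya_coeff_nonneg)

text \<open>Characteristic functions need |w| = 1, the boundary of the disc of convergence. Both
  sides are continuous on the closed disc, the series by the M-test and the power because 1 - z
  stays in the closed right half-plane, so the identity extends from the open disc.\<close>

lemma sibuya_coeff_sums_closed:
  assumes w: "norm (w::complex) \<le> 1"
  shows "(\<lambda>k. of_real (sibuya_coeff \<beta> k) * w ^ k) sums (1 - (1 - w) powr of_real \<beta>)"
proof -
  have bound: "norm (of_real (sibuya_coeff \<beta> k) * z ^ k) \<le> sibuya_coeff \<beta> k" if "z \<in> cball 0 1" for z :: complex and k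
    using that sibuya_coeff_nonneg[of k]
    by (auto simp: norm_mult norm_power intro!: mult_left_le power_le_one)
  have cont1: "continuous_on (cball 0 1) (\<lambda>z::complex. \<Sum>k. of_real (sibuya_coeff \<beta> k) * z ^ k)"
    by (rule uniform_limit_theorem[OF _ Weierstrass_m_test[OF bound sibuya_coeff_summable]])
       (auto intro!: always_eventually continuous_intros)
  have Re: "0 \<le> Re (1 - z)" if "z \<in> cball 0 1" for z :: complex
    using that complex_Re_le_cmod[of z] by simp
  have cont2: "continuous_on (cball 0 1) (\<lambda>z::complex. 1 - (1 - z) powr of_real \<beta>)"
    by (intro continuous_intros continuous_on_powr_complex) (use Re \<beta> in auto)
  have "(\<Sum>k. of_real (sibuya_coeff \<beta> k) * w ^ k) - (1 - (1 - w) powr of_real \<beta>) = 0"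
  proof (rule continuous_constant_on_closure[where S = "ball 0 1" and f = "\<lambda>w. (\<Sum>k. of_real (sibuya_coeff \<beta> k) * w ^ k) - (1 - (1 - w) powr of_real \<beta>)"])
    show "continuous_on (closure (ball 0 1)) (\<lambda>w::complex. (\<Sum>k. of_real (sibuya_coeff \<beta> k) * w ^ k) - (1 - (1 - w) powr of_real \<beta>))"
      using cont1 cont2 by (auto intro: continuous_on_diff)
    show "w \<in> closure (ball 0 1)" using w by simp
  qed (use sibuya_coeff_sums in \<open>auto simp: sums_iff\<close>)
  moreover have "summable (\<lambda>k. of_real (sibuya_coeff \<beta> k) * w ^ k)"
    by (rule summable_comparison_test'[OF sibuya_coeff_summable]) (use bound w in auto)
  ultimately show ?thesis by (simp add: sums_iff)
qed

definition sibuya_pmf :: "nat pmf" where "sibuya_pmf = embed_pmf (sibuya_coeff \<beta>)"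

lemma pmf_sibuya: "pmf sibuya_pmf k = sibuya_coeff \<beta> k"
  unfolding sibuya_pmf_def
proof (rule pmf_embed_pmf)
  have "(\<lambda>k. complex_of_real (sibuya_coeff \<beta> k)) sums complex_of_real 1"
    using sibuya_coeff_sums_closed[of 1] \<beta> by simp
  hence "sibuya_coeff \<beta> sums 1" by (rule sums_of_real_iff[THEN iffD1])
  thus "(\<integral>\<^sup>+x. ennreal (sibuya_coeff \<beta> x) \<partial>count_space UNIV) = 1"
    by (subst nn_integral_count_space_nat) (simp add: suminf_ennreal2 sibuya_coeff_nonneg sums_iff)
qed (rule sibuya_coeff_nonneg)

lemma sibuya_pgf:
  assumes w: "norm (w::complex) \<le> 1"
  shows "(\<integral>k. w ^ k \<partial>measure_pmf sibuya_pmf) = 1 - (1 - w) powr of_real \<beta>"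
proof -
  have abs: "summable (\<lambda>k. norm (sibuya_coeff \<beta> k *\<^sub>R w ^ k))"
    by (rule summable_comparison_test'[OF sibuya_coeff_summable])
       (use w sibuya_coeff_nonneg in \<open>auto simp: norm_power intro!: mult_left_le power_le_one\<close>)
  have "(\<integral>k. w ^ k \<partial>measure_pmf sibuya_pmf) = (\<integral>k. sibuya_coeff \<beta> k *\<^sub>R w ^ k \<partial>count_space UNIV)"
    unfolding measure_pmf_eq_density pmf_sibuya by (rule integral_density) (auto simp: sibuya_coeff_nonneg)
  also have "\<dots> = (\<Sum>k. sibuya_coeff \<beta> k *\<^sub>R w ^ k)"
    using abs by (intro integral_count_space_nat) (simp add: integrable_count_space_nat_iff)
  finally show ?thesis using sibuya_coeff_sums_closed[OF w] by (simp add: sums_iff scaleR_conv_of_real)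
qed

text \<open>With \<epsilon> = n^(-1/\<beta>), the difference 1 - exp(-w \<epsilon>) behaves like w
  \<epsilon>, whose \<beta>-th power is w^\<beta> / n. The half-plane Re w \<ge> 0 contains both w =
  -i t for the characteristic function and w = l for the Laplace transform.\<close>

lemma sibuya_limit:
  assumes w: "0 \<le> Re w"
  shows "(\<lambda>n. (1 - (1 - exp (- w * of_real (real n powr (- 1 / \<beta>)))) powr of_real \<beta>) ^ n) \<longlonglongrightarrow> exp (- (w powr of_real \<beta>))"
\<comment> \<open>The complex power is treated by continuity off the branch cut, which excludes 0;
  there both sides are simply 1.\<close>
proof (cases "w = 0")
  case True
  thus ?thesis using \<beta> by simp
next
  case False
  define \<epsilon> where "\<epsilon> n = real n powr (- 1 / \<beta>)" for n
  have w': "w \<notin> \<real>\<^sub>\<le>\<^sub>0" using w False by (auto simp: complex_nonpos_Reals_iff complex_eq_iff)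
  have "((\<lambda>s. exp (- w * s)) has_field_derivative - w) (at 0)"
    by (auto intro!: derivative_eq_intros)
  hence d: "(\<lambda>s. (exp (- w * s) - 1) / s) \<midarrow>0\<rightarrow> - w"
    by (simp add: has_field_derivative_iff)
  have "(\<lambda>n. \<epsilon> n) \<longlonglongrightarrow> 0"
    unfolding \<epsilon>_def by (rule tendsto_neg_powr) (use \<beta> in \<open>auto simp: filterlim_real_sequentially\<close>)
  from tendsto_of_real[OF this] have "(\<lambda>n. complex_of_real (\<epsilon> n)) \<longlonglongrightarrow> 0" by simp
  hence eps: "filterlim (\<lambda>n. complex_of_real (\<epsilon> n)) (at 0) sequentially"
    unfolding filterlim_at
    by (intro conjI eventually_mono[OF eventually_gt_at_top[of 0]]) (auto simp: \<epsilon>_def)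
  have "(\<lambda>n. (exp (- w * of_real (\<epsilon> n)) - 1) / of_real (\<epsilon> n)) \<longlonglongrightarrow> - w"
    by (rule filterlim_compose[OF d eps])
  from tendsto_minus[OF this] have y: "(\<lambda>n. (1 - exp (- w * of_real (\<epsilon> n))) / of_real (\<epsilon> n)) \<longlonglongrightarrow> w"
    by (simp add: minus_divide_left)
  define y where "y n = (1 - exp (- w * of_real (\<epsilon> n))) / of_real (\<epsilon> n)" for n
  have "(\<lambda>n. - (y n powr of_real \<beta>)) \<longlonglongrightarrow> - (w powr of_real \<beta>)"
    using y w' unfolding y_def[symmetric] by (intro tendsto_intros) auto
  from complex_tendsto_exp_limit[OF this]
  have "(\<lambda>n. (1 + - (y n powr of_real \<beta>) / of_nat n) ^ n) \<longlonglongrightarrow> exp (- (w powr of_real \<beta>))" .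
  moreover have "eventually (\<lambda>n. (1 + - (y n powr of_real \<beta>) / of_nat n) ^ n =
      (1 - (1 - exp (- w * of_real (\<epsilon> n))) powr of_real \<beta>) ^ n) sequentially"
    using eventually_gt_at_top[of 0]
  proof eventually_elim
    case (elim n)
    have e: "\<epsilon> n > 0" using elim by (simp add: \<epsilon>_def)
    have eq: "1 - exp (- w * of_real (\<epsilon> n)) = of_real (\<epsilon> n) * y n" using e by (simp add: y_def)
    have "complex_of_real (\<epsilon> n) powr of_real \<beta> = 1 / of_nat n"
    proof -
      have "\<epsilon> n powr \<beta> = real n powr (- 1)"
        using \<beta> unfolding \<epsilon>_def powr_powr by simp
      hence "\<epsilon> n powr \<beta> = 1 / real n"
        using elim by (simp add: powr_minus divide_inverse)
      moreover have "complex_of_real (\<epsilon> n) powr of_real \<beta> = of_real (\<epsilon> n powr \<beta>)"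
        using e by (intro powr_of_real) auto
      ultimately show ?thesis by simp
    qed
    \<comment> \<open>Splitting the complex power of this product is legitimate because its first
      factor is a positive real.\<close>
    hence "(of_real (\<epsilon> n) * y n) powr of_real \<beta> = y n powr of_real \<beta> / of_nat n"
      using e by (auto simp: powr_def Ln_times_of_real ring_distribs exp_add Ln_of_real split: if_splits)
    thus ?case unfolding eq by simp
  qed
  ultimately show ?thesis unfolding \<epsilon>_def by (rule Lim_transform_eventually)
qed

end

section \<open>One-sided stable laws\<close>

lemma AE_nonneg_conv_pow:
  assumes \<nu>: "real_distribution \<nu>" and nonneg: "AE x in \<nu>. 0 \<le> x"
  shows "AE x in conv_pow \<nu> n. 0 \<le> x"
proof (induction n)
  case 0
  show ?case unfolding conv_pow.simps by (subst AE_return) auto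
next
  case (Suc n)
  interpret \<nu>: real_distribution \<nu> by fact
  interpret C: real_distribution "conv_pow \<nu> n" by (rule real_distribution_conv_pow[OF \<nu>])
  interpret P: pair_prob_space \<nu> "conv_pow \<nu> n" ..
  have "AE x in \<nu>. AE y in conv_pow \<nu> n. 0 \<le> x + y"
    using nonneg
  proof eventually_elim
    case (elim x)
    from Suc show ?case by eventually_elim (use elim in simp)
  qed
  moreover have "{z \<in> space (\<nu> \<Otimes>\<^sub>M conv_pow \<nu> n). 0 \<le> fst z + snd z} \<in> sets (\<nu> \<Otimes>\<^sub>M conv_pow \<nu> n)"
    by measurable
  ultimately have "AE z in (\<nu> \<Otimes>\<^sub>M conv_pow \<nu> n). 0 \<le> fst z + snd z"
    by (intro P.AE_pair_measure) auto
  thus ?case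
    unfolding conv_pow.simps convolution_def by (subst AE_distr_iff) (auto simp: split_beta')
qed

lemma nn_integral_exp_conv_pow:
  assumes \<nu>: "real_distribution \<nu>"
  shows "(\<integral>\<^sup>+x. ennreal (exp (- l * x)) \<partial>conv_pow \<nu> n) = (\<integral>\<^sup>+x. ennreal (exp (- l * x)) \<partial>\<nu>) ^ n"
proof (induction n)
  case 0
  show ?case by (simp add: nn_integral_return)
next
  case (Suc n)
  interpret \<nu>: real_distribution \<nu> by fact
  interpret C: real_distribution "conv_pow \<nu> n" by (rule real_distribution_conv_pow[OF \<nu>])
  have "(\<integral>\<^sup>+x. ennreal (exp (- l * x)) \<partial>conv_pow \<nu> (Suc n)) =
    (\<integral>\<^sup>+x. \<integral>\<^sup>+y. ennreal (exp (- l * (x + y))) \<partial>conv_pow \<nu> n \<partial>\<nu>)"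
    unfolding conv_pow.simps by (rule nn_integral_convolution) (auto intro: \<nu>.finite_measure C.finite_measure)
  also have "\<dots> = (\<integral>\<^sup>+x. \<integral>\<^sup>+y. ennreal (exp (- l * x)) * ennreal (exp (- l * y)) \<partial>conv_pow \<nu> n \<partial>\<nu>)"
    by (simp add: ennreal_mult'[symmetric] mult_exp_exp algebra_simps)
  also have "\<dots> = (\<integral>\<^sup>+x. ennreal (exp (- l * x)) \<partial>\<nu>) * (\<integral>\<^sup>+y. ennreal (exp (- l * y)) \<partial>conv_pow \<nu> n)"
    by (simp add: nn_integral_cmult nn_integral_multc)
  finally show ?case by (simp only: Suc power_Suc)
qed

text \<open>On the principal branch Ln (-i t) = ln |t| - i pi sgn t / 2. This reconciles the complex
  power in the Sibuya limit with the polar form in the definition of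
  \<open>stable_pos\<close>.\<close>

lemma minus_ii_powr:
  assumes "t \<noteq> 0"
  shows "(- \<i> * complex_of_real t) powr complex_of_real \<beta> =
    complex_of_real (\<bar>t\<bar> powr \<beta>) * exp (- \<i> * complex_of_real (pi * \<beta> * sgn t / 2))"
proof -
  have L: "Ln (- \<i> * complex_of_real t) = complex_of_real (ln \<bar>t\<bar>) - \<i> * complex_of_real (pi * sgn t / 2)"
  proof (cases "t > 0")
    case True
    thus ?thesis using Ln_times_of_real[of t "- \<i>"] by (simp add: mult.commute Ln_of_real)
  next
    case False
    hence "t < 0" using assms by simp
    thus ?thesis using Ln_times_of_real[of "- t" "\<i>"] Ln_of_real[of "- t"] by (simp add: mult.commute)
  qed
  have "(- \<i> * complex_of_real t) powr complex_of_real \<beta> =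
    exp (complex_of_real (\<beta> * ln \<bar>t\<bar>) + - \<i> * complex_of_real (pi * \<beta> * sgn t / 2))"
    using assms unfolding powr_def L by (simp add: algebra_simps)
  thus ?thesis using assms
    by (simp only: exp_add exp_of_real) (simp add: powr_def)
qed

text \<open>Support and Laplace transform are read off from the same weak limit that yields the
  characteristic function, so no analytic continuation from the imaginary axis to the half-line has
  to be carried out.\<close>

lemma stable_pos_exists:
  assumes \<beta>: "0 < \<beta>" "\<beta> < 1"
  shows "\<exists>\<rho>. real_distribution \<rho> \<and>
      (\<forall>t. char \<rho> t = exp (- (complex_of_real (\<bar>t\<bar> powr \<beta>)) *
              exp (- \<i> * complex_of_real (pi * \<beta> * sgn t / 2)))) \<and>
      (AE x in \<rho>. 0 \<le> x) \<and> (\<forall>l\<ge>0. (\<integral>x. exp (- l * x) \<partial>\<rho>) = exp (- (l powr \<beta>)))"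
proof -
  define \<epsilon> where "\<epsilon> n = real n powr (- 1 / \<beta>)" for n
  define p where "p = sibuya_pmf \<beta>"
  define \<nu> where "\<nu> n = distr (measure_pmf p) borel (\<lambda>k. \<epsilon> n * real k)" for n
  define \<mu> where "\<mu> n = conv_pow (\<nu> n) n" for n
  have eps: "0 \<le> \<epsilon> n" for n by (simp add: \<epsilon>_def)
  have \<nu>: "real_distribution (\<nu> n)" for n
    unfolding \<nu>_def by (rule prob_space.real_distribution_distr) (auto intro: measure_pmf.prob_space_axioms)
  have \<mu>: "real_distribution (\<mu> n)" for n
    unfolding \<mu>_def by (rule real_distribution_conv_pow[OF \<nu>])
  interpret \<mu>: real_distribution "\<mu> n" for n by (rule \<mu>)
  have pgf: "(\<integral>k. w ^ k \<partial>measure_pmf p) = 1 - (1 - w) powr of_real \<beta>" if "norm w \<le> 1" for w :: complex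
    unfolding p_def by (rule sibuya_pgf[OF \<beta> that])
  have real_pgf: "(\<integral>k. w ^ k \<partial>measure_pmf p) = 1 - (1 - w) powr \<beta>" if "0 \<le> w" "w \<le> 1" for w :: real
  proof -
    have "complex_of_real (\<integral>k. w ^ k \<partial>measure_pmf p) = (\<integral>k. complex_of_real w ^ k \<partial>measure_pmf p)"
      by (simp flip: of_real_power)
    also have "\<dots> = 1 - complex_of_real (1 - w) powr of_real \<beta>"
      using that by (subst pgf) auto
    also have "\<dots> = complex_of_real (1 - (1 - w) powr \<beta>)"
      using that by (subst powr_of_real) auto
    finally show ?thesis by (simp only: of_real_eq_iff)
  qed
  have "char (\<nu> n) t = 1 - (1 - exp (- (- \<i> * of_real t) * of_real (\<epsilon> n))) powr of_real \<beta>" for n t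
  proof -
    have "char (\<nu> n) t = (\<integral>k. exp (\<i> * of_real (t * \<epsilon> n)) ^ k \<partial>measure_pmf p)"
      unfolding char_def \<nu>_def
      by (subst integral_distr) (auto simp: exp_of_nat_mult[symmetric] mult_ac intro!: Bochner_Integration.integral_cong)
    thus ?thesis by (subst (asm) pgf) (simp_all add: mult_ac)
  qed
  hence char_\<mu>: "char (\<mu> n) t = (1 - (1 - exp (- (- \<i> * of_real t) * of_real (\<epsilon> n))) powr of_real \<beta>) ^ n" for n t
    unfolding \<mu>_def by (simp add: char_conv_pow \<nu>)
  define \<phi> where "\<phi> t = exp (- ((- \<i> * complex_of_real t) powr of_real \<beta>))" for t
  have lim: "(\<lambda>n. char (\<mu> n) t) \<longlonglongrightarrow> \<phi> t" for t
    unfolding char_\<mu> \<phi>_def \<epsilon>_def by (rule sibuya_limit[OF \<beta>]) simp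
  have \<phi>_eq: "\<phi> t = exp (- (complex_of_real (\<bar>t\<bar> powr \<beta>)) *
              exp (- \<i> * complex_of_real (pi * \<beta> * sgn t / 2)))" for t
    unfolding \<phi>_def using minus_ii_powr[of t \<beta>] by (cases "t = 0") auto
  have "isCont \<phi> 0"
  proof -
    have "((\<lambda>t. (- \<i> * complex_of_real t) powr of_real \<beta>) \<longlongrightarrow> (- \<i> * complex_of_real 0) powr of_real \<beta>) (at 0)"
      by (intro tendsto_intros) (use \<beta> in auto)
    hence "(\<phi> \<longlongrightarrow> \<phi> 0) (at 0)" unfolding \<phi>_def by (intro tendsto_exp tendsto_minus)
    thus ?thesis by (simp add: isCont_def)
  qed
  from levy_continuity_exists[OF \<mu> lim this] obtain \<rho> where
    \<rho>: "real_distribution \<rho>" "char \<rho> = \<phi>" and conv: "weak_conv_m \<mu> \<rho>" by blast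
  interpret \<rho>: real_distribution \<rho> by fact
  have nonneg: "AE x in \<mu> n. 0 \<le> x" for n
    unfolding \<mu>_def by (rule AE_nonneg_conv_pow[OF \<nu>]) (unfold \<nu>_def, subst AE_distr_iff, auto simp: eps)
  have nonneg_\<rho>: "AE x in \<rho>. 0 \<le> x"
  proof -
    \<comment> \<open>A bounded continuous test function that vanishes exactly on the half-line; its
      integral is 0 along the sequence, hence in the limit.\<close>
    define f where "f x = min 1 (max 0 (- x))" for x :: real
    have f_meas [measurable]: "f \<in> borel_measurable borel" unfolding f_def by measurable
    have "(\<lambda>n. \<integral>x. f x \<partial>\<mu> n) \<longlonglongrightarrow> (\<integral>x. f x \<partial>\<rho>)"
      by (rule weak_conv_imp_integral_bdd_continuous_conv[OF \<mu> \<rho>(1) conv, where B = 1])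
         (auto simp: f_def intro!: continuous_intros)
    moreover have "(\<integral>x. f x \<partial>\<mu> n) = (\<integral>x. 0 \<partial>\<mu> n)" for n
      by (intro integral_cong_AE) (use nonneg[of n] in \<open>auto simp: f_def\<close>)
    ultimately have "(\<integral>x. f x \<partial>\<rho>) = 0" by (simp add: LIMSEQ_const_iff)
    moreover have "integrable \<rho> f"
      by (rule \<rho>.integrable_const_bound[where B = 1]) (auto simp: f_def)
    ultimately have "AE x in \<rho>. f x = 0"
      by (subst (asm) integral_nonneg_eq_0_iff_AE) (auto simp: f_def)
    thus ?thesis by eventually_elim (auto simp: f_def min_def max_def split: if_splits)
  qed
  have "(\<integral>x. exp (- l * x) \<partial>\<rho>) = exp (- (l powr \<beta>))" if l: "0 \<le> l" for l
  proof (rule LIMSEQ_unique)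
    \<comment> \<open>The cut at 0 makes the exponential bounded and continuous on the whole line,
      as weak convergence requires, without changing it on the supports.\<close>
    define f where "f x = exp (- l * max 0 x)" for x :: real
    have f_eq: "0 \<le> x \<Longrightarrow> f x = exp (- (l * x))" for x by (simp add: f_def)
    have f_meas [measurable]: "f \<in> borel_measurable borel" unfolding f_def by measurable
    have "(\<lambda>n. \<integral>x. f x \<partial>\<mu> n) \<longlonglongrightarrow> (\<integral>x. f x \<partial>\<rho>)"
      by (rule weak_conv_imp_integral_bdd_continuous_conv[OF \<mu> \<rho>(1) conv, where B = 1])
         (auto simp: f_def l intro!: continuous_intros)
    also have "(\<integral>x. f x \<partial>\<rho>) = (\<integral>x. exp (- l * x) \<partial>\<rho>)"
      by (intro integral_cong_AE) (use nonneg_\<rho> in \<open>auto elim!: eventually_mono intro: f_eq\<close>)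
    also have "(\<lambda>n. \<integral>x. f x \<partial>\<mu> n) = (\<lambda>n. \<integral>x. exp (- l * x) \<partial>\<mu> n)"
    proof
      fix n show "(\<integral>x. f x \<partial>\<mu> n) = (\<integral>x. exp (- l * x) \<partial>\<mu> n)"
        by (intro integral_cong_AE) (use nonneg[of n] in \<open>auto elim!: eventually_mono intro: f_eq\<close>)
    qed
    finally show "(\<lambda>n. \<integral>x. exp (- l * x) \<partial>\<mu> n) \<longlonglongrightarrow> (\<integral>x. exp (- l * x) \<partial>\<rho>)" .
    have *: "(\<integral>x. exp (- l * x) \<partial>\<mu> n) = (1 - (1 - exp (- l * \<epsilon> n)) powr \<beta>) ^ n" for n
    proof -
      have le: "exp (- l * \<epsilon> n) \<le> 1" using l eps by simp
      have "(\<integral>\<^sup>+x. ennreal (exp (- l * x)) \<partial>\<nu> n) = (\<integral>\<^sup>+k. ennreal (exp (- l * \<epsilon> n) ^ k) \<partial>measure_pmf p)"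
        unfolding \<nu>_def by (subst nn_integral_distr) (auto simp: exp_of_nat_mult[symmetric] mult_ac)
      also have "\<dots> = ennreal (\<integral>k. exp (- l * \<epsilon> n) ^ k \<partial>measure_pmf p)"
        by (rule nn_integral_eq_integral)
           (use le in \<open>auto intro!: measure_pmf.integrable_const_bound[where B = 1] AE_I2 power_le_one\<close>)
      also have "(\<integral>k. exp (- l * \<epsilon> n) ^ k \<partial>measure_pmf p) = 1 - (1 - exp (- l * \<epsilon> n)) powr \<beta>"
        by (rule real_pgf) (use le in auto)
      finally have "(\<integral>\<^sup>+x. ennreal (exp (- l * x)) \<partial>\<mu> n) = ennreal (1 - (1 - exp (- l * \<epsilon> n)) powr \<beta>) ^ n"
        unfolding \<mu>_def nn_integral_exp_conv_pow[OF \<nu>] by simp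
      moreover have "0 \<le> 1 - (1 - exp (- l * \<epsilon> n)) powr \<beta>"
        using le \<beta> by (auto intro!: powr_le1)
      ultimately show ?thesis
        by (subst integral_eq_nn_integral) (auto simp: ennreal_power)
    qed
    have "complex_of_real ((1 - (1 - exp (- l * \<epsilon> n)) powr \<beta>) ^ n) =
      (1 - (1 - exp (- of_real l * of_real (\<epsilon> n))) powr of_real \<beta>) ^ n" for n
    proof -
      have "exp (- of_real l * of_real (\<epsilon> n)) = complex_of_real (exp (- l * \<epsilon> n))"
        by (simp add: exp_of_real[symmetric] del: exp_of_real)
      moreover have "exp (- l * \<epsilon> n) \<le> 1" using l eps by simp
      ultimately show ?thesis
        using powr_of_real[of "1 - exp (- l * \<epsilon> n)" \<beta>] by simp
    qed
    hence "(\<lambda>n. complex_of_real ((1 - (1 - exp (- l * \<epsilon> n)) powr \<beta>) ^ n)) \<longlonglongrightarrow> exp (- (of_real l powr of_real \<beta>))"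
      using sibuya_limit[OF \<beta>, of "of_real l"] l unfolding \<epsilon>_def by simp
    also have "exp (- (of_real l powr of_real \<beta>)) = complex_of_real (exp (- (l powr \<beta>)))"
      using powr_of_real[of l \<beta>] l by (simp add: exp_of_real[symmetric] del: exp_of_real)
    finally have "(\<lambda>n. complex_of_real ((1 - (1 - exp (- l * \<epsilon> n)) powr \<beta>) ^ n)) \<longlonglongrightarrow> complex_of_real (exp (- (l powr \<beta>)))" .
    thus "(\<lambda>n. \<integral>x. exp (- l * x) \<partial>\<mu> n) \<longlonglongrightarrow> exp (- (l powr \<beta>))"
      unfolding * tendsto_of_real_iff .
  qed
  thus ?thesis using \<rho> nonneg_\<rho> \<phi>_eq by auto
qed

text \<open>Levy's uniqueness theorem identifies the law picked by \<open>SOME\<close> with the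
  constructed one, which hands over its Laplace transform and its support.\<close>

lemma
  assumes \<beta>: "0 < \<beta>" "\<beta> < 1"
  shows real_distribution_stable_pos: "real_distribution (stable_pos \<beta>)"
    and stable_pos_laplace: "0 \<le> l \<Longrightarrow> (\<integral>x. exp (- l * x) \<partial>stable_pos \<beta>) = exp (- (l powr \<beta>))"
    and AE_stable_pos: "AE x in stable_pos \<beta>. 0 < x"
proof -
  let ?\<phi> = "\<lambda>t. exp (- (complex_of_real (\<bar>t\<bar> powr \<beta>)) * exp (- \<i> * complex_of_real (pi * \<beta> * sgn t / 2)))"
  obtain \<rho> where \<rho>: "real_distribution \<rho>" "\<forall>t. char \<rho> t = ?\<phi> t" "AE x in \<rho>. 0 \<le> x"
    "\<And>l. 0 \<le> l \<Longrightarrow> (\<integral>x. exp (- l * x) \<partial>\<rho>) = exp (- (l powr \<beta>))"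
    using stable_pos_exists[OF \<beta>] by blast
  have *: "real_distribution (stable_pos \<beta>) \<and> (\<forall>t. char (stable_pos \<beta>) t = ?\<phi> t)"
    unfolding stable_pos_def by (rule someI[of _ \<rho>]) (use \<rho> in blast)
  have eq: "stable_pos \<beta> = \<rho>"
    by (rule Levy_uniqueness) (use * \<rho> in auto)
  show "real_distribution (stable_pos \<beta>)" using * by blast
  show "0 \<le> l \<Longrightarrow> (\<integral>x. exp (- l * x) \<partial>stable_pos \<beta>) = exp (- (l powr \<beta>))"
    unfolding eq by (rule \<rho>)
  interpret \<rho>: real_distribution \<rho> by fact
  \<comment> \<open>An atom at 0 bounds the Laplace transform from below at every l; the choice l =
    n^(1/\<beta>) turns the transform into exp(-n).\<close>
  have "measure \<rho> {0} \<le> exp (- real n)" for n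
  proof -
    have "(\<integral>x. indicator {0} x \<partial>\<rho>) \<le> (\<integral>x. exp (- (real n powr (1 / \<beta>)) * x) \<partial>\<rho>)"
    proof (rule integral_mono_AE)
      show "integrable \<rho> (\<lambda>x. exp (- (real n powr (1 / \<beta>)) * x))"
        by (rule \<rho>.integrable_const_bound[where B = 1]) (use \<rho>(3) in auto)
      show "integrable \<rho> (indicator {0} :: real \<Rightarrow> real)"
        by (rule \<rho>.integrable_const_bound[where B = 1]) auto
    qed (auto simp: indicator_def)
    thus ?thesis using \<rho>(4)[of "real n powr (1 / \<beta>)"] \<beta> by (simp add: powr_powr)
  qed
  moreover have "(\<lambda>n. exp (- real n)) \<longlonglongrightarrow> 0"
    by (intro filterlim_compose[OF exp_at_bot] filterlim_uminus_at_bot[THEN iffD2])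
       (simp add: filterlim_real_sequentially)
  ultimately have "measure \<rho> {0} \<le> 0"
    by (intro LIMSEQ_le_const) auto
  hence "{0} \<in> null_sets \<rho>" by (auto simp: null_sets_def \<rho>.emeasure_eq_measure measure_le_0_iff)
  hence "AE x in \<rho>. x \<noteq> 0" by (auto dest: AE_not_in)
  with \<rho>(3) show "AE x in stable_pos \<beta>. 0 < x"
    unfolding eq by eventually_elim auto
qed

section \<open>Normal variance mixtures and the limit law\<close>

lemma integral_distr_pair:
  fixes h :: "real \<Rightarrow> real"
  assumes "prob_space \<mu>" "prob_space K" and f[measurable]: "f \<in> borel_measurable (\<mu> \<Otimes>\<^sub>M K)"
    and h[measurable]: "h \<in> borel_measurable borel" and B: "\<And>x y. \<bar>h (f (x, y))\<bar> \<le> B"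
  shows "(\<integral>z. h z \<partial>distr (\<mu> \<Otimes>\<^sub>M K) borel f) = (\<integral>y. \<integral>x. h (f (x, y)) \<partial>\<mu> \<partial>K)"
proof -
  interpret \<mu>: prob_space \<mu> by fact
  interpret K: prob_space K by fact
  interpret P: pair_prob_space \<mu> K ..
  have "(\<integral>z. h z \<partial>distr (\<mu> \<Otimes>\<^sub>M K) borel f) = (\<integral>z. h (f z) \<partial>(\<mu> \<Otimes>\<^sub>M K))"
    by (rule integral_distr) auto
  also have "\<dots> = (\<integral>z. (\<lambda>(x, y). h (f (x, y))) z \<partial>(\<mu> \<Otimes>\<^sub>M K))"
    by simp
  also have "\<dots> = (\<integral>y. \<integral>x. h (f (x, y)) \<partial>\<mu> \<partial>K)"
    by (rule P.integral_snd[symmetric], rule P.integrable_const_bound[where B = B]) (auto simp: B)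
  finally show ?thesis .
qed

lemma measure_std_normal_singleton: "measure std_normal_distr {x} = 0"
  by (simp add: std_normal_distr_def measure_def emeasure_density nn_integral_0_iff_AE
      AE_lborel_singleton[THEN eventually_mono])

text \<open>The factor 2 makes the conditional characteristic function exp(-t^2 z), so that the
  characteristic function at t is the Laplace transform of K at t^2.\<close>

definition normal_mixture :: "real measure \<Rightarrow> real measure" where
  "normal_mixture K = distr (std_normal_distr \<Otimes>\<^sub>M K) borel (\<lambda>(x, z). x * sqrt (2 * z))"

context
  fixes K :: "real measure"
  assumes K: "real_distribution K"
begin

interpretation K: real_distribution K by (rule K)
interpretation N: real_distribution std_normal_distr by (rule real_distribution_std_normal_distr)

lemma real_distribution_normal_mixture: "real_distribution (normal_mixture K)"
  unfolding normal_mixture_def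
  by (rule real_distribution_pair_distr) (auto intro: K.prob_space_axioms N.prob_space_axioms)

lemma char_normal_mixture:
  assumes "AE z in K. 0 \<le> z"
  shows "char (normal_mixture K) t = complex_of_real (\<integral>z. exp (- (t\<^sup>2) * z) \<partial>K)"
proof -
  have "char (normal_mixture K) t = (\<integral>z. char std_normal_distr (t * sqrt (2 * z)) \<partial>K)"
    unfolding normal_mixture_def
    by (rule char_scale_mixture) (auto intro: N.real_distribution_axioms K.prob_space_axioms)
  also have "\<dots> = (\<integral>z. complex_of_real (exp (- (t\<^sup>2) * z)) \<partial>K)"
  proof (rule integral_cong_AE, goal_cases)
    case 3
    show ?case
      using assms by eventually_elim (simp add: char_std_normal_distr power_mult_distrib)
  qed (auto simp: char_std_normal_distr)
  finally show ?thesis by simp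
qed

lemma measure_normal_mixture:
  assumes [measurable]: "A \<in> sets borel"
  shows "measure (normal_mixture K) A = (\<integral>z. measure std_normal_distr {x. x * sqrt (2 * z) \<in> A} \<partial>K)"
proof -
  interpret NM: real_distribution "normal_mixture K" by (rule real_distribution_normal_mixture)
  have "measure (normal_mixture K) A = (\<integral>z. indicator A z \<partial>normal_mixture K)"
    by simp
  also have "\<dots> = (\<integral>z. \<integral>x. indicator A (x * sqrt (2 * z)) \<partial>std_normal_distr \<partial>K)"
    unfolding normal_mixture_def
    by (subst integral_distr_pair[where B = 1])
       (auto intro: N.prob_space_axioms K.prob_space_axioms simp: indicator_def)
  also have "\<dots> = (\<integral>z. measure std_normal_distr {x. x * sqrt (2 * z) \<in> A} \<partial>K)"
  proof (intro Bochner_Integration.integral_cong refl)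
    fix z
    have "(\<integral>x. indicat_real A (x * sqrt (2 * z)) \<partial>std_normal_distr) =
      (\<integral>x. indicator {x. x * sqrt (2 * z) \<in> A} x \<partial>std_normal_distr)"
      by (intro Bochner_Integration.integral_cong) (auto simp: indicator_def)
    thus "(\<integral>x. indicator A (x * sqrt (2 * z)) \<partial>std_normal_distr) = measure std_normal_distr {x. x * sqrt (2 * z) \<in> A}"
      by simp
  qed
  finally show ?thesis .
qed

context
  assumes pos: "AE z in K. 0 < z"
begin

lemma measure_normal_mixture_singleton: "measure (normal_mixture K) {x} = 0"
proof -
  have "measure (normal_mixture K) {x} = (\<integral>z. measure std_normal_distr {y. y * sqrt (2 * z) \<in> {x}} \<partial>K)"
    by (rule measure_normal_mixture) simp
  also have "\<dots> = 0"
  proof (rule integral_eq_zero_AE)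
    show "AE z in K. measure std_normal_distr {y. y * sqrt (2 * z) \<in> {x}} = 0"
      using pos
    proof eventually_elim
      case (elim z)
      hence "{y. y * sqrt (2 * z) \<in> {x}} = {x / sqrt (2 * z)}" by (auto simp: field_simps)
      thus ?case by (simp add: measure_std_normal_singleton)
    qed
  qed
  finally show ?thesis .
qed

text \<open>H is defined by a strict inequality and \<open>Phi\<close> by a weak one. A mixture over
  positive scales has no atoms, so the two agree, and conditioning on z gives the formula.\<close>

lemma measure_normal_mixture_lessThan:
  "measure (normal_mixture K) {..<x} = (\<integral>z. Phi (x / sqrt (2 * z)) \<partial>K)"
proof -
  interpret NM: real_distribution "normal_mixture K" by (rule real_distribution_normal_mixture)
  have "measure (normal_mixture K) {..x} = measure (normal_mixture K) {..<x} + measure (normal_mixture K) {x}"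
    by (subst NM.finite_measure_Union[symmetric]) (auto intro!: arg_cong[where f = "measure _"])
  hence "measure (normal_mixture K) {..<x} = measure (normal_mixture K) {..x}"
    by (simp add: measure_normal_mixture_singleton)
  also have "\<dots> = (\<integral>z. measure std_normal_distr {y. y * sqrt (2 * z) \<in> {..x}} \<partial>K)"
    by (rule measure_normal_mixture) simp
  also have "\<dots> = (\<integral>z. Phi (x / sqrt (2 * z)) \<partial>K)"
  proof (rule integral_cong_AE)
    have mono: "mono Phi"
      unfolding Phi_def by (intro monoI N.finite_measure_mono) auto
    have [measurable]: "Phi \<in> borel_measurable borel" by (rule borel_measurable_mono[OF mono])
    show "(\<lambda>z. Phi (x / sqrt (2 * z))) \<in> borel_measurable K" by measurable
    have "{z \<in> space (K \<Otimes>\<^sub>M std_normal_distr). snd z * sqrt (2 * fst z) \<le> x} \<in> sets (K \<Otimes>\<^sub>M std_normal_distr)"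
      by measurable
    from N.measurable_emeasure_Pair[OF this] have "(\<lambda>z. measure std_normal_distr (Pair z -` {w \<in> space (K \<Otimes>\<^sub>M std_normal_distr). snd w * sqrt (2 * fst w) \<le> x})) \<in> borel_measurable K"
      unfolding measure_def by measurable
    thus "(\<lambda>z. measure std_normal_distr {y. y * sqrt (2 * z) \<in> {..x}}) \<in> borel_measurable K"
      by (simp add: vimage_def space_pair_measure)
    show "AE z in K. measure std_normal_distr {y. y * sqrt (2 * z) \<in> {..x}} = Phi (x / sqrt (2 * z))"
      using pos
    proof eventually_elim
      case (elim z)
      hence "{y. y * sqrt (2 * z) \<in> {..x}} = {..x / sqrt (2 * z)}" by (auto simp: field_simps)
      thus ?case by (simp add: Phi_def)
    qed
  qed
  finally show ?thesis .
qed

end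

end

section \<open>The symmetric stable law and the limit law\<close>

lemma square_powr_half: "(t\<^sup>2) powr (\<alpha> / 2) = \<bar>t\<bar> powr \<alpha>" for t \<alpha> :: real
proof (cases "t = 0")
  case False
  hence "t\<^sup>2 = \<bar>t\<bar> powr 2" by (simp add: powr_numeral)
  hence "(t\<^sup>2) powr (\<alpha> / 2) = (\<bar>t\<bar> powr 2) powr (\<alpha> / 2)" by (rule arg_cong)
  also have "\<dots> = \<bar>t\<bar> powr \<alpha>" unfolding powr_powr by simp
  finally show ?thesis .
qed simp

text \<open>Subordination: the Laplace transform exp(-l^(\<alpha>/2)) at l = t^2 is
  exp(-|t|^\<alpha>). The bound \<alpha> < 2 keeps the index of the mixing law below 1.\<close>

lemma
  assumes \<alpha>: "0 < \<alpha>" "\<alpha> < 2"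
  shows stable_sym_eq: "stable_sym \<alpha> = normal_mixture (stable_pos (\<alpha> / 2))"
    and char_stable_sym: "char (stable_sym \<alpha>) t = complex_of_real (exp (- (\<bar>t\<bar> powr \<alpha>)))"
    and real_distribution_stable_sym: "real_distribution (stable_sym \<alpha>)"
proof -
  let ?\<mu> = "normal_mixture (stable_pos (\<alpha> / 2))"
  have h: "0 < \<alpha> / 2" "\<alpha> / 2 < 1" using \<alpha> by auto
  have 1: "real_distribution ?\<mu>"
    by (rule real_distribution_normal_mixture[OF real_distribution_stable_pos[OF h]])
  have 2: "char ?\<mu> t = complex_of_real (exp (- (\<bar>t\<bar> powr \<alpha>)))" for t
  proof -
    have "AE z in stable_pos (\<alpha> / 2). 0 \<le> z" using AE_stable_pos[OF h] by eventually_elim auto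
    thus ?thesis
      using stable_pos_laplace[OF h, of "t\<^sup>2"]
      by (simp add: char_normal_mixture[OF real_distribution_stable_pos[OF h]] square_powr_half)
  qed
  have *: "real_distribution (stable_sym \<alpha>) \<and> (\<forall>t. char (stable_sym \<alpha>) t = complex_of_real (exp (- (\<bar>t\<bar> powr \<alpha>))))"
    unfolding stable_sym_def by (rule someI[of _ ?\<mu>]) (use 1 2 in blast)
  thus "real_distribution (stable_sym \<alpha>)" "char (stable_sym \<alpha>) t = complex_of_real (exp (- (\<bar>t\<bar> powr \<alpha>)))"
    by auto
  show "stable_sym \<alpha> = ?\<mu>"
    by (rule Levy_uniqueness) (use * 1 2 in auto)
qed

text \<open>Given g, the stable factor is evaluated at l g^(1/(\<beta> \<alpha>')), and raising this
  to the power \<beta> leaves l^\<beta> g^(1/\<alpha>').\<close>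

lemma
  assumes r: "0 < r" and \<beta>: "0 < \<beta>" "\<beta> < 1"
  shows real_distribution_law_A: "real_distribution (law_A r \<beta> \<alpha>')"
    and AE_law_A: "AE z in law_A r \<beta> \<alpha>'. 0 < z"
    and law_A_laplace: "0 \<le> l \<Longrightarrow> (\<integral>z. exp (- l * z) \<partial>law_A r \<beta> \<alpha>') =
      (\<integral>g. exp (- (l powr \<beta> * g powr (1 / \<alpha>'))) \<partial>gamma_distr r)"
proof -
  interpret S: real_distribution "stable_pos \<beta>" by (rule real_distribution_stable_pos[OF \<beta>])
  interpret G: real_distribution "gamma_distr r" by (rule real_distribution_gamma_distr[OF r])
  interpret P: pair_prob_space "stable_pos \<beta>" "gamma_distr r" ..
  show 1: "real_distribution (law_A r \<beta> \<alpha>')"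
    unfolding law_A_def by (rule real_distribution_pair_distr) (auto intro: S.prob_space_axioms G.prob_space_axioms)
  interpret A: real_distribution "law_A r \<beta> \<alpha>'" by (rule 1)
  have AE_AE: "AE s in stable_pos \<beta>. AE g in gamma_distr r. 0 < s * g powr (1 / (\<beta> * \<alpha>'))"
    using AE_stable_pos[OF \<beta>]
  proof eventually_elim
    case (elim s)
    show ?case using AE_gamma_distr_pos[of r] by eventually_elim (use elim in simp)
  qed
  have "{z \<in> space (stable_pos \<beta> \<Otimes>\<^sub>M gamma_distr r). 0 < fst z * snd z powr (1 / (\<beta> * \<alpha>'))}
      \<in> sets (stable_pos \<beta> \<Otimes>\<^sub>M gamma_distr r)"
    by measurable
  from P.AE_pair_measure[OF this] AE_AE
  have AE_pair: "AE z in stable_pos \<beta> \<Otimes>\<^sub>M gamma_distr r. 0 < fst z * snd z powr (1 / (\<beta> * \<alpha>'))"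
    by (simp only: fst_conv snd_conv)
  show pos: "AE z in law_A r \<beta> \<alpha>'. 0 < z"
    unfolding law_A_def split_beta'
  proof (subst AE_distr_iff)
    show "AE z in stable_pos \<beta> \<Otimes>\<^sub>M gamma_distr r. 0 < fst z * snd z powr (1 / (\<beta> * \<alpha>'))" by (rule AE_pair)
  qed measurable
  assume l: "0 \<le> l"
  \<comment> \<open>\<open>integral_distr_pair\<close> wants an integrand bounded for all arguments;
    the cut at 0 provides this and changes nothing on the support.\<close>
  define h where "h z = exp (- l * max 0 z)" for z :: real
  have h_eq: "h z = exp (- (l * z))" if "0 \<le> z" for z using that by (simp add: h_def)
  have h_meas [measurable]: "h \<in> borel_measurable borel" unfolding h_def by measurable
  have "(\<integral>z. exp (- l * z) \<partial>law_A r \<beta> \<alpha>') = (\<integral>z. h z \<partial>law_A r \<beta> \<alpha>')"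
    by (intro integral_cong_AE) (use pos in \<open>auto elim!: eventually_mono simp: h_eq\<close>)
  also have "\<dots> = (\<integral>g. \<integral>s. h (s * g powr (1 / (\<beta> * \<alpha>'))) \<partial>stable_pos \<beta> \<partial>gamma_distr r)"
    unfolding law_A_def
    by (subst integral_distr_pair[where B = 1])
       (use l in \<open>auto intro: S.prob_space_axioms G.prob_space_axioms simp: h_def\<close>)
  also have "\<dots> = (\<integral>g. exp (- (l powr \<beta> * g powr (1 / \<alpha>'))) \<partial>gamma_distr r)"
  proof (intro Bochner_Integration.integral_cong refl)
    fix g :: real
    let ?c = "g powr (1 / (\<beta> * \<alpha>'))"
    have "(\<integral>s. h (s * ?c) \<partial>stable_pos \<beta>) = (\<integral>s. exp (- (l * ?c) * s) \<partial>stable_pos \<beta>)"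
      by (intro integral_cong_AE) (use AE_stable_pos[OF \<beta>] in \<open>auto elim!: eventually_mono simp: h_eq mult_ac\<close>)
    also have "\<dots> = exp (- ((l * ?c) powr \<beta>))"
      by (rule stable_pos_laplace[OF \<beta>]) (use l in simp)
    also have "(l * ?c) powr \<beta> = l powr \<beta> * g powr (1 / \<alpha>')"
      using l \<beta> by (simp add: powr_mult powr_powr)
    finally show "(\<integral>s. h (s * ?c) \<partial>stable_pos \<beta>) = exp (- (l powr \<beta> * g powr (1 / \<alpha>')))" .
  qed
  finally show "(\<integral>z. exp (- l * z) \<partial>law_A r \<beta> \<alpha>') =
      (\<integral>g. exp (- (l powr \<beta> * g powr (1 / \<alpha>'))) \<partial>gamma_distr r)" .
qed

text \<open>The formula for the characteristic function is the common target of all later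
  representations. Its first use is \<open>law_H_eq\<close>: the Laplace transform of
  \<open>law_A\<close> with index \<alpha>/2, taken at t^2, is the same integral.\<close>

lemma
  assumes r: "0 < r" and \<alpha>: "0 < \<alpha>" "\<alpha> < 2"
  shows real_distribution_law_H: "real_distribution (law_H r \<alpha> \<alpha>')"
    and char_law_H: "char (law_H r \<alpha> \<alpha>') t =
      complex_of_real (\<integral>g. exp (- (\<bar>t\<bar> powr \<alpha> * g powr (1 / \<alpha>'))) \<partial>gamma_distr r)"
    and law_H_eq: "law_H r \<alpha> \<alpha>' = normal_mixture (law_A r (\<alpha> / 2) \<alpha>')"
proof -
  interpret S: real_distribution "stable_sym \<alpha>" by (rule real_distribution_stable_sym[OF \<alpha>])
  interpret G: real_distribution "gamma_distr r" by (rule real_distribution_gamma_distr[OF r])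
  have h: "0 < \<alpha> / 2" "\<alpha> / 2 < 1" using \<alpha> by auto
  show 1: "real_distribution (law_H r \<alpha> \<alpha>')"
    unfolding law_H_def by (rule real_distribution_pair_distr) (auto intro: S.prob_space_axioms G.prob_space_axioms)
  show 2: "char (law_H r \<alpha> \<alpha>') t =
      complex_of_real (\<integral>g. exp (- (\<bar>t\<bar> powr \<alpha> * g powr (1 / \<alpha>'))) \<partial>gamma_distr r)" for t
  proof -
    have "char (law_H r \<alpha> \<alpha>') t = (\<integral>g. char (stable_sym \<alpha>) (t * g powr (1 / (\<alpha> * \<alpha>'))) \<partial>gamma_distr r)"
      unfolding law_H_def by (rule char_scale_mixture) (auto intro: S.real_distribution_axioms G.prob_space_axioms)
    also have "\<dots> = (\<integral>g. complex_of_real (exp (- (\<bar>t\<bar> powr \<alpha> * g powr (1 / \<alpha>')))) \<partial>gamma_distr r)"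
      using \<alpha> by (simp add: char_stable_sym abs_mult powr_mult powr_powr)
    finally show ?thesis by simp
  qed
  show "law_H r \<alpha> \<alpha>' = normal_mixture (law_A r (\<alpha> / 2) \<alpha>')"
  proof (rule Levy_uniqueness[OF 1])
    note A = real_distribution_law_A[OF r h, of \<alpha>'] AE_law_A[OF r h, of \<alpha>']
    show "real_distribution (normal_mixture (law_A r (\<alpha> / 2) \<alpha>'))"
      by (rule real_distribution_normal_mixture[OF A(1)])
    have "AE z in law_A r (\<alpha> / 2) \<alpha>'. 0 \<le> z" using A(2) by eventually_elim auto
    thus "char (law_H r \<alpha> \<alpha>') = char (normal_mixture (law_A r (\<alpha> / 2) \<alpha>'))"
      using law_A_laplace[OF r h, of "t\<^sup>2" \<alpha>' for t]
      by (intro ext) (simp add: char_normal_mixture[OF A(1)] 2 square_powr_half)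
  qed
qed

lemma
  assumes r: "0 < r" and \<alpha>: "0 < \<alpha>" "\<alpha> < 2"
  shows H_fun_eq: "H_fun x r \<alpha> \<alpha>' = (\<integral>z. Phi (x / sqrt (2 * z)) \<partial>law_A r (\<alpha> / 2) \<alpha>')"
    and measure_law_H_singleton: "measure (law_H r \<alpha> \<alpha>') {x} = 0"
proof -
  have h: "0 < \<alpha> / 2" "\<alpha> / 2 < 1" using \<alpha> by auto
  note A = real_distribution_law_A[OF r h, of \<alpha>'] AE_law_A[OF r h, of \<alpha>']
  show "H_fun x r \<alpha> \<alpha>' = (\<integral>z. Phi (x / sqrt (2 * z)) \<partial>law_A r (\<alpha> / 2) \<alpha>')"
    unfolding H_fun_def law_H_eq[OF assms] by (rule measure_normal_mixture_lessThan[OF A])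
  show "measure (law_H r \<alpha> \<alpha>') {x} = 0"
    unfolding law_H_eq[OF assms] by (rule measure_normal_mixture_singleton[OF A])
qed

lemma measure_stable_sym_singleton:
  assumes "0 < \<alpha>" "\<alpha> < 2" shows "measure (stable_sym \<alpha>) {x} = 0"
  unfolding stable_sym_eq[OF assms]
  by (rule measure_normal_mixture_singleton[OF real_distribution_stable_pos AE_stable_pos]) (use assms in auto)

section \<open>The Mittag-Leffler and Linnik laws\<close>

lemma gamma_distr_1_laplace: "0 \<le> l \<Longrightarrow> (\<integral>g. exp (- (l * g)) \<partial>gamma_distr 1) = 1 / (1 + l)"
  using gamma_distr_laplace[of 1 l] by (simp add: powr_minus_divide)

text \<open>The exponent \<open>1 / 1\<close> is what the formulas for the product laws leave behind
  at \<alpha>' = 1. Since \<open>g powr 1\<close> is g only for g \<ge> 0, it is removed almost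
  everywhere.\<close>

lemma gamma_distr_1_laplace_powr:
  assumes "0 \<le> l"
  shows "(\<integral>g. exp (- (l * g powr (1 / 1))) \<partial>gamma_distr 1) = 1 / (1 + l)"
proof -
  have "(\<integral>g. exp (- (l * g powr (1 / 1))) \<partial>gamma_distr 1) = (\<integral>g. exp (- (l * g)) \<partial>gamma_distr 1)"
  proof (rule integral_cong_AE, goal_cases)
    case 3
    show ?case
      using AE_gamma_distr_pos[of 1] by eventually_elim simp
  qed (auto simp: gamma_distr_eq)
  thus ?thesis using assms by (simp only: gamma_distr_1_laplace)
qed

text \<open>The witness for \<open>SOME\<close> is S W^(1/\<beta>) with W exponential, the case r =
  \<alpha>' = 1 of \<open>law_A\<close>: conditioning on W gives E exp(-s^\<beta> W) = 1 / (1 +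
  s^\<beta>).\<close>

lemma
  assumes \<beta>: "0 < \<beta>" "\<beta> < 1"
  shows real_distribution_mittag_leffler: "real_distribution (mittag_leffler \<beta>)"
    and AE_mittag_leffler: "AE x in mittag_leffler \<beta>. 0 \<le> x"
    and mittag_leffler_laplace: "0 \<le> s \<Longrightarrow> (\<integral>x. exp (- s * x) \<partial>mittag_leffler \<beta>) = 1 / (1 + s powr \<beta>)"
proof -
  have "AE x in law_A 1 \<beta> 1. 0 \<le> x" using AE_law_A[OF zero_less_one \<beta>, of 1] by eventually_elim auto
  moreover have "(\<integral>x. exp (- s * x) \<partial>law_A 1 \<beta> 1) = 1 / (1 + s powr \<beta>)" if "0 \<le> s" for s
  proof -
    have "(\<integral>x. exp (- s * x) \<partial>law_A 1 \<beta> 1) = (\<integral>g. exp (- (s powr \<beta> * g powr (1 / 1))) \<partial>gamma_distr 1)"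
      by (rule law_A_laplace[OF zero_less_one \<beta> that])
    thus ?thesis by (simp only: gamma_distr_1_laplace_powr powr_ge_zero)
  qed
  ultimately have *: "real_distribution (mittag_leffler \<beta>) \<and> (AE x in mittag_leffler \<beta>. 0 \<le> x) \<and>
      (\<forall>s\<ge>0. (\<integral>x. exp (- s * x) \<partial>mittag_leffler \<beta>) = 1 / (1 + s powr \<beta>))"
    unfolding mittag_leffler_def
    by (intro someI[of "\<lambda>\<mu>. real_distribution \<mu> \<and> (AE x in \<mu>. 0 \<le> x) \<and>
      (\<forall>s\<ge>0. (\<integral>x. exp (- s * x) \<partial>\<mu>) = 1 / (1 + s powr \<beta>))" "law_A 1 \<beta> 1"] conjI allI impI
      real_distribution_law_A[OF zero_less_one \<beta>])
  show "real_distribution (mittag_leffler \<beta>)" "AE x in mittag_leffler \<beta>. 0 \<le> x"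
    "0 \<le> s \<Longrightarrow> (\<integral>x. exp (- s * x) \<partial>mittag_leffler \<beta>) = 1 / (1 + s powr \<beta>)"
    using * by auto
qed

text \<open>The witness is the limit law itself at r = \<alpha>' = 1, that is, a symmetric stable
  variable times W^(1/\<alpha>) with W exponential.\<close>

lemma
  assumes \<alpha>: "0 < \<alpha>" "\<alpha> < 2"
  shows real_distribution_linnik: "real_distribution (linnik \<alpha>)"
    and char_linnik: "char (linnik \<alpha>) t = complex_of_real (1 / (1 + \<bar>t\<bar> powr \<alpha>))"
proof -
  have "char (law_H 1 \<alpha> 1) t = complex_of_real (1 / (1 + \<bar>t\<bar> powr \<alpha>))" for t
    by (simp only: char_law_H[OF zero_less_one \<alpha>] gamma_distr_1_laplace_powr powr_ge_zero)
  hence *: "real_distribution (linnik \<alpha>) \<and> (\<forall>t. char (linnik \<alpha>) t = complex_of_real (1 / (1 + \<bar>t\<bar> powr \<alpha>)))"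
    unfolding linnik_def
    by (intro someI[of "\<lambda>\<mu>. real_distribution \<mu> \<and> (\<forall>t. char \<mu> t = complex_of_real (1 / (1 + \<bar>t\<bar> powr \<alpha>)))"
      "law_H 1 \<alpha> 1"] conjI allI real_distribution_law_H[OF zero_less_one \<alpha>])
  show "real_distribution (linnik \<alpha>)" "char (linnik \<alpha>) t = complex_of_real (1 / (1 + \<bar>t\<bar> powr \<alpha>))"
    using * by auto
qed

section \<open>Exponential, gamma and stable factorizations\<close>

lemma nn_integral_exp_lborel_halfline:
  assumes "0 < c"
  shows "(\<integral>\<^sup>+x. ennreal (if 0 < x then exp (- c * x) else 0) \<partial>lborel) = ennreal (1 / c)"
proof -
  have "(\<integral>\<^sup>+x. ennreal (if 0 < x then exp (- c * x) else 0) \<partial>lborel) =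
    (\<integral>\<^sup>+x. ennreal (if 0 < x then x powr (1 - 1) * exp (- c * x) else 0) \<partial>lborel)"
    by (intro nn_integral_cong) auto
  also have "\<dots> = ennreal (1 / c)"
    using nn_integral_Gamma_scaled[of 1 c] assms by (simp add: powr_minus_divide)
  finally show ?thesis .
qed

lemma nn_integral_gamma_distr:
  assumes "0 < s" and [measurable]: "f \<in> borel_measurable borel"
  shows "(\<integral>\<^sup>+x. f x \<partial>gamma_distr s) = (\<integral>\<^sup>+x. ennreal (gamma_pdf s x) * f x \<partial>lborel)"
  unfolding gamma_distr_eq by (rule nn_integral_density) auto

lemma emeasure_gamma_distr_1_greaterThan:
  assumes "0 \<le> a"
  shows "emeasure (gamma_distr 1) {a<..} = ennreal (exp (- a))"
proof -
  have "emeasure (gamma_distr 1) {a<..} = (\<integral>\<^sup>+x. ennreal (gamma_pdf 1 x) * indicator {a<..} x \<partial>lborel)"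
    by (simp add: gamma_distr_eq emeasure_density)
  also have "\<dots> = (\<integral>\<^sup>+x. ennreal (gamma_pdf 1 (a + 1 * x)) * indicator {a<..} (a + 1 * x) \<partial>lborel)"
    by (subst nn_integral_real_affine[where c = 1 and t = a]) auto
  also have "\<dots> = (\<integral>\<^sup>+x. ennreal (exp (- a)) * ennreal (if 0 < x then exp (- 1 * x) else 0) \<partial>lborel)"
    using assms
    by (intro nn_integral_cong) (auto simp: gamma_pdf_def indicator_def ennreal_mult'[symmetric] mult_exp_exp)
  also have "\<dots> = ennreal (exp (- a)) * ennreal (1 / 1)"
    by (subst nn_integral_cmult) (auto simp only: nn_integral_exp_lborel_halfline[OF zero_less_one], simp)
  finally show ?thesis by simp
qed

text \<open>Comparison of tails: for x \<ge> 0, given S = s the event is W > s x^(1/\<gamma>), of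
  probability exp(-s x^(1/\<gamma>)), and the stable Laplace transform at x^(1/\<gamma>) is
  exp(-x).\<close>

lemma gamma_1_over_stable:
  assumes \<gamma>: "0 < \<gamma>" "\<gamma> < 1"
  shows "distr (gamma_distr 1 \<Otimes>\<^sub>M stable_pos \<gamma>) borel (\<lambda>(w, s). (w / s) powr \<gamma>) = gamma_distr 1"
proof -
  interpret W: real_distribution "gamma_distr 1" by (rule real_distribution_gamma_distr) simp
  interpret S: real_distribution "stable_pos \<gamma>" by (rule real_distribution_stable_pos[OF \<gamma>])
  interpret P: pair_prob_space "gamma_distr 1" "stable_pos \<gamma>" ..
  let ?D = "distr (gamma_distr 1 \<Otimes>\<^sub>M stable_pos \<gamma>) borel (\<lambda>(w, s). (w / s) powr \<gamma>)"
  interpret D: real_distribution ?D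
    by (rule real_distribution_pair_distr) (auto intro: W.prob_space_axioms S.prob_space_axioms)
  show ?thesis
  proof (rule measure_eqI_lessThan)
    fix x :: real
    show "emeasure ?D {x<..} < \<infinity>" by (simp add: D.emeasure_eq_measure)
    show "emeasure ?D {x<..} = emeasure (gamma_distr 1) {x<..}"
    proof (cases "0 \<le> x")
      case True
      have "emeasure ?D {x<..} = (\<integral>\<^sup>+z. indicator {x<..} z \<partial>?D)"
        by simp
      also have "\<dots> = (\<integral>\<^sup>+z. indicator {x<..} ((fst z / snd z) powr \<gamma>) \<partial>(gamma_distr 1 \<Otimes>\<^sub>M stable_pos \<gamma>))"
        by (subst nn_integral_distr) (auto simp: split_beta')
      also have "\<dots> = (\<integral>\<^sup>+s. \<integral>\<^sup>+w. indicator {x<..} ((w / s) powr \<gamma>) \<partial>gamma_distr 1 \<partial>stable_pos \<gamma>)"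
        by (subst P.nn_integral_snd[symmetric]) auto
      also have "\<dots> = (\<integral>\<^sup>+s. ennreal (exp (- (x powr (1 / \<gamma>)) * s)) \<partial>stable_pos \<gamma>)"
      proof (rule nn_integral_cong_AE, goal_cases)
        case 1
        show ?case
          using AE_stable_pos[OF \<gamma>]
        proof eventually_elim
          case (elim s)
          have "(\<integral>\<^sup>+w. indicator {x<..} ((w / s) powr \<gamma>) \<partial>gamma_distr 1) =
            (\<integral>\<^sup>+w. indicator {s * x powr (1 / \<gamma>)<..} w \<partial>gamma_distr 1)"
          proof (rule nn_integral_cong_AE, goal_cases)
            case 1
            show ?case
              using AE_gamma_distr_pos[of 1]
            proof eventually_elim
              case (elim w)
              have x: "x = (x powr (1 / \<gamma>)) powr \<gamma>" using True \<gamma> by (simp add: powr_powr)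
              have "x < (w / s) powr \<gamma> \<longleftrightarrow> (x powr (1 / \<gamma>)) powr \<gamma> < (w / s) powr \<gamma>"
                by (simp flip: x)
              also have "\<dots> \<longleftrightarrow> x powr (1 / \<gamma>) < w / s"
                using \<gamma> elim \<open>0 < s\<close>
                by (meson divide_pos_pos less_eq_real_def linorder_not_less powr_ge_zero powr_less_mono2 powr_mono2)
              also have "\<dots> \<longleftrightarrow> s * x powr (1 / \<gamma>) < w" using \<open>0 < s\<close> by (simp add: field_simps)
              finally show ?case by (simp add: indicator_def)
            qed
          qed
          also have "\<dots> = ennreal (exp (- (s * x powr (1 / \<gamma>))))"
            using elim by (simp add: emeasure_gamma_distr_1_greaterThan)
          finally show ?case by (simp add: mult.commute)
        qed
      qed
      also have "\<dots> = ennreal (\<integral>s. exp (- (x powr (1 / \<gamma>)) * s) \<partial>stable_pos \<gamma>)"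
      proof (rule nn_integral_eq_integral)
        show "integrable (stable_pos \<gamma>) (\<lambda>s. exp (- (x powr (1 / \<gamma>)) * s))"
          by (rule S.integrable_const_bound[where B = 1])
             (use AE_stable_pos[OF \<gamma>] in \<open>auto elim!: eventually_mono\<close>)
      qed auto
      also have "\<dots> = ennreal (exp (- x))"
        using \<gamma> True by (subst stable_pos_laplace[OF \<gamma>]) (auto simp: powr_powr)
      finally show ?thesis by (simp add: emeasure_gamma_distr_1_greaterThan True)
    next
      case False
      have "AE w in gamma_distr 1. x < w"
        using AE_gamma_distr_pos[of 1] by eventually_elim (use False in simp)
      hence "emeasure (gamma_distr 1) {x<..} = emeasure (gamma_distr 1) (space (gamma_distr 1))"
        by (intro emeasure_eq_AE) auto
      moreover have "AE z in ?D. x < z"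
        using False by (subst AE_distr_iff) (auto intro!: AE_I2 less_le_trans[OF _ powr_ge_zero])
      hence "emeasure ?D {x<..} = emeasure ?D (space ?D)"
        by (intro emeasure_eq_AE) auto
      ultimately show ?thesis using W.emeasure_space_1 D.emeasure_space_1 by simp
    qed
  qed simp_all
qed

lemma nn_integral_stable_laplace:
  assumes \<beta>: "0 < \<beta>" "\<beta> < 1" and l: "0 \<le> l"
  shows "(\<integral>\<^sup>+s. ennreal (exp (- l * s)) \<partial>stable_pos \<beta>) = ennreal (exp (- (l powr \<beta>)))"
proof -
  interpret S: real_distribution "stable_pos \<beta>" by (rule real_distribution_stable_pos[OF \<beta>])
  have "(\<integral>\<^sup>+s. ennreal (exp (- l * s)) \<partial>stable_pos \<beta>) = ennreal (\<integral>s. exp (- l * s) \<partial>stable_pos \<beta>)"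
  proof (rule nn_integral_eq_integral)
    show "integrable (stable_pos \<beta>) (\<lambda>s. exp (- l * s))"
      by (rule S.integrable_const_bound[where B = 1])
         (use AE_stable_pos[OF \<beta>] l in \<open>auto elim!: eventually_mono\<close>)
  qed auto
  thus ?thesis by (simp only: stable_pos_laplace[OF \<beta> l])
qed

lemma nn_integral_gamma_1_laplace:
  assumes l: "0 \<le> l"
  shows "(\<integral>\<^sup>+w. ennreal (exp (- l * w)) \<partial>gamma_distr 1) = ennreal (1 / (1 + l))"
proof -
  interpret W: real_distribution "gamma_distr 1" by (rule real_distribution_gamma_distr) simp
  have "(\<integral>\<^sup>+w. ennreal (exp (- l * w)) \<partial>gamma_distr 1) = ennreal (\<integral>w. exp (- l * w) \<partial>gamma_distr 1)"
  proof (rule nn_integral_eq_integral)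
    show "integrable (gamma_distr 1) (\<lambda>s. exp (- l * s))"
      by (rule W.integrable_const_bound[where B = 1])
         (use AE_gamma_distr_pos[of 1] l in \<open>auto elim!: eventually_mono\<close>)
  qed auto
  thus ?thesis using gamma_distr_1_laplace[OF l] by simp
qed

text \<open>Write 1 / (1 + u) = E exp(-u W) with W exponential. Integrating s1 first gives exp(-(c W
  / s2)^a), and here (W / s2)^(a \<alpha>') may be replaced by W thanks to
  \<open>gamma_1_over_stable\<close>, which needs a \<alpha>' < 1. All integrands are nonnegative,
  so the orders of integration can be changed freely.\<close>

lemma stable_ratio_mixture:
  assumes a: "0 < a" "a < 1" and \<alpha>': "0 < \<alpha>'" "a * \<alpha>' < 1" and c: "0 \<le> c"
  shows "(\<integral>\<^sup>+s1. \<integral>\<^sup>+s2. ennreal (1 / (1 + c * \<bar>s1 / s2\<bar>)) \<partial>stable_pos (a * \<alpha>') \<partial>stable_pos a) =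
    (\<integral>\<^sup>+w. ennreal (exp (- (c powr a * w powr (1 / \<alpha>')))) \<partial>gamma_distr 1)"
proof -
  have a': "0 < a * \<alpha>'" using a \<alpha>' by simp
  interpret W: real_distribution "gamma_distr 1" by (rule real_distribution_gamma_distr) simp
  interpret S: real_distribution "stable_pos a" by (rule real_distribution_stable_pos[OF a])
  interpret T: real_distribution "stable_pos (a * \<alpha>')" by (rule real_distribution_stable_pos[OF a' \<alpha>'(2)])
  interpret ST: pair_prob_space "stable_pos a" "stable_pos (a * \<alpha>')" ..
  interpret SW: pair_prob_space "stable_pos a" "gamma_distr 1" ..
  interpret WT: pair_prob_space "gamma_distr 1" "stable_pos (a * \<alpha>')" ..
  have "(\<integral>\<^sup>+s1. \<integral>\<^sup>+s2. ennreal (1 / (1 + c * \<bar>s1 / s2\<bar>)) \<partial>stable_pos (a * \<alpha>') \<partial>stable_pos a) =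
    (\<integral>\<^sup>+s1. \<integral>\<^sup>+s2. \<integral>\<^sup>+w. ennreal (exp (- (c * (s1 / s2)) * w)) \<partial>gamma_distr 1 \<partial>stable_pos (a * \<alpha>') \<partial>stable_pos a)"
  proof (rule nn_integral_cong_AE, goal_cases)
    case 1
    show ?case
      using AE_stable_pos[OF a]
    proof eventually_elim
      case (elim s1)
      show ?case
      proof (rule nn_integral_cong_AE, goal_cases)
        case 1
        show ?case
          using AE_stable_pos[OF a' \<alpha>'(2)]
          by eventually_elim (use elim c in \<open>simp add: nn_integral_gamma_1_laplace[of "c * (s1 / s2)" for s2, simplified]\<close>)
      qed
    qed
  qed
  also have "\<dots> = (\<integral>\<^sup>+s2. \<integral>\<^sup>+s1. \<integral>\<^sup>+w. ennreal (exp (- (c * (s1 / s2)) * w)) \<partial>gamma_distr 1 \<partial>stable_pos a \<partial>stable_pos (a * \<alpha>'))"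
    by (rule ST.Fubini'[symmetric]) measurable
  also have "\<dots> = (\<integral>\<^sup>+s2. \<integral>\<^sup>+w. \<integral>\<^sup>+s1. ennreal (exp (- (c * (s1 / s2)) * w)) \<partial>stable_pos a \<partial>gamma_distr 1 \<partial>stable_pos (a * \<alpha>'))"
    by (intro nn_integral_cong SW.Fubini'[symmetric]) measurable
  also have "\<dots> = (\<integral>\<^sup>+s2. \<integral>\<^sup>+w. ennreal (exp (- (c powr a * ((w / s2) powr (a * \<alpha>')) powr (1 / \<alpha>')))) \<partial>gamma_distr 1 \<partial>stable_pos (a * \<alpha>'))"
  proof (rule nn_integral_cong_AE, goal_cases)
    case 1
    show ?case
      using AE_stable_pos[OF a' \<alpha>'(2)]
    proof eventually_elim
      case (elim s2)
      show ?case
      proof (rule nn_integral_cong_AE, goal_cases)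
        case 1
        show ?case
          using AE_gamma_distr_pos[of 1]
        proof eventually_elim
          case (elim w)
          have "(\<integral>\<^sup>+s1. ennreal (exp (- (c * (s1 / s2)) * w)) \<partial>stable_pos a) =
            (\<integral>\<^sup>+s1. ennreal (exp (- (c * (w / s2)) * s1)) \<partial>stable_pos a)"
            by (simp add: mult_ac)
          also have "\<dots> = ennreal (exp (- ((c * (w / s2)) powr a)))"
            by (rule nn_integral_stable_laplace[OF a]) (use c elim \<open>0 < s2\<close> in simp)
          also have "(c * (w / s2)) powr a = c powr a * ((w / s2) powr (a * \<alpha>')) powr (1 / \<alpha>')"
            using c elim \<open>0 < s2\<close> \<alpha>' powr_mult[of c "w / s2" a] unfolding powr_powr by simp
          finally show ?case .
        qed
      qed
    qed
  qed
  also have "\<dots> = (\<integral>\<^sup>+z. ennreal (exp (- (c powr a * ((fst z / snd z) powr (a * \<alpha>')) powr (1 / \<alpha>')))) \<partial>(gamma_distr 1 \<Otimes>\<^sub>M stable_pos (a * \<alpha>')))"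
    by (subst WT.nn_integral_snd[symmetric]) auto
  also have "\<dots> = (\<integral>\<^sup>+z. ennreal (exp (- (c powr a * z powr (1 / \<alpha>')))) \<partial>distr (gamma_distr 1 \<Otimes>\<^sub>M stable_pos (a * \<alpha>')) borel (\<lambda>(w, s). (w / s) powr (a * \<alpha>')))"
    by (subst nn_integral_distr) (auto simp: split_beta')
  finally show ?thesis unfolding gamma_1_over_stable[OF a' \<alpha>'(2)] .
qed

text \<open>In terms of u = y / x the quotient is 1 / (1 + u). Integrating x out leaves the beta
  prime density of u, whose normalizing constant is Gamma r * Gamma (1 - r).\<close>

lemma gamma_ratio_law:
  fixes h :: "real \<Rightarrow> ennreal"
  assumes r: "0 < r" "r < 1" and [measurable]: "h \<in> borel_measurable borel"
  shows "(\<integral>\<^sup>+x. \<integral>\<^sup>+y. h (x / (x + y)) \<partial>gamma_distr (1 - r) \<partial>gamma_distr r) =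
    (\<integral>\<^sup>+u. ennreal (if 0 < u then u powr (- r) / ((1 + u) * (Gamma r * Gamma (1 - r))) else 0) * h (1 / (1 + u)) \<partial>lborel)"
proof -
  have G: "0 < Gamma r" "0 < Gamma (1 - r)" using r by auto
  define C where "C = Gamma r * Gamma (1 - r)"
  have C: "0 < C" using G by (simp add: C_def)
  have [measurable_cong, simp]: "sets (gamma_distr s) = sets borel" for s by (simp add: gamma_distr_eq)
  interpret Y: real_distribution "gamma_distr (1 - r)" by (rule real_distribution_gamma_distr) (use r in simp)
  have "(\<integral>\<^sup>+x. \<integral>\<^sup>+y. h (x / (x + y)) \<partial>gamma_distr (1 - r) \<partial>gamma_distr r) =
    (\<integral>\<^sup>+x. ennreal (gamma_pdf r x) * (\<integral>\<^sup>+y. h (x / (x + y)) \<partial>gamma_distr (1 - r)) \<partial>lborel)"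
    using r by (intro nn_integral_gamma_distr) auto
  also have "\<dots> = (\<integral>\<^sup>+x. \<integral>\<^sup>+u. ennreal (if 0 < u \<and> 0 < x then u powr (- r) / C * exp (- (1 + u) * x) else 0) * h (1 / (1 + u)) \<partial>lborel \<partial>lborel)"
  proof (rule nn_integral_cong, goal_cases)
    case (1 x)
    show ?case
    proof (cases "0 < x")
      case True
      have "(\<integral>\<^sup>+y. h (x / (x + y)) \<partial>gamma_distr (1 - r)) = (\<integral>\<^sup>+y. ennreal (gamma_pdf (1 - r) y) * h (x / (x + y)) \<partial>lborel)"
        using r by (intro nn_integral_gamma_distr) auto
      also have "\<dots> = ennreal \<bar>x\<bar> * (\<integral>\<^sup>+u. ennreal (gamma_pdf (1 - r) (x * u)) * h (x / (x + x * u)) \<partial>lborel)"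
        using True by (intro nn_integral_lborel_scale) auto
      finally have "ennreal (gamma_pdf r x) * (\<integral>\<^sup>+y. h (x / (x + y)) \<partial>gamma_distr (1 - r)) =
        ennreal (gamma_pdf r x * x) * (\<integral>\<^sup>+u. ennreal (gamma_pdf (1 - r) (x * u)) * h (x / (x + x * u)) \<partial>lborel)"
        using True r by (simp add: ennreal_mult gamma_pdf_nonneg mult.assoc)
      also have "\<dots> = (\<integral>\<^sup>+u. ennreal (gamma_pdf r x * x) * (ennreal (gamma_pdf (1 - r) (x * u)) * h (x / (x + x * u))) \<partial>lborel)"
        by (subst nn_integral_cmult) auto
      also have "\<dots> = (\<integral>\<^sup>+u. ennreal (if 0 < u \<and> 0 < x then u powr (- r) / C * exp (- (1 + u) * x) else 0) * h (1 / (1 + u)) \<partial>lborel)"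
      proof (rule nn_integral_cong, goal_cases)
        case (1 u)
        show ?case
        proof (cases "0 < u")
          case u: True
          have "x / (x + x * u) = (x * 1) / (x * (1 + u))" by (simp add: distrib_left)
          also have "\<dots> = 1 / (1 + u)" using True by (subst mult_divide_mult_cancel_left) auto
          finally have h: "x / (x + x * u) = 1 / (1 + u)" .
          \<comment> \<open>The shapes add up to 1, so all powers of x, including the Jacobian,
            cancel and a pure exponential in x remains.\<close>
          have "x powr (r - 1) * x * x powr (- r) = 1"
            using True powr_add[of x "r - 1" 1] powr_add[of x r "- r"] by simp
          hence "gamma_pdf r x * x * gamma_pdf (1 - r) (x * u) = u powr (- r) / C * (exp (- x) * exp (- (x * u)))"
            using True u G by (simp add: gamma_pdf_def C_def powr_mult field_simps)
          also have "exp (- x) * exp (- (x * u)) = exp (- (1 + u) * x)"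
            by (simp add: mult_exp_exp algebra_simps)
          finally show ?thesis
            using True u r by (simp add: h mult.assoc[symmetric] ennreal_mult'[symmetric] gamma_pdf_nonneg)
        qed (use True in \<open>auto simp: gamma_pdf_def zero_less_mult_iff\<close>)
      qed
      finally show ?thesis .
    qed (auto simp: gamma_pdf_def)
  qed
  also have "\<dots> = (\<integral>\<^sup>+u. \<integral>\<^sup>+x. ennreal (if 0 < u \<and> 0 < x then u powr (- r) / C * exp (- (1 + u) * x) else 0) * h (1 / (1 + u)) \<partial>lborel \<partial>lborel)"
    by (rule lborel_pair.Fubini'[symmetric]) measurable
  also have "\<dots> = (\<integral>\<^sup>+u. ennreal (if 0 < u then u powr (- r) / ((1 + u) * C) else 0) * h (1 / (1 + u)) \<partial>lborel)"
  proof (rule nn_integral_cong, goal_cases)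
    case (1 u)
    show ?case
    proof (cases "0 < u")
      case True
      have "(\<integral>\<^sup>+x. ennreal (if 0 < u \<and> 0 < x then u powr (- r) / C * exp (- (1 + u) * x) else 0) * h (1 / (1 + u)) \<partial>lborel) =
        (\<integral>\<^sup>+x. (ennreal (u powr (- r) / C) * h (1 / (1 + u))) * ennreal (if 0 < x then exp (- (1 + u) * x) else 0) \<partial>lborel)"
      proof (rule nn_integral_cong)
        fix x :: real
        have "ennreal (u powr (- r) / C * exp (- (1 + u) * x)) = ennreal (u powr (- r) / C) * ennreal (exp (- (1 + u) * x))"
          using C by (intro ennreal_mult) auto
        thus "ennreal (if 0 < u \<and> 0 < x then u powr (- r) / C * exp (- (1 + u) * x) else 0) * h (1 / (1 + u)) =
          (ennreal (u powr (- r) / C) * h (1 / (1 + u))) * ennreal (if 0 < x then exp (- (1 + u) * x) else 0)"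
          using True by (simp add: mult_ac)
      qed
      also have "\<dots> = (ennreal (u powr (- r) / C) * h (1 / (1 + u))) * ennreal (1 / (1 + u))"
        using True by (subst nn_integral_cmult) (simp, simp only: nn_integral_exp_lborel_halfline)
      also have "\<dots> = (ennreal (u powr (- r) / C) * ennreal (1 / (1 + u))) * h (1 / (1 + u))"
        by (simp only: mult_ac)
      also have "ennreal (u powr (- r) / C) * ennreal (1 / (1 + u)) = ennreal (u powr (- r) / ((1 + u) * C))"
        using True C by (subst ennreal_mult'[symmetric]) (auto simp: mult_ac)
      finally show ?thesis using True by simp
    qed simp
  qed
  finally show ?thesis unfolding C_def .
qed

text \<open>Beta-gamma algebra. For fixed u the substitution w = (1 + u) v cancels the factor 1 + u
  of the beta prime density and turns exp(-w) into exp(-v) exp(-u v). The remaining integral over u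
  is Gamma (1 - r) v^(r - 1), which completes the gamma density of shape r.\<close>

lemma gamma_beta_factorization:
  fixes f :: "real \<Rightarrow> ennreal"
  assumes r: "0 < r" "r < 1" and [measurable]: "f \<in> borel_measurable borel"
  shows "(\<integral>\<^sup>+w. \<integral>\<^sup>+x. \<integral>\<^sup>+y. f (w * (x / (x + y))) \<partial>gamma_distr (1 - r) \<partial>gamma_distr r \<partial>gamma_distr 1) =
    (\<integral>\<^sup>+v. f v \<partial>gamma_distr r)"
proof -
  have G: "0 < Gamma r" "0 < Gamma (1 - r)" using r by auto
  define C where "C = Gamma r * Gamma (1 - r)"
  have C: "0 < C" using G by (simp add: C_def)
  interpret W: real_distribution "gamma_distr 1" by (rule real_distribution_gamma_distr) simp
  interpret WL: pair_sigma_finite "gamma_distr 1" "lborel :: real measure" ..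
  let ?k = "\<lambda>u. if 0 < u then u powr (- r) / ((1 + u) * C) else 0"
  have "(\<integral>\<^sup>+w. \<integral>\<^sup>+x. \<integral>\<^sup>+y. f (w * (x / (x + y))) \<partial>gamma_distr (1 - r) \<partial>gamma_distr r \<partial>gamma_distr 1) =
    (\<integral>\<^sup>+w. \<integral>\<^sup>+u. ennreal (?k u) * f (w * (1 / (1 + u))) \<partial>lborel \<partial>gamma_distr 1)"
    unfolding C_def by (intro nn_integral_cong gamma_ratio_law[OF r, of "\<lambda>z. f (w * z)" for w]) measurable
  also have "\<dots> = (\<integral>\<^sup>+u. \<integral>\<^sup>+w. ennreal (?k u) * f (w * (1 / (1 + u))) \<partial>gamma_distr 1 \<partial>lborel)"
    by (rule WL.Fubini'[symmetric]) measurable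
  also have "\<dots> = (\<integral>\<^sup>+u. \<integral>\<^sup>+v. ennreal (if 0 < u \<and> 0 < v then u powr (- r) / C * exp (- (1 + u) * v) else 0) * f v \<partial>lborel \<partial>lborel)"
  proof (rule nn_integral_cong, goal_cases)
    case (1 u)
    show ?case
    proof (cases "0 < u")
      case True
      have "(\<integral>\<^sup>+w. ennreal (?k u) * f (w * (1 / (1 + u))) \<partial>gamma_distr 1) =
        (\<integral>\<^sup>+w. ennreal (gamma_pdf 1 w) * (ennreal (?k u) * f (w * (1 / (1 + u)))) \<partial>lborel)"
        by (rule nn_integral_gamma_distr) auto
      also have "\<dots> = ennreal \<bar>1 + u\<bar> * (\<integral>\<^sup>+v. ennreal (gamma_pdf 1 ((1 + u) * v)) * (ennreal (?k u) * f (((1 + u) * v) * (1 / (1 + u)))) \<partial>lborel)"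
        using True by (intro nn_integral_lborel_scale) auto
      also have "\<dots> = (\<integral>\<^sup>+v. ennreal \<bar>1 + u\<bar> * (ennreal (gamma_pdf 1 ((1 + u) * v)) * (ennreal (?k u) * f (((1 + u) * v) * (1 / (1 + u))))) \<partial>lborel)"
        by (subst nn_integral_cmult) auto
      also have "\<dots> = (\<integral>\<^sup>+v. ennreal (if 0 < u \<and> 0 < v then u powr (- r) / C * exp (- (1 + u) * v) else 0) * f v \<partial>lborel)"
      proof (rule nn_integral_cong)
        fix v :: real
        have e: "((1 + u) * v) * (1 / (1 + u)) = v" using True by simp
        have "\<bar>1 + u\<bar> * (gamma_pdf 1 ((1 + u) * v) * ?k u) = (if 0 < u \<and> 0 < v then u powr (- r) / C * exp (- (1 + u) * v) else 0)"
        proof (cases "0 < v")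
          case v: True
          have "(1 + u) * (exp (- ((1 + u) * v)) * (u powr (- r) / ((1 + u) * C))) = u powr (- r) / C * exp (- ((1 + u) * v))"
            using True C by (simp add: divide_simps)
          moreover have "exp (- (1 + u) * v) = exp (- ((1 + u) * v))" by (simp only: mult_minus_left)
          ultimately show ?thesis using True v by (simp only: gamma_pdf_def) (simp del: minus_add_distrib)
        qed (use True in \<open>auto simp: gamma_pdf_def zero_less_mult_iff\<close>)
        moreover have "ennreal \<bar>1 + u\<bar> * (ennreal (gamma_pdf 1 ((1 + u) * v)) * ennreal (?k u)) = ennreal (\<bar>1 + u\<bar> * (gamma_pdf 1 ((1 + u) * v) * ?k u))"
          using C by (simp add: ennreal_mult gamma_pdf_nonneg)
        ultimately show "ennreal \<bar>1 + u\<bar> * (ennreal (gamma_pdf 1 ((1 + u) * v)) * (ennreal (?k u) * f (((1 + u) * v) * (1 / (1 + u))))) =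
          ennreal (if 0 < u \<and> 0 < v then u powr (- r) / C * exp (- (1 + u) * v) else 0) * f v"
          unfolding e by (simp only: mult.assoc[symmetric])
      qed
      finally show ?thesis .
    qed simp
  qed
  also have "\<dots> = (\<integral>\<^sup>+v. \<integral>\<^sup>+u. ennreal (if 0 < u \<and> 0 < v then u powr (- r) / C * exp (- (1 + u) * v) else 0) * f v \<partial>lborel \<partial>lborel)"
    by (rule lborel_pair.Fubini') measurable
  also have "\<dots> = (\<integral>\<^sup>+v. ennreal (gamma_pdf r v) * f v \<partial>lborel)"
  proof (rule nn_integral_cong, goal_cases)
    case (1 v)
    show ?case
    proof (cases "0 < v")
      case True
      have "(\<integral>\<^sup>+u. ennreal (if 0 < u \<and> 0 < v then u powr (- r) / C * exp (- (1 + u) * v) else 0) * f v \<partial>lborel) =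
        (\<integral>\<^sup>+u. (ennreal (exp (- v) / C) * f v) * ennreal (if 0 < u then u powr ((1 - r) - 1) * exp (- v * u) else 0) \<partial>lborel)"
      proof (rule nn_integral_cong)
        fix u :: real
        have "exp (- (1 + u) * v) = exp (- v) * exp (- v * u)"
          by (simp add: mult_exp_exp algebra_simps)
        thus "ennreal (if 0 < u \<and> 0 < v then u powr (- r) / C * exp (- (1 + u) * v) else 0) * f v =
          (ennreal (exp (- v) / C) * f v) * ennreal (if 0 < u then u powr ((1 - r) - 1) * exp (- v * u) else 0)"
          using True C by (auto simp: ennreal_mult' mult_ac divide_inverse)
      qed
      also have "\<dots> = (ennreal (exp (- v) / C) * f v) * ennreal (Gamma (1 - r) * v powr (- (1 - r)))"
        using True r by (subst nn_integral_cmult) (simp, subst nn_integral_Gamma_scaled, auto)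
      also have "\<dots> = (ennreal (exp (- v) / C) * ennreal (Gamma (1 - r) * v powr (- (1 - r)))) * f v"
        by (simp only: mult_ac)
      also have "ennreal (exp (- v) / C) * ennreal (Gamma (1 - r) * v powr (- (1 - r))) = ennreal (gamma_pdf r v)"
        using True C G by (subst ennreal_mult'[symmetric]) (auto simp: gamma_pdf_def C_def)
      finally show ?thesis .
    qed (auto simp: gamma_pdf_def)
  qed
  also have "\<dots> = (\<integral>\<^sup>+v. f v \<partial>gamma_distr r)"
    using r by (intro nn_integral_gamma_distr[symmetric]) auto
  finally show ?thesis .
qed

section \<open>Product representations of the limit law\<close>

text \<open>The factorization with the exponential variable integrated innermost, the position in
  which the Laplace and stable computations leave it.\<close>

lemma beta_gamma_mixture:
  assumes r: "0 < r" "r < 1"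
  shows "(\<integral>\<^sup>+x. \<integral>\<^sup>+y. \<integral>\<^sup>+w. ennreal (exp (- (T * (x / (x + y)) powr p * w powr p))) \<partial>gamma_distr 1 \<partial>gamma_distr (1 - r) \<partial>gamma_distr r) =
    (\<integral>\<^sup>+g. ennreal (exp (- (T * g powr p))) \<partial>gamma_distr r)"
proof -
  interpret W: real_distribution "gamma_distr 1" by (rule real_distribution_gamma_distr) simp
  interpret X: real_distribution "gamma_distr r" by (rule real_distribution_gamma_distr[OF r(1)])
  interpret Y: real_distribution "gamma_distr (1 - r)" by (rule real_distribution_gamma_distr) (use r in simp)
  interpret WX: pair_prob_space "gamma_distr 1" "gamma_distr r" ..
  interpret WY: pair_prob_space "gamma_distr 1" "gamma_distr (1 - r)" ..
  let ?f = "\<lambda>g. ennreal (exp (- (T * g powr p)))"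
  have "(\<integral>\<^sup>+x. \<integral>\<^sup>+y. \<integral>\<^sup>+w. ennreal (exp (- (T * (x / (x + y)) powr p * w powr p))) \<partial>gamma_distr 1 \<partial>gamma_distr (1 - r) \<partial>gamma_distr r) =
    (\<integral>\<^sup>+x. \<integral>\<^sup>+y. \<integral>\<^sup>+w. ?f (w * (x / (x + y))) \<partial>gamma_distr 1 \<partial>gamma_distr (1 - r) \<partial>gamma_distr r)"
  proof (rule nn_integral_cong_AE, goal_cases)
    case 1
    show ?case
      using AE_gamma_distr_pos[of r]
    proof eventually_elim
      case (elim x)
      show ?case
      proof (rule nn_integral_cong_AE, goal_cases)
        case 1
        show ?case
          using AE_gamma_distr_pos[of "1 - r"]
        proof eventually_elim
          case (elim y)
          show ?case
          proof (rule nn_integral_cong_AE, goal_cases)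
            case 1
            show ?case
              using AE_gamma_distr_pos[of 1]
            proof eventually_elim
              case (elim w)
              have "(w * (x / (x + y))) powr p = w powr p * (x / (x + y)) powr p"
                by (rule powr_mult)
              thus ?case by (simp only: mult_ac)
            qed
          qed
        qed
      qed
    qed
  qed
  also have "\<dots> = (\<integral>\<^sup>+x. \<integral>\<^sup>+w. \<integral>\<^sup>+y. ?f (w * (x / (x + y))) \<partial>gamma_distr (1 - r) \<partial>gamma_distr 1 \<partial>gamma_distr r)"
    by (intro nn_integral_cong WY.Fubini') measurable
  also have "\<dots> = (\<integral>\<^sup>+w. \<integral>\<^sup>+x. \<integral>\<^sup>+y. ?f (w * (x / (x + y))) \<partial>gamma_distr (1 - r) \<partial>gamma_distr r \<partial>gamma_distr 1)"
    by (rule WX.Fubini') measurable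
  also have "\<dots> = (\<integral>\<^sup>+g. ?f g \<partial>gamma_distr r)"
    by (rule gamma_beta_factorization[OF r]) measurable
  finally show ?thesis .
qed

lemma nn_integral_pair3:
  fixes M1 M2 M3 :: "real measure"
  assumes "real_distribution M1" "real_distribution M2" "real_distribution M3"
    and [measurable]: "F \<in> borel_measurable (borel \<Otimes>\<^sub>M (borel \<Otimes>\<^sub>M borel))"
  shows "(\<integral>\<^sup>+z. F z \<partial>(M1 \<Otimes>\<^sub>M (M2 \<Otimes>\<^sub>M M3))) = (\<integral>\<^sup>+a. \<integral>\<^sup>+b. \<integral>\<^sup>+c. F (a, b, c) \<partial>M3 \<partial>M2 \<partial>M1)"
proof -
  interpret M1: real_distribution M1 by fact
  interpret M2: real_distribution M2 by fact
  interpret M3: real_distribution M3 by fact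
  interpret P: pair_prob_space M2 M3 ..
  have "(\<integral>\<^sup>+z. F z \<partial>(M1 \<Otimes>\<^sub>M (M2 \<Otimes>\<^sub>M M3))) = (\<integral>\<^sup>+a. \<integral>\<^sup>+z. F (a, z) \<partial>(M2 \<Otimes>\<^sub>M M3) \<partial>M1)"
    by (rule P.nn_integral_fst[symmetric]) measurable
  also have "\<dots> = (\<integral>\<^sup>+a. \<integral>\<^sup>+b. \<integral>\<^sup>+c. F (a, b, c) \<partial>M3 \<partial>M2 \<partial>M1)"
    by (intro nn_integral_cong M3.nn_integral_fst[symmetric]) measurable
  finally show ?thesis .
qed

lemma nn_integral_pair4:
  fixes M1 M2 M3 M4 :: "real measure"
  assumes "real_distribution M1" "real_distribution M2" "real_distribution M3" "real_distribution M4"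
    and [measurable]: "F \<in> borel_measurable (borel \<Otimes>\<^sub>M (borel \<Otimes>\<^sub>M (borel \<Otimes>\<^sub>M borel)))"
  shows "(\<integral>\<^sup>+z. F z \<partial>(M1 \<Otimes>\<^sub>M (M2 \<Otimes>\<^sub>M (M3 \<Otimes>\<^sub>M M4)))) =
    (\<integral>\<^sup>+a. \<integral>\<^sup>+b. \<integral>\<^sup>+c. \<integral>\<^sup>+d. F (a, b, c, d) \<partial>M4 \<partial>M3 \<partial>M2 \<partial>M1)"
proof -
  interpret M1: real_distribution M1 by fact
  interpret M2: real_distribution M2 by fact
  interpret M3: real_distribution M3 by fact
  interpret M4: real_distribution M4 by fact
  interpret P: pair_prob_space M3 M4 ..
  interpret Q: pair_prob_space M2 "M3 \<Otimes>\<^sub>M M4" ..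
  have "(\<integral>\<^sup>+z. F z \<partial>(M1 \<Otimes>\<^sub>M (M2 \<Otimes>\<^sub>M (M3 \<Otimes>\<^sub>M M4)))) = (\<integral>\<^sup>+a. \<integral>\<^sup>+z. F (a, z) \<partial>(M2 \<Otimes>\<^sub>M (M3 \<Otimes>\<^sub>M M4)) \<partial>M1)"
    by (rule Q.nn_integral_fst[symmetric]) measurable
  also have "\<dots> = (\<integral>\<^sup>+a. \<integral>\<^sup>+b. \<integral>\<^sup>+c. \<integral>\<^sup>+d. F (a, b, c, d) \<partial>M4 \<partial>M3 \<partial>M2 \<partial>M1)"
    by (intro nn_integral_cong nn_integral_pair3[OF assms(2-4)]) measurable
  finally show ?thesis .
qed

text \<open>Conditionally on y the product has characteristic function \<psi> (t * f y). For the
  Laplace, normal and Linnik factors \<psi> is real and nonnegative, so each representation reduces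
  to an identity between nonnegative integrals, where Tonelli applies without integrability
  conditions.\<close>

lemma law_H_eqI:
  assumes r: "0 < r" and \<alpha>: "0 < \<alpha>" "\<alpha> < 2"
    and \<mu>: "real_distribution \<mu>" and K: "prob_space K" and f[measurable]: "f \<in> borel_measurable K"
    and \<psi>: "\<And>t. char \<mu> t = complex_of_real (\<psi> t)" "\<And>t. 0 \<le> \<psi> t" and [measurable]: "\<psi> \<in> borel_measurable borel"
    and eq: "\<And>t. (\<integral>\<^sup>+y. ennreal (\<psi> (t * f y)) \<partial>K) =
      (\<integral>\<^sup>+g. ennreal (exp (- (\<bar>t\<bar> powr \<alpha> * g powr (1 / \<alpha>')))) \<partial>gamma_distr r)"
  shows "law_H r \<alpha> \<alpha>' = distr (\<mu> \<Otimes>\<^sub>M K) borel (\<lambda>(x, y). x * f y)"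
proof (rule Levy_uniqueness)
  interpret \<mu>: real_distribution \<mu> by fact
  show "real_distribution (law_H r \<alpha> \<alpha>')" by (rule real_distribution_law_H[OF r \<alpha>])
  show "real_distribution (distr (\<mu> \<Otimes>\<^sub>M K) borel (\<lambda>(x, y). x * f y))"
    by (rule real_distribution_pair_distr) (use K in \<open>auto intro: \<mu>.prob_space_axioms\<close>)
  show "char (law_H r \<alpha> \<alpha>') = char (distr (\<mu> \<Otimes>\<^sub>M K) borel (\<lambda>(x, y). x * f y))"
  proof
    fix t
    have "char (distr (\<mu> \<Otimes>\<^sub>M K) borel (\<lambda>(x, y). x * f y)) t = (\<integral>y. complex_of_real (\<psi> (t * f y)) \<partial>K)"
      by (simp add: char_scale_mixture[OF \<mu> K f] \<psi>)
    also have "\<dots> = complex_of_real (\<integral>y. \<psi> (t * f y) \<partial>K)" by simp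
    also have "(\<integral>y. \<psi> (t * f y) \<partial>K) = enn2real (\<integral>\<^sup>+y. ennreal (\<psi> (t * f y)) \<partial>K)"
      by (rule integral_eq_nn_integral) (auto simp: \<psi>)
    also have "\<dots> = (\<integral>g. exp (- (\<bar>t\<bar> powr \<alpha> * g powr (1 / \<alpha>'))) \<partial>gamma_distr r)"
      unfolding eq by (rule integral_eq_nn_integral[symmetric]) (auto simp: gamma_distr_eq)
    finally show "char (law_H r \<alpha> \<alpha>') t = char (distr (\<mu> \<Otimes>\<^sub>M K) borel (\<lambda>(x, y). x * f y)) t"
      by (simp add: char_law_H[OF r \<alpha>])
  qed
qed

text \<open>The scale is B^(p/\<alpha>) with B = x / (x + y); the power \<alpha> of its absolute
  value, or \<alpha>/2 of its square, leaves B^p. The squared form serves the Laplace and normal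
  factors, the other one the Linnik factor.\<close>

lemma beta_scale_powr:
  fixes x y \<alpha> p t :: real
  assumes "0 < x" "0 < y" "0 < \<alpha>"
  shows "(t\<^sup>2 * (1 / ((x + y) / x) powr (p / \<alpha>))\<^sup>2) powr (\<alpha> / 2) = \<bar>t\<bar> powr \<alpha> * (x / (x + y)) powr p"
    and "(\<bar>t * (1 / ((x + y) / x) powr (p / \<alpha>))\<bar>) powr \<alpha> = \<bar>t\<bar> powr \<alpha> * (x / (x + y)) powr p"
proof -
  have B: "1 / ((x + y) / x) powr (p / \<alpha>) = (x / (x + y)) powr (p / \<alpha>)"
    using assms by (simp add: powr_divide)
  show 2: "(\<bar>t * (1 / ((x + y) / x) powr (p / \<alpha>))\<bar>) powr \<alpha> = \<bar>t\<bar> powr \<alpha> * (x / (x + y)) powr p"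
    unfolding B abs_mult using assms by (subst powr_mult) (auto simp: powr_powr)
  have "(t\<^sup>2 * (1 / ((x + y) / x) powr (p / \<alpha>))\<^sup>2) powr (\<alpha> / 2) = (\<bar>t * (1 / ((x + y) / x) powr (p / \<alpha>))\<bar>) powr \<alpha>"
    using square_powr_half[of "t * (1 / ((x + y) / x) powr (p / \<alpha>))" \<alpha>] by (simp only: power_mult_distrib)
  thus "(t\<^sup>2 * (1 / ((x + y) / x) powr (p / \<alpha>))\<^sup>2) powr (\<alpha> / 2) = \<bar>t\<bar> powr \<alpha> * (x / (x + y)) powr p"
    unfolding 2 .
qed

lemma nn_integral_gamma_pair_cong:
  assumes "\<And>x y. 0 < x \<Longrightarrow> 0 < y \<Longrightarrow> F x y = G x y"
  shows "(\<integral>\<^sup>+x. \<integral>\<^sup>+y. F x y \<partial>gamma_distr s \<partial>gamma_distr r) = (\<integral>\<^sup>+x. \<integral>\<^sup>+y. G x y \<partial>gamma_distr s \<partial>gamma_distr r)"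
proof (rule nn_integral_cong_AE, goal_cases)
  case 1
  show ?case
    using AE_gamma_distr_pos[of r]
  proof eventually_elim
    case (elim x)
    show ?case
    proof (rule nn_integral_cong_AE, goal_cases)
      case 1
      show ?case
        using AE_gamma_distr_pos[of s] by eventually_elim (rule assms[OF elim])
    qed
  qed
qed

lemma stable_index_bounds:
  fixes \<alpha> \<alpha>' :: real
  assumes \<alpha>: "0 < \<alpha>" "\<alpha> < 2" and \<alpha>': "0 < \<alpha>'" "\<alpha>' \<le> 1"
  shows "0 < \<alpha> / 2" "\<alpha> / 2 < 1" "0 < \<alpha> * \<alpha>' / 2" "\<alpha> * \<alpha>' / 2 < 1"
proof -
  have "\<alpha> * \<alpha>' \<le> \<alpha> * 1" using \<alpha> \<alpha>' by (intro mult_left_mono) auto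
  hence "\<alpha> * \<alpha>' < 2" using \<alpha> by linarith
  thus "0 < \<alpha> / 2" "\<alpha> / 2 < 1" "0 < \<alpha> * \<alpha>' / 2" "\<alpha> * \<alpha>' / 2 < 1" using \<alpha> \<alpha>' by auto
qed

definition stable_mixing_space :: "real \<Rightarrow> real \<Rightarrow> real \<Rightarrow> (real \<times> real \<times> real \<times> real) measure" where
  "stable_mixing_space r \<alpha> \<alpha>' = gamma_distr r \<Otimes>\<^sub>M (gamma_distr (1 - r) \<Otimes>\<^sub>M
      (stable_pos (\<alpha> / 2) \<Otimes>\<^sub>M stable_pos (\<alpha> * \<alpha>' / 2)))"

context
  fixes r \<alpha> :: real
  assumes r: "0 < r" "r < 1" and \<alpha>: "0 < \<alpha>" "\<alpha> < 2"
begin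

interpretation X: real_distribution "gamma_distr r" by (rule real_distribution_gamma_distr[OF r(1)])
interpretation Y: real_distribution "gamma_distr (1 - r)" by (rule real_distribution_gamma_distr) (use r in simp)
interpretation XY: pair_prob_space "gamma_distr r" "gamma_distr (1 - r)" ..

text \<open>At \<alpha>' = 1 the exponential variable enters linearly and can be integrated out: E
  exp(-T B W) is E (1 / (1 + T B)). With T = |t|^\<alpha> this is the shape produced by both the
  Linnik and the Mittag-Leffler factor.\<close>

lemma beta_resolvent_mixture:
  assumes "0 \<le> T"
  shows "(\<integral>\<^sup>+x. \<integral>\<^sup>+y. ennreal (1 / (1 + T * (x / (x + y)) powr 1)) \<partial>gamma_distr (1 - r) \<partial>gamma_distr r) =
    (\<integral>\<^sup>+g. ennreal (exp (- (T * g powr (1 / 1)))) \<partial>gamma_distr r)"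
proof -
  have "(\<integral>\<^sup>+x. \<integral>\<^sup>+y. ennreal (1 / (1 + T * (x / (x + y)) powr 1)) \<partial>gamma_distr (1 - r) \<partial>gamma_distr r) =
    (\<integral>\<^sup>+x. \<integral>\<^sup>+y. \<integral>\<^sup>+w. ennreal (exp (- (T * (x / (x + y)) powr 1 * w powr 1))) \<partial>gamma_distr 1 \<partial>gamma_distr (1 - r) \<partial>gamma_distr r)"
  proof (intro nn_integral_cong)
    fix x y :: real
    have "(\<integral>\<^sup>+w. ennreal (exp (- (T * (x / (x + y)) powr 1 * w powr 1))) \<partial>gamma_distr 1) =
      (\<integral>\<^sup>+w. ennreal (exp (- (T * (x / (x + y)) powr 1) * w)) \<partial>gamma_distr 1)"
    proof (rule nn_integral_cong_AE, goal_cases)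
      case 1
      show ?case
        using AE_gamma_distr_pos[of 1] by eventually_elim simp
    qed
    also have "\<dots> = ennreal (1 / (1 + T * (x / (x + y)) powr 1))"
      by (rule nn_integral_gamma_1_laplace) (use assms in simp)
    finally show "ennreal (1 / (1 + T * (x / (x + y)) powr 1)) =
      (\<integral>\<^sup>+w. ennreal (exp (- (T * (x / (x + y)) powr 1 * w powr 1))) \<partial>gamma_distr 1)" by simp
  qed
  also have "\<dots> = (\<integral>\<^sup>+g. ennreal (exp (- (T * g powr 1))) \<partial>gamma_distr r)"
    by (rule beta_gamma_mixture[OF r])
  finally show ?thesis by simp
qed

lemma law_H_linnik:
  "law_H r \<alpha> 1 = distr (linnik \<alpha> \<Otimes>\<^sub>M (gamma_distr r \<Otimes>\<^sub>M gamma_distr (1 - r))) borel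
     (\<lambda>(l, g1, g2). l / ((g1 + g2) / g1) powr (1 / \<alpha>))"
proof -
  let ?f = "\<lambda>z. 1 / ((fst z + snd z) / fst z) powr (1 / \<alpha>)"
  have "law_H r \<alpha> 1 = distr (linnik \<alpha> \<Otimes>\<^sub>M (gamma_distr r \<Otimes>\<^sub>M gamma_distr (1 - r))) borel (\<lambda>(l, z). l * ?f z)"
  proof (rule law_H_eqI[OF r(1) \<alpha> real_distribution_linnik[OF \<alpha>] XY.prob_space_axioms _ char_linnik[OF \<alpha>]])
    fix t :: real
    have "(\<integral>\<^sup>+z. ennreal (1 / (1 + \<bar>t * ?f z\<bar> powr \<alpha>)) \<partial>(gamma_distr r \<Otimes>\<^sub>M gamma_distr (1 - r))) =
      (\<integral>\<^sup>+x. \<integral>\<^sup>+y. ennreal (1 / (1 + \<bar>t * (1 / ((x + y) / x) powr (1 / \<alpha>))\<bar> powr \<alpha>)) \<partial>gamma_distr (1 - r) \<partial>gamma_distr r)"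
      by (subst Y.nn_integral_fst[symmetric]) auto
    also have "\<dots> = (\<integral>\<^sup>+x. \<integral>\<^sup>+y. ennreal (1 / (1 + \<bar>t\<bar> powr \<alpha> * (x / (x + y)) powr 1)) \<partial>gamma_distr (1 - r) \<partial>gamma_distr r)"
      by (intro nn_integral_gamma_pair_cong) (simp only: beta_scale_powr(2)[OF _ _ \<alpha>(1)])
    also have "\<dots> = (\<integral>\<^sup>+g. ennreal (exp (- (\<bar>t\<bar> powr \<alpha> * g powr (1 / 1)))) \<partial>gamma_distr r)"
      by (rule beta_resolvent_mixture) simp
    finally show "(\<integral>\<^sup>+z. ennreal (1 / (1 + \<bar>t * ?f z\<bar> powr \<alpha>)) \<partial>(gamma_distr r \<Otimes>\<^sub>M gamma_distr (1 - r))) =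
      (\<integral>\<^sup>+g. ennreal (exp (- (\<bar>t\<bar> powr \<alpha> * g powr (1 / 1)))) \<partial>gamma_distr r)" .
  qed auto
  thus ?thesis by (simp add: split_beta')
qed

text \<open>Given the gamma variables, the normal factor produces exp(-c m) with c = t^2
  B^(2/\<alpha>), and the Mittag-Leffler transform at c is 1 / (1 + |t|^\<alpha> B).\<close>

lemma law_H_mittag_leffler:
  "law_H r \<alpha> 1 = distr (std_normal_distr \<Otimes>\<^sub>M (gamma_distr r \<Otimes>\<^sub>M (gamma_distr (1 - r) \<Otimes>\<^sub>M mittag_leffler (\<alpha> / 2)))) borel
     (\<lambda>(x, g1, g2, m). x * sqrt (2 * m) / ((g1 + g2) / g1) powr (1 / \<alpha>))"
proof -
  have h: "0 < \<alpha> / 2" "\<alpha> / 2 < 1" using \<alpha> by auto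
  interpret M: real_distribution "mittag_leffler (\<alpha> / 2)" by (rule real_distribution_mittag_leffler[OF h])
  interpret YM: pair_prob_space "gamma_distr (1 - r)" "mittag_leffler (\<alpha> / 2)" ..
  interpret XYM: pair_prob_space "gamma_distr r" "gamma_distr (1 - r) \<Otimes>\<^sub>M mittag_leffler (\<alpha> / 2)" ..
  let ?K = "gamma_distr r \<Otimes>\<^sub>M (gamma_distr (1 - r) \<Otimes>\<^sub>M mittag_leffler (\<alpha> / 2))"
  let ?b = "\<lambda>x y. 1 / ((x + y) / x) powr (1 / \<alpha>)"
  let ?f = "\<lambda>(x, y, m). sqrt (2 * m) * ?b x y"
  have "law_H r \<alpha> 1 = distr (std_normal_distr \<Otimes>\<^sub>M ?K) borel (\<lambda>(l, z). l * ?f z)"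
  proof (rule law_H_eqI[OF r(1) \<alpha> real_distribution_std_normal_distr XYM.prob_space_axioms _ char_std_normal_distr])
    fix t :: real
    have "(\<integral>\<^sup>+z. ennreal (exp (- ((t * ?f z)\<^sup>2 / 2))) \<partial>?K) =
      (\<integral>\<^sup>+x. \<integral>\<^sup>+y. \<integral>\<^sup>+m. ennreal (exp (- ((t * (sqrt (2 * m) * ?b x y))\<^sup>2 / 2))) \<partial>mittag_leffler (\<alpha> / 2) \<partial>gamma_distr (1 - r) \<partial>gamma_distr r)"
      by (subst nn_integral_pair3[OF X.real_distribution_axioms Y.real_distribution_axioms M.real_distribution_axioms]) simp_all
    also have "\<dots> = (\<integral>\<^sup>+x. \<integral>\<^sup>+y. ennreal (1 / (1 + \<bar>t\<bar> powr \<alpha> * (x / (x + y)) powr 1)) \<partial>gamma_distr (1 - r) \<partial>gamma_distr r)"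
    proof (rule nn_integral_gamma_pair_cong)
      fix x y :: real assume xy: "0 < x" "0 < y"
      let ?c = "t\<^sup>2 * (?b x y)\<^sup>2"
      have "(\<integral>\<^sup>+m. ennreal (exp (- ((t * (sqrt (2 * m) * ?b x y))\<^sup>2 / 2))) \<partial>mittag_leffler (\<alpha> / 2)) =
        (\<integral>\<^sup>+m. ennreal (exp (- ?c * m)) \<partial>mittag_leffler (\<alpha> / 2))"
      proof (rule nn_integral_cong_AE, goal_cases)
        case 1
        show ?case
          using AE_mittag_leffler[OF h]
        proof eventually_elim
          case (elim m)
          hence "(sqrt (2 * m))\<^sup>2 = 2 * m" by simp
          hence "(t * (sqrt (2 * m) * ?b x y))\<^sup>2 / 2 = ?c * m" unfolding power_mult_distrib by simp
          thus ?case by (simp only: mult_minus_left)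
        qed
      qed
      also have "\<dots> = ennreal (\<integral>m. exp (- ?c * m) \<partial>mittag_leffler (\<alpha> / 2))"
      proof (rule nn_integral_eq_integral)
        show "integrable (mittag_leffler (\<alpha> / 2)) (\<lambda>m. exp (- ?c * m))"
        proof (rule M.integrable_const_bound[where B = 1])
          show "AE m in mittag_leffler (\<alpha> / 2). norm (exp (- ?c * m)) \<le> 1"
            using AE_mittag_leffler[OF h] by eventually_elim simp
        qed auto
      qed auto
      also have "(\<integral>m. exp (- ?c * m) \<partial>mittag_leffler (\<alpha> / 2)) = 1 / (1 + ?c powr (\<alpha> / 2))"
        by (rule mittag_leffler_laplace[OF h]) simp
      also have "?c powr (\<alpha> / 2) = \<bar>t\<bar> powr \<alpha> * (x / (x + y)) powr 1"
        by (rule beta_scale_powr(1)[OF xy \<alpha>(1)])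
      finally show "(\<integral>\<^sup>+m. ennreal (exp (- ((t * (sqrt (2 * m) * ?b x y))\<^sup>2 / 2))) \<partial>mittag_leffler (\<alpha> / 2)) =
        ennreal (1 / (1 + \<bar>t\<bar> powr \<alpha> * (x / (x + y)) powr 1))" .
    qed
    also have "\<dots> = (\<integral>\<^sup>+g. ennreal (exp (- (\<bar>t\<bar> powr \<alpha> * g powr (1 / 1)))) \<partial>gamma_distr r)"
      by (rule beta_resolvent_mixture) simp
    finally show "(\<integral>\<^sup>+z. ennreal (exp (- ((t * ?f z)\<^sup>2 / 2))) \<partial>?K) =
      (\<integral>\<^sup>+g. ennreal (exp (- (\<bar>t\<bar> powr \<alpha> * g powr (1 / 1)))) \<partial>gamma_distr r)" .
  qed auto
  thus ?thesis by (simp add: split_beta')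
qed

context
  fixes \<alpha>' :: real
  assumes \<alpha>': "0 < \<alpha>'" "\<alpha>' \<le> 1"
begin

lemma prob_space_stable_mixing_space: "prob_space (stable_mixing_space r \<alpha> \<alpha>')"
proof -
  interpret S: real_distribution "stable_pos (\<alpha> / 2)" by (rule real_distribution_stable_pos[OF stable_index_bounds(1,2)[OF \<alpha> \<alpha>']])
  interpret T: real_distribution "stable_pos (\<alpha> * \<alpha>' / 2)" by (rule real_distribution_stable_pos[OF stable_index_bounds(3,4)[OF \<alpha> \<alpha>']])
  interpret ST: pair_prob_space "stable_pos (\<alpha> / 2)" "stable_pos (\<alpha> * \<alpha>' / 2)" ..
  interpret YST: pair_prob_space "gamma_distr (1 - r)" "stable_pos (\<alpha> / 2) \<Otimes>\<^sub>M stable_pos (\<alpha> * \<alpha>' / 2)" ..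
  interpret XYST: pair_prob_space "gamma_distr r" "gamma_distr (1 - r) \<Otimes>\<^sub>M (stable_pos (\<alpha> / 2) \<Otimes>\<^sub>M stable_pos (\<alpha> * \<alpha>' / 2))" ..
  show ?thesis unfolding stable_mixing_space_def by (rule XYST.prob_space_axioms)
qed

text \<open>Given the gamma variables, the Laplace factor yields 1 / (1 + c s1 / s2) with c = t^2
  B^(2/(\<alpha> \<alpha>')). The stable pair collapses to an exponential variable by
  \<open>stable_ratio_mixture\<close>, which the beta factor then absorbs into the gamma variable of
  shape r.\<close>

lemma law_H_laplace_mixture:
  "law_H r \<alpha> \<alpha>' = distr (laplace_distr \<Otimes>\<^sub>M stable_mixing_space r \<alpha> \<alpha>') borel
     (\<lambda>(l, z). l * (case z of (x, y, s1, s2) \<Rightarrow> 1 / ((x + y) / x) powr (1 / (\<alpha> * \<alpha>')) * sqrt (s1 / s2)))"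
proof -
  interpret S: real_distribution "stable_pos (\<alpha> / 2)" by (rule real_distribution_stable_pos[OF stable_index_bounds(1,2)[OF \<alpha> \<alpha>']])
  interpret T: real_distribution "stable_pos (\<alpha> * \<alpha>' / 2)" by (rule real_distribution_stable_pos[OF stable_index_bounds(3,4)[OF \<alpha> \<alpha>']])
  interpret ST: pair_prob_space "stable_pos (\<alpha> / 2)" "stable_pos (\<alpha> * \<alpha>' / 2)" ..
  interpret YST: pair_prob_space "gamma_distr (1 - r)" "stable_pos (\<alpha> / 2) \<Otimes>\<^sub>M stable_pos (\<alpha> * \<alpha>' / 2)" ..
  let ?K = "gamma_distr r \<Otimes>\<^sub>M (gamma_distr (1 - r) \<Otimes>\<^sub>M (stable_pos (\<alpha> / 2) \<Otimes>\<^sub>M stable_pos (\<alpha> * \<alpha>' / 2)))"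
  let ?b = "\<lambda>x y. 1 / ((x + y) / x) powr ((1 / \<alpha>') / \<alpha>)"
  let ?f = "\<lambda>(x, y, s1, s2). 1 / ((x + y) / x) powr (1 / (\<alpha> * \<alpha>')) * sqrt (s1 / s2)"
  \<comment> \<open>The exponent in the form p / \<alpha> with p = 1 / \<alpha>', as expected by
    \<open>beta_scale_powr\<close>.\<close>
  have p: "1 / (\<alpha> * \<alpha>') = (1 / \<alpha>') / \<alpha>" by simp
  show ?thesis
  proof (rule law_H_eqI[OF r(1) \<alpha> real_distribution_laplace_distr prob_space_stable_mixing_space _ char_laplace_distr])
    show "?f \<in> borel_measurable (stable_mixing_space r \<alpha> \<alpha>')"
      unfolding stable_mixing_space_def by measurable
    fix t :: real
    have "(\<integral>\<^sup>+z. ennreal (1 / (1 + (t * ?f z)\<^sup>2)) \<partial>?K) =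
      (\<integral>\<^sup>+x. \<integral>\<^sup>+y. \<integral>\<^sup>+s1. \<integral>\<^sup>+s2. ennreal (1 / (1 + (t * (?b x y * sqrt (s1 / s2)))\<^sup>2))
        \<partial>stable_pos (\<alpha> * \<alpha>' / 2) \<partial>stable_pos (\<alpha> / 2) \<partial>gamma_distr (1 - r) \<partial>gamma_distr r)"
      unfolding p
      by (subst nn_integral_pair4[OF X.real_distribution_axioms Y.real_distribution_axioms S.real_distribution_axioms
          T.real_distribution_axioms]) simp_all
    also have "\<dots> = (\<integral>\<^sup>+x. \<integral>\<^sup>+y. \<integral>\<^sup>+w. ennreal (exp (- (\<bar>t\<bar> powr \<alpha> * (x / (x + y)) powr (1 / \<alpha>') * w powr (1 / \<alpha>')))) \<partial>gamma_distr 1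
         \<partial>gamma_distr (1 - r) \<partial>gamma_distr r)"
    proof (rule nn_integral_gamma_pair_cong)
      fix x y :: real assume xy: "0 < x" "0 < y"
      let ?c = "t\<^sup>2 * (?b x y)\<^sup>2"
      have "(t * (?b x y * sqrt (s1 / s2)))\<^sup>2 = ?c * \<bar>s1 / s2\<bar>" for s1 s2
      proof -
        \<comment> \<open>The real \<open>sqrt\<close> is odd, so its square is the absolute value
          whatever the sign of the ratio.\<close>
        have "(sqrt (s1 / s2))\<^sup>2 = \<bar>s1 / s2\<bar>"
          unfolding power2_eq_square by (rule real_sqrt_mult_self)
        thus ?thesis unfolding power_mult_distrib by (simp only: mult.assoc)
      qed
      moreover have "(\<integral>\<^sup>+s1. \<integral>\<^sup>+s2. ennreal (1 / (1 + ?c * \<bar>s1 / s2\<bar>)) \<partial>stable_pos (\<alpha> * \<alpha>' / 2) \<partial>stable_pos (\<alpha> / 2)) =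
        (\<integral>\<^sup>+w. ennreal (exp (- (?c powr (\<alpha> / 2) * w powr (1 / \<alpha>')))) \<partial>gamma_distr 1)"
        using stable_ratio_mixture[of "\<alpha> / 2" \<alpha>' ?c] stable_index_bounds[OF \<alpha> \<alpha>'] \<alpha>' by simp
      ultimately show "(\<integral>\<^sup>+s1. \<integral>\<^sup>+s2. ennreal (1 / (1 + (t * (?b x y * sqrt (s1 / s2)))\<^sup>2)) \<partial>stable_pos (\<alpha> * \<alpha>' / 2) \<partial>stable_pos (\<alpha> / 2)) =
        (\<integral>\<^sup>+w. ennreal (exp (- (\<bar>t\<bar> powr \<alpha> * (x / (x + y)) powr (1 / \<alpha>') * w powr (1 / \<alpha>')))) \<partial>gamma_distr 1)"
        by (simp only: beta_scale_powr(1)[OF xy \<alpha>(1)])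
    qed
    also have "\<dots> = (\<integral>\<^sup>+g. ennreal (exp (- (\<bar>t\<bar> powr \<alpha> * g powr (1 / \<alpha>')))) \<partial>gamma_distr r)"
      by (rule beta_gamma_mixture[OF r])
    finally show "(\<integral>\<^sup>+z. ennreal (1 / (1 + (t * ?f z)\<^sup>2)) \<partial>stable_mixing_space r \<alpha> \<alpha>') =
      (\<integral>\<^sup>+g. ennreal (exp (- (\<bar>t\<bar> powr \<alpha> * g powr (1 / \<alpha>')))) \<partial>gamma_distr r)"
      unfolding stable_mixing_space_def .
  qed auto
qed

end

end

section \<open>Infinite divisibility of Laplace mixtures\<close>

text \<open>The mixture is realized as the law of Y_N, where the Y_k are the coordinates of the
  infinite product of the laws \<mu> k and N is an independent index with weights a.\<close>

lemma mixture_exists: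
  assumes \<mu>: "\<And>k::nat. real_distribution (\<mu> k)"
    and a: "\<And>k. 0 \<le> a k" "a sums 1"
  shows "\<exists>\<nu>. real_distribution \<nu> \<and> (\<forall>t. (\<lambda>k. complex_of_real (a k) * char (\<mu> k) t) sums char \<nu> t)"
proof -
  interpret \<mu>: real_distribution "\<mu> k" for k by (rule \<mu>)
  define p where "p = embed_pmf a"
  have p: "pmf p k = a k" for k
    unfolding p_def
  proof (rule pmf_embed_pmf)
    show "(\<integral>\<^sup>+x. ennreal (a x) \<partial>count_space UNIV) = 1"
      using a by (subst nn_integral_count_space_nat) (simp add: suminf_ennreal2 sums_iff)
  qed (rule a)
  define Q where "Q = PiM UNIV \<mu>"
  interpret Q: prob_space Q unfolding Q_def by (rule prob_space_PiM) (rule \<mu>.prob_space_axioms)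
  interpret P: pair_prob_space "measure_pmf p" Q ..
  have comp[measurable]: "(\<lambda>\<omega>. \<omega> k) \<in> borel_measurable Q" for k
    unfolding Q_def by measurable
  \<comment> \<open>Evaluation at a random coordinate is jointly measurable because the index set is
    countable.\<close>
  have "(\<lambda>z. snd z (fst z)) \<in> borel_measurable (count_space UNIV \<Otimes>\<^sub>M Q)"
    by (rule measurable_pair_measure_countable1) auto
  hence meas[measurable]: "(\<lambda>z. snd z (fst z)) \<in> borel_measurable (measure_pmf p \<Otimes>\<^sub>M Q)"
    by (subst measurable_cong_sets[OF sets_pair_measure_cong[OF sets_measure_pmf_count_space refl] refl])
  define \<nu> where "\<nu> = distr (measure_pmf p \<Otimes>\<^sub>M Q) borel (\<lambda>z. snd z (fst z))"
  have "(\<lambda>k. complex_of_real (a k) * char (\<mu> k) t) sums char \<nu> t" for t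
  proof -
    have inner: "(\<integral>\<omega>. iexp (t * \<omega> k) \<partial>Q) = char (\<mu> k) t" for k
    proof -
      have "char (\<mu> k) t = (\<integral>x. iexp (t * x) \<partial>distr Q (\<mu> k) (\<lambda>\<omega>. \<omega> k))"
        unfolding Q_def char_def by (subst distr_PiM_component) (auto intro: \<mu>.prob_space_axioms)
      also have "\<dots> = (\<integral>\<omega>. iexp (t * \<omega> k) \<partial>Q)"
        by (subst integral_distr) (auto simp: Q_def)
      finally show ?thesis ..
    qed
    have "char \<nu> t = (\<integral>z. iexp (t * (snd z (fst z))) \<partial>(measure_pmf p \<Otimes>\<^sub>M Q))"
      unfolding \<nu>_def char_def by (rule integral_distr) auto
    also have "\<dots> = (\<integral>k. \<integral>\<omega>. iexp (t * \<omega> k) \<partial>Q \<partial>measure_pmf p)"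
      by (subst P.integral_fst'[symmetric]) (auto intro!: P.integrable_const_bound[where B = 1])
    also have "\<dots> = (\<integral>k. a k *\<^sub>R char (\<mu> k) t \<partial>count_space UNIV)"
      unfolding inner measure_pmf_eq_density p by (rule integral_density) (auto simp: a)
    also have "\<dots> = (\<Sum>k. a k *\<^sub>R char (\<mu> k) t)"
    proof (intro integral_count_space_nat)
      have "summable (\<lambda>k. norm (a k *\<^sub>R char (\<mu> k) t))"
        by (rule summable_comparison_test'[OF sums_summable[OF a(2)]])
           (auto simp: a intro!: mult_left_le \<mu>.cmod_char_le_1)
      thus "integrable (count_space UNIV) (\<lambda>k. a k *\<^sub>R char (\<mu> k) t)"
        by (simp add: integrable_count_space_nat_iff)
    qed
    finally have "char \<nu> t = (\<Sum>k. complex_of_real (a k) * char (\<mu> k) t)"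
      by (simp add: scaleR_conv_of_real)
    moreover have "summable (\<lambda>k. complex_of_real (a k) * char (\<mu> k) t)"
      by (rule summable_comparison_test'[OF sums_summable[OF a(2)]])
         (auto simp: a norm_mult intro!: mult_left_le \<mu>.cmod_char_le_1)
    ultimately show ?thesis by (simp add: sums_iff)
  qed
  moreover have "real_distribution \<nu>"
    unfolding \<nu>_def by (rule P.real_distribution_distr) (rule meas)
  ultimately show ?thesis by blast
qed

text \<open>Only symmetric laws occur in this part. Speaking of their real characteristic functions
  reduces the argument to closure under products, power series with probability weights, and
  limits.\<close>

definition real_char :: "(real \<Rightarrow> real) \<Rightarrow> bool" where
  "real_char \<phi> \<longleftrightarrow> (\<exists>\<mu>. real_distribution \<mu> \<and> (\<forall>t. char \<mu> t = complex_of_real (\<phi> t)))"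

lemma real_char_mult: "real_char \<phi> \<Longrightarrow> real_char \<psi> \<Longrightarrow> real_char (\<lambda>t. \<phi> t * \<psi> t)"
  unfolding real_char_def
  by (elim exE conjE, rule_tac x = "convolution \<mu> \<mu>'" in exI) (auto simp: char_convolution real_distribution_convolution)

text \<open>A random sum in disguise: \<phi>^k belongs to the k-fold convolution power, and the
  weights a choose k at random.\<close>

lemma real_char_power_series:
  assumes \<phi>: "real_char \<phi>" and a: "\<And>k::nat. 0 \<le> a k" "a sums 1"
    and \<psi>: "\<And>t. (\<lambda>k. a k * \<phi> t ^ k) sums \<psi> t"
  shows "real_char \<psi>"
proof -
  obtain \<mu> where \<mu>: "real_distribution \<mu>" "\<And>t. char \<mu> t = complex_of_real (\<phi> t)"
    using \<phi> by (auto simp: real_char_def)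
  obtain \<nu> where \<nu>: "real_distribution \<nu>" "\<And>t. (\<lambda>k. complex_of_real (a k) * char (conv_pow \<mu> k) t) sums char \<nu> t"
    using mixture_exists[of "conv_pow \<mu>", OF real_distribution_conv_pow[OF \<mu>(1)] a] by blast
  have "char \<nu> t = complex_of_real (\<psi> t)" for t
  proof (rule sums_unique2[OF \<nu>(2)])
    show "(\<lambda>k. complex_of_real (a k) * char (conv_pow \<mu> k) t) sums complex_of_real (\<psi> t)"
      using sums_of_real[OF \<psi>[of t]] by (simp add: char_conv_pow \<mu>)
  qed
  thus ?thesis using \<nu>(1) by (auto simp: real_char_def)
qed

lemma real_char_limit:
  assumes "\<And>n. real_char (\<phi> n)" "\<And>t. (\<lambda>n. \<phi> n t) \<longlonglongrightarrow> \<psi> t" "isCont \<psi> 0"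
  shows "real_char \<psi>"
proof -
  obtain \<mu> where \<mu>: "\<And>n. real_distribution (\<mu> n)" "\<And>n t. char (\<mu> n) t = complex_of_real (\<phi> n t)"
    using assms(1) unfolding real_char_def by metis
  have "\<exists>M. real_distribution M \<and> char M = (\<lambda>t. complex_of_real (\<psi> t)) \<and> weak_conv_m \<mu> M"
    by (rule levy_continuity_exists[OF \<mu>(1)]) (auto simp: \<mu> intro!: tendsto_of_real assms continuous_intros)
  thus ?thesis unfolding real_char_def by metis
qed

text \<open>The normal mixture over G / c with G gamma of shape s: E exp(-t^2 G / c) = (1 + t^2 /
  c)^(-s). For s = 1 it is a scaled Laplace law.\<close>

lemma real_char_variance_gamma:
  assumes s: "0 < s" and c: "0 < c"
  shows "real_char (\<lambda>t. (c / (c + t\<^sup>2)) powr s)"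
proof -
  interpret G: real_distribution "gamma_distr s" by (rule real_distribution_gamma_distr[OF s])
  define K where "K = distr (gamma_distr s) borel (\<lambda>g. g / c)"
  have K: "real_distribution K" unfolding K_def by (rule G.real_distribution_distr) simp
  have "AE z in K. 0 \<le> z"
    unfolding K_def using AE_gamma_distr_pos[of s] c
    by (subst AE_distr_iff) (auto elim!: eventually_mono)
  hence "char (normal_mixture K) t = complex_of_real ((c / (c + t\<^sup>2)) powr s)" for t
  proof -
    have "(\<integral>z. exp (- (t\<^sup>2) * z) \<partial>K) = (\<integral>g. exp (- (t\<^sup>2 / c) * g) \<partial>gamma_distr s)"
      unfolding K_def by (subst integral_distr) auto
    also have "\<dots> = (1 + t\<^sup>2 / c) powr (- s)"
      using c by (intro gamma_distr_laplace[OF s]) simp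
    also have "1 + t\<^sup>2 / c = inverse (c / (c + t\<^sup>2))"
      using c by (simp add: field_simps)
    also have "inverse (c / (c + t\<^sup>2)) powr (- s) = (c / (c + t\<^sup>2)) powr s"
      using c by (simp add: powr_def ln_inverse ln_div add_pos_nonneg algebra_simps)
    finally show ?thesis
      using \<open>AE z in K. 0 \<le> z\<close> by (simp only: char_normal_mixture[OF K])
  qed
  thus ?thesis using real_distribution_normal_mixture[OF K] by (auto simp: real_char_def)
qed

text \<open>f is the coefficient sequence of 1 - 1 / U for the generating series U of u.
  Log-convexity means that the ratios u (k + 1) / u k are nondecreasing, and this makes f
  nonnegative; the bound f \<le> u then follows from the recursion.\<close>

lemma kaluza_logconvex_renewal:
  fixes u :: "nat \<Rightarrow> real"
  assumes u0: "u 0 = 1" and pos: "\<And>k. 0 < u k" and logconv: "\<And>k. u (Suc k) ^ 2 \<le> u k * u (Suc (Suc k))"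
  shows "\<exists>f. (\<forall>k. 0 \<le> f k \<and> f k \<le> u k) \<and> f 0 = 0 \<and> (\<forall>n\<ge>1. u n = (\<Sum>i\<le>n. f i * u (n - i)))"
proof -
  define U where "U = Abs_fps u"
  define f where "f = fps_nth (1 - inverse U)"
  have U0: "fps_nth U 0 \<noteq> 0" by (simp add: U_def u0)
  have "(1 - inverse U) * U = U - 1"
    using inverse_mult_eq_1[OF U0] by (simp add: algebra_simps)
  hence "fps_nth ((1 - inverse U) * U) n = fps_nth (U - 1) n" for n by simp
  hence conv: "(\<Sum>i=0..n. f i * u (n - i)) = u n - (if n = 0 then 1 else 0)" for n
    by (simp add: fps_mult_nth f_def U_def del: fps_sub_nth) (simp add: fps_one_nth)
  have f0: "f 0 = 0" using conv[of 0] u0 by simp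
  have rec: "f (Suc n) = u (Suc n) - (\<Sum>i\<le>n. f i * u (Suc n - i))" for n
    using conv[of "Suc n"] u0 by (simp add: atLeast0AtMost)
  have ratio_step: "u (Suc k) / u k \<le> u (Suc (Suc k)) / u (Suc k)" for k
    using logconv[of k] pos by (simp add: divide_simps power2_eq_square mult.commute)
  have ratio: "u (Suc j) / u j \<le> u (Suc k) / u k" if "j \<le> k" for j k
    using lift_Suc_mono_le[of "\<lambda>k. u (Suc k) / u k", OF ratio_step that] .
  have nonneg: "0 \<le> f n" for n
  proof (induction n rule: less_induct)
    case (less n)
    show ?case
    proof (cases n)
      case 0
      thus ?thesis by (simp add: f0)
    next
      case (Suc m)
      show ?thesis
      proof (cases m)
        case 0
        thus ?thesis using Suc rec[of 0] f0 pos[of 1] by simp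
      next
        case (Suc l)
        \<comment> \<open>q is the largest ratio up to index m. Expanding u m by the renewal
          equation, valid because m \<ge> 1 in this case, and multiplying by q dominates the sum in
          \<open>rec\<close> term by term; the surplus is f (Suc m).\<close>
        define q where "q = u (Suc m) / u m"
        have "u (Suc m) = q * u m" using pos[of m] by (simp add: q_def)
        also have "u m = (\<Sum>i\<le>m. f i * u (m - i))"
          using conv[of m] Suc by (simp add: atLeast0AtMost)
        finally have um: "u (Suc m) = (\<Sum>i\<le>m. f i * (q * u (m - i)))"
          by (simp add: sum_distrib_left mult_ac)
        have "(\<Sum>i\<le>m. f i * u (Suc m - i)) \<le> (\<Sum>i\<le>m. f i * (q * u (m - i)))"
        proof (intro sum_mono mult_left_mono)
          fix i assume i: "i \<in> {..m}"
          show "0 \<le> f i" using i \<open>n = Suc m\<close> by (intro less) auto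
          have "u (Suc (m - i)) / u (m - i) \<le> q" unfolding q_def by (rule ratio) simp
          hence "u (Suc (m - i)) \<le> q * u (m - i)" using pos[of "m - i"] by (simp add: pos_divide_le_eq)
          thus "u (Suc m - i) \<le> q * u (m - i)" using i by (simp add: Suc_diff_le)
        qed
        thus ?thesis using rec[of m] \<open>n = Suc m\<close> um by simp
      qed
    qed
  qed
  have le: "f n \<le> u n" for n
  proof (cases n)
    case 0
    thus ?thesis using f0 u0 by simp
  next
    case (Suc m)
    have "0 \<le> (\<Sum>i\<le>m. f i * u (Suc m - i))"
      by (intro sum_nonneg mult_nonneg_nonneg nonneg less_imp_le[OF pos])
    thus ?thesis using rec[of m] Suc by simp
  qed
  show ?thesis
    using nonneg le f0 conv by (intro exI[of _ f]) (auto simp: atLeast0AtMost)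
qed

text \<open>These are the coefficients of (1 - y)^(-s), quotients of a rising factorial by a
  factorial.\<close>

lemma neg_binomial_coeff_nonneg:
  assumes "0 < (s::real)" shows "0 \<le> (- s gchoose j) * (- 1) ^ j"
proof -
  have "(- s gchoose j) * (- 1) ^ j = pochhammer s j / fact j"
    by (simp add: gbinomial_pochhammer mult_ac flip: power_mult_distrib)
  thus ?thesis using assms by (simp add: pochhammer_nonneg)
qed

text \<open>Kaluza's theorem gives g = m 0 / (1 - F(\<phi>)). Dividing F(\<phi>) by the total mass
  \<theta> of F yields a characteristic function \<xi>, and g^s = (m 0)^s (1 - \<theta> \<xi>)^(-s)
  expands into a power series in \<xi> with nonnegative coefficients of sum (m 0)^s (1 -
  \<theta>)^(-s) = 1.\<close>

lemma real_char_logconvex_root: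
  fixes m :: "nat \<Rightarrow> real"
  assumes \<phi>: "real_char \<phi>" "\<And>t. 0 \<le> \<phi> t" "\<And>t. \<phi> t \<le> 1"
    and m: "\<And>k. 0 < m k" "m sums 1" "\<And>k. m (Suc k) ^ 2 \<le> m k * m (Suc (Suc k))" and m0: "m 0 < 1"
    and g: "\<And>t. (\<lambda>k. m k * \<phi> t ^ k) sums g t" and s: "0 < s"
  shows "real_char (\<lambda>t. g t powr s)"
proof -
  define u where "u k = m k / m 0" for k
  have u: "u 0 = 1" "\<And>k. 0 < u k" "\<And>k. u (Suc k) ^ 2 \<le> u k * u (Suc (Suc k))"
    using m less_imp_neq[OF m(1)[of 0]] by (auto simp: u_def power_divide power2_eq_square intro!: divide_right_mono)
  obtain f where f: "\<And>k. 0 \<le> f k" "\<And>k. f k \<le> u k" "f 0 = 0" "\<And>n. n \<ge> 1 \<Longrightarrow> u n = (\<Sum>i\<le>n. f i * u (n - i))"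
    using kaluza_logconvex_renewal[OF u] by metis
  have u_sums: "u sums (1 / m 0)" unfolding u_def by (rule sums_divide[OF m(2)])
  have u_sum: "summable u" using u_sums by (rule sums_summable)
  have f_sum: "summable f"
    by (rule summable_comparison_test'[OF u_sum]) (use f in auto)
  \<comment> \<open>The renewal equation for generating functions: the Cauchy product gives F U = U
    - 1, and U \<ge> u 0 = 1 allows division by U.\<close>
  have F: "(\<lambda>k. f k * x ^ k) sums (1 - 1 / U)" "1 \<le> U"
    if x: "0 \<le> x" "x \<le> 1" and U: "(\<lambda>k. u k * x ^ k) sums U" for x U
  proof -
    have le: "y * x ^ k \<le> y" "0 \<le> y * x ^ k" if "0 \<le> y" for y k
      using x that by (auto intro!: mult_left_le power_le_one)
    have sf: "summable (\<lambda>k. norm (f k * x ^ k))"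
      by (rule summable_comparison_test'[OF f_sum]) (use f le x in \<open>auto simp: abs_mult\<close>)
    have su: "summable (\<lambda>k. norm (u k * x ^ k))"
    proof (rule summable_comparison_test'[OF u_sum])
      show "norm (norm (u k * x ^ k)) \<le> u k" if "0 \<le> k" for k
        using le[of "u k" k] u(2)[of k] by simp
    qed
    have "(\<lambda>k. \<Sum>i\<le>k. (f i * x ^ i) * (u (k - i) * x ^ (k - i))) sums ((\<Sum>k. f k * x ^ k) * (\<Sum>k. u k * x ^ k))"
      by (rule Cauchy_product_sums[OF sf su])
    moreover have "(\<Sum>i\<le>k. (f i * x ^ i) * (u (k - i) * x ^ (k - i))) = u k * x ^ k - (if k = 0 then 1 else 0)" for k
    proof -
      have "(\<Sum>i\<le>k. (f i * x ^ i) * (u (k - i) * x ^ (k - i))) = (\<Sum>i\<le>k. f i * u (k - i) * x ^ k)"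
        by (intro sum.cong) (auto simp: power_add[symmetric] mult_ac)
      also have "\<dots> = (\<Sum>i\<le>k. f i * u (k - i)) * x ^ k" by (simp add: sum_distrib_right)
      finally show ?thesis using f(3) f(4)[of k] u(1) by (cases "k = 0") auto
    qed
    ultimately have 1: "(\<lambda>k. u k * x ^ k - (if k = 0 then 1 else 0)) sums ((\<Sum>k. f k * x ^ k) * U)"
      using U by (simp add: sums_iff)
    have "(\<lambda>k. u k * x ^ k - (if k = 0 then 1 else 0)) sums (U - 1)"
      by (intro sums_diff U) (use sums_single[of 0 "\<lambda>_. 1 :: real"] in auto)
    from sums_unique2[OF 1 this] have 2: "(\<Sum>k. f k * x ^ k) * U = U - 1" .
    have "(\<Sum>k\<in>{0}. u k * x ^ k) \<le> (\<Sum>k. u k * x ^ k)"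
      by (intro sum_le_suminf sums_summable[OF U]) (use less_imp_le[OF u(2)] x in auto)
    thus U1: "1 \<le> U" using U u(1) by (simp add: sums_iff)
    hence "(\<Sum>k. f k * x ^ k) = 1 - 1 / U" using 2 by (simp add: field_simps)
    thus "(\<lambda>k. f k * x ^ k) sums (1 - 1 / U)"
      using summable_norm_cancel[OF sf] by (simp add: sums_iff)
  qed
  \<comment> \<open>The total mass of f, since 1 - 1 / U at x = 1 is taken at U = 1 / m 0. It is
    positive because m 0 < 1, so the weights f can be normalized.\<close>
  define \<theta> where "\<theta> = 1 - m 0"
  have \<theta>: "0 < \<theta>" "\<theta> < 1" using m0 m(1)[of 0] by (auto simp: \<theta>_def)
  have f_sums: "f sums \<theta>"
    using F(1)[of 1 "1 / m 0"] u_sums by (simp add: \<theta>_def)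
  define \<xi> where "\<xi> t = (1 - m 0 / g t) / \<theta>" for t
  have gU: "(\<lambda>k. u k * \<phi> t ^ k) sums (g t / m 0)" for t
    using sums_divide[OF g[of t], of "m 0"] by (simp add: u_def)
  have g_pos: "m 0 \<le> g t" for t
    using F(2)[OF \<phi>(2,3) gU, of t] m(1)[of 0] by (simp add: divide_simps)
  have \<xi>_char: "real_char \<xi>"
  proof (rule real_char_power_series[OF \<phi>(1), of "\<lambda>k. f k / \<theta>"])
    show "0 \<le> f k / \<theta>" for k using f \<theta> by simp
    show "(\<lambda>k. f k / \<theta>) sums 1" using sums_divide[OF f_sums, of \<theta>] \<theta> by simp
    show "(\<lambda>k. f k / \<theta> * \<phi> t ^ k) sums \<xi> t" for t
      using sums_divide[OF F(1)[OF \<phi>(2,3) gU, of t], of \<theta>] by (simp add: \<xi>_def)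
  qed
  have ser: "(\<lambda>j. m 0 powr s * ((- s gchoose j) * (- 1) ^ j * \<theta> ^ j) * y ^ j) sums (m 0 powr s * (1 - \<theta> * y) powr (- s))"
    if "0 \<le> y" "y \<le> 1" for y
  proof -
    have "\<theta> * y \<le> \<theta> * 1" using that \<theta> by (intro mult_left_mono) auto
    also have "\<dots> < 1" using \<theta> by simp
    finally have "\<bar>- (\<theta> * y)\<bar> < 1" using that \<theta> by auto
    from sums_mult[OF gen_binomial_real[OF this, of "- s"], of "m 0 powr s"]
    have "(\<lambda>j. m 0 powr s * ((- s gchoose j) * (- (\<theta> * y)) ^ j)) sums (m 0 powr s * (1 - \<theta> * y) powr (- s))"
      by simp
    moreover have "(- (\<theta> * y)) ^ j = (- 1) ^ j * \<theta> ^ j * y ^ j" for j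
      by (simp add: power_minus[of "\<theta> * y"] power_mult_distrib)
    ultimately show ?thesis by (simp add: mult_ac)
  qed
  show ?thesis
  proof (rule real_char_power_series[OF \<xi>_char])
    show "0 \<le> m 0 powr s * ((- s gchoose j) * (- 1) ^ j * \<theta> ^ j)" for j
      using mult_nonneg_nonneg[OF neg_binomial_coeff_nonneg[OF s, of j], of "\<theta> ^ j"] \<theta> by simp
    show "(\<lambda>j. m 0 powr s * ((- s gchoose j) * (- 1) ^ j * \<theta> ^ j)) sums 1"
      using ser[of 1] m(1)[of 0] by (simp add: \<theta>_def powr_minus)
    fix t
    have "g t \<le> 1"
    proof (rule sums_le[OF _ g m(2)])
      show "m k * \<phi> t ^ k \<le> m k" for k
        using less_imp_le[OF m(1)] \<phi>(2,3) by (intro mult_left_le power_le_one)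
    qed
    hence "m 0 / g t \<ge> m 0" "m 0 / g t \<le> 1"
      using g_pos[of t] m(1)[of 0] by (auto simp: divide_simps mult_left_le)
    hence "0 \<le> \<xi> t" "\<xi> t \<le> 1" using \<theta> by (auto simp: \<xi>_def \<theta>_def)
    from ser[OF this] have "(\<lambda>j. m 0 powr s * ((- s gchoose j) * (- 1) ^ j * \<theta> ^ j) * \<xi> t ^ j) sums
      (m 0 powr s * (1 - \<theta> * \<xi> t) powr (- s))" .
    moreover have "1 - \<theta> * \<xi> t = m 0 / g t" using \<theta> by (simp add: \<xi>_def)
    moreover have "m 0 powr s * (m 0 / g t) powr (- s) = g t powr s"
      using m(1)[of 0] g_pos[of t] by (simp add: powr_minus powr_divide)
    ultimately show "(\<lambda>j. m 0 powr s * ((- s gchoose j) * (- 1) ^ j * \<theta> ^ j) * \<xi> t ^ j) sums (g t powr s)"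
      by simp
  qed
qed

lemma (in prob_space) integral_pos:
  fixes f :: "'a \<Rightarrow> real"
  assumes "integrable M f" and pos: "AE x in M. 0 < f x"
  shows "0 < (\<integral>x. f x \<partial>M)"
proof -
  have nn: "AE x in M. 0 \<le> f x" using pos by eventually_elim auto
  have "(\<integral>x. f x \<partial>M) \<noteq> 0"
  proof
    assume "(\<integral>x. f x \<partial>M) = 0"
    hence "AE x in M. f x = 0" using assms(1) nn by (simp add: integral_nonneg_eq_0_iff_AE)
    with pos have "AE x in M. False" by eventually_elim auto
    thus False by simp
  qed
  thus ?thesis using integral_nonneg_AE[OF nn] by simp
qed

text \<open>With p = 1 / (c v) the integrand 1 / (1 + t^2 v) equals \<phi> p / (1 - (1 - p) \<phi>),
  a geometric series in \<phi>. The bound v \<ge> 2 / c makes p \<le> 1/2, so 1 - p is bounded away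
  from 0; this keeps all moments positive and m 0 below 1.\<close>

lemma real_char_laplace_mixture_root_bounded:
  assumes K: "real_distribution K" and c: "0 < c" and V: "AE v in K. 2 / c \<le> v" and s: "0 < s"
  shows "real_char (\<lambda>t. (\<integral>v. 1 / (1 + t\<^sup>2 * v) \<partial>K) powr s)"
proof -
  interpret K: real_distribution K by fact
  define p where "p v = 1 / (c * v)" for v :: real
  define \<phi> where "\<phi> t = c / (c + t\<^sup>2)" for t :: real
  define m where "m k = (\<integral>v. p v * (1 - p v) ^ k \<partial>K)" for k
  have [measurable]: "p \<in> borel_measurable borel" unfolding p_def by measurable
  have p: "AE v in K. 0 < p v \<and> p v \<le> 1 / 2 \<and> 0 < v"
    using V
  proof eventually_elim
    case (elim v)
    hence "2 \<le> c * v" using c by (simp add: field_simps)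
    moreover have "0 < v" using elim c by (smt (verit) divide_pos_pos)
    ultimately show ?case using c by (simp add: p_def field_simps)
  qed
  have int: "integrable K (\<lambda>v. p v * (1 - p v) ^ k)" for k
  proof (rule K.integrable_const_bound[where B = 1])
    show "AE v in K. norm (p v * (1 - p v) ^ k) \<le> 1"
      using p by eventually_elim (auto simp: abs_mult power_abs intro!: mult_le_one power_le_one)
  qed simp
  have m_pos: "0 < m k" for k
    unfolding m_def
  proof (rule K.integral_pos[OF int])
    show "AE v in K. 0 < p v * (1 - p v) ^ k"
      using p by eventually_elim (auto intro!: mult_pos_pos)
  qed
  have m0: "m 0 < 1"
  proof -
    have "m 0 \<le> (\<integral>v. 1 / 2 \<partial>K)"
      unfolding m_def
    proof (rule integral_mono_AE[OF int])
      show "AE v in K. p v * (1 - p v) ^ 0 \<le> 1 / 2" using p by eventually_elim simp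
    qed simp
    thus ?thesis using K.prob_space by simp
  qed
  have logconv: "m (Suc k) ^ 2 \<le> m k * m (Suc (Suc k))" for k
  proof -
    \<comment> \<open>The Cauchy-Schwarz inequality for the weight p (1 - p)^k: the quadratic E p (1
      - p)^k (1 - p - l)^2 is nonnegative, and this l minimizes it.\<close>
    define l where "l = m (Suc k) / m k"
    have eq: "p v * (1 - p v) ^ k * (1 - p v - l) ^ 2 =
      p v * (1 - p v) ^ Suc (Suc k) - 2 * l * (p v * (1 - p v) ^ Suc k) + l ^ 2 * (p v * (1 - p v) ^ k)" for v
      by (simp add: power2_eq_square algebra_simps)
    have "0 \<le> (\<integral>v. p v * (1 - p v) ^ k * (1 - p v - l) ^ 2 \<partial>K)"
    proof (rule integral_nonneg_AE)
      show "AE v in K. 0 \<le> p v * (1 - p v) ^ k * (1 - p v - l) ^ 2" using p by eventually_elim simp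
    qed
    also have "\<dots> = m (Suc (Suc k)) - 2 * l * m (Suc k) + l ^ 2 * m k"
      unfolding eq m_def
      by (subst Bochner_Integration.integral_add, (intro integrable_mult_right Bochner_Integration.integrable_diff int)+,
          subst Bochner_Integration.integral_diff) (auto simp: int intro!: integrable_mult_right int simp del: power_Suc)
    also have "\<dots> = m (Suc (Suc k)) - m (Suc k) ^ 2 / m k"
      using m_pos[of k] by (simp add: l_def power2_eq_square field_simps)
    finally show ?thesis using m_pos[of k] by (simp add: field_simps)
  qed
  have series: "(\<lambda>k. m k * x ^ k) sums (\<integral>v. p v / (1 - (1 - p v) * x) \<partial>K)" if x: "0 \<le> x" "x \<le> 1" for x
    unfolding sums_def
  proof -
    have geo: "(\<lambda>k. p v * (1 - p v) ^ k * x ^ k) sums (p v / (1 - (1 - p v) * x))"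
      if "0 < p v" "p v \<le> 1 / 2" for v
    proof -
      have "(1 - p v) * x \<le> (1 - p v) * 1" using that x by (intro mult_left_mono) auto
      also have "\<dots> < 1" using that by simp
      finally have "(1 - p v) * x < 1" .
      moreover have "0 \<le> (1 - p v) * x" using that x by simp
      ultimately have "norm ((1 - p v) * x) < 1" by simp
      from sums_mult[OF geometric_sums[OF this], of "p v"] show ?thesis
        by (simp add: power_mult_distrib mult_ac)
    qed
    have "(\<lambda>n. \<integral>v. (\<Sum>k<n. p v * (1 - p v) ^ k * x ^ k) \<partial>K) \<longlonglongrightarrow> (\<integral>v. p v / (1 - (1 - p v) * x) \<partial>K)"
    proof (rule integral_dominated_convergence[where w = "\<lambda>_. 1"])
      show "AE v in K. (\<lambda>n. \<Sum>k<n. p v * (1 - p v) ^ k * x ^ k) \<longlonglongrightarrow> p v / (1 - (1 - p v) * x)"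
        using p by eventually_elim (use geo in \<open>auto simp: sums_def\<close>)
      \<comment> \<open>The terms are nonnegative and sum to p / (1 - (1 - p) x), which is at most 1
        because (1 - p) x \<le> 1 - p.\<close>
      show "AE v in K. norm (\<Sum>k<n. p v * (1 - p v) ^ k * x ^ k) \<le> 1" for n
        using p
      proof eventually_elim
        case (elim v)
        have nn: "0 \<le> (\<Sum>k<n. p v * (1 - p v) ^ k * x ^ k)"
          using elim x by (intro sum_nonneg) auto
        have "(\<Sum>k<n. p v * (1 - p v) ^ k * x ^ k) \<le> p v / (1 - (1 - p v) * x)"
          using geo[of v] elim x by (subst sums_unique[OF geo]) (auto intro!: sum_le_suminf sums_summable)
        also have "\<dots> \<le> 1"
        proof -
          define d where "d = (1 - p v) * x"
          have "d \<le> (1 - p v) * 1" unfolding d_def using elim x by (intro mult_left_mono) auto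
          thus ?thesis unfolding d_def[symmetric] using elim by (simp add: divide_le_eq_1)
        qed
        finally show ?case using nn by simp
      qed
    qed auto
    moreover have "(\<integral>v. (\<Sum>k<n. p v * (1 - p v) ^ k * x ^ k) \<partial>K) = (\<Sum>k<n. m k * x ^ k)" for n
      unfolding m_def by (subst Bochner_Integration.integral_sum) (auto intro: int)
    ultimately show "(\<lambda>n. \<Sum>k<n. m k * x ^ k) \<longlonglongrightarrow> (\<integral>v. p v / (1 - (1 - p v) * x) \<partial>K)" by simp
  qed
  have m_sums: "m sums 1"
  proof -
    have "(\<integral>v. p v / (1 - (1 - p v) * 1) \<partial>K) = (\<integral>v. 1 \<partial>K)"
    proof (rule integral_cong_AE, goal_cases)
      case 3
      show ?case using p by eventually_elim simp
    qed auto
    thus ?thesis using series[of 1] K.prob_space by simp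
  qed
  have \<phi>01: "0 \<le> \<phi> t" "\<phi> t \<le> 1" "0 < \<phi> t" for t
    using c by (auto simp: \<phi>_def divide_simps add_pos_nonneg)
  have "real_char \<phi>"
    using real_char_variance_gamma[OF zero_less_one c] c by (simp add: \<phi>_def[abs_def])
  hence "real_char (\<lambda>t. (\<integral>v. p v / (1 - (1 - p v) * \<phi> t) \<partial>K) powr s)"
    by (rule real_char_logconvex_root[OF _ \<phi>01(1,2) m_pos m_sums logconv m0 series[OF \<phi>01(1,2)] s])
  \<comment> \<open>The factor \<phi> in front of the series has its own root, a variance gamma
    characteristic function.\<close>
  hence "real_char (\<lambda>t. \<phi> t powr s * (\<integral>v. p v / (1 - (1 - p v) * \<phi> t) \<partial>K) powr s)"
    using real_char_variance_gamma[OF s c] by (intro real_char_mult) (auto simp: \<phi>_def)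
  moreover have "\<phi> t powr s * (\<integral>v. p v / (1 - (1 - p v) * \<phi> t) \<partial>K) powr s = (\<integral>v. 1 / (1 + t\<^sup>2 * v) \<partial>K) powr s" for t
  proof -
    have "\<phi> t * (\<integral>v. p v / (1 - (1 - p v) * \<phi> t) \<partial>K) = (\<integral>v. \<phi> t * (p v / (1 - (1 - p v) * \<phi> t)) \<partial>K)"
      by (rule integral_mult_right_zero[symmetric])
    also have "\<dots> = (\<integral>v. 1 / (1 + t\<^sup>2 * v) \<partial>K)"
    proof (rule integral_cong_AE, goal_cases)
      case 3
      show ?case
        using p
      proof eventually_elim
        case (elim v)
        define D where "D = c + t\<^sup>2"
        have D: "0 < D" using c by (simp add: D_def add_pos_nonneg)
        have "1 - (1 - p v) * \<phi> t = (D - (1 - p v) * c) / D"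
          using D by (simp add: \<phi>_def D_def[symmetric] diff_divide_distrib)
        also have "D - (1 - p v) * c = (1 + t\<^sup>2 * v) / v"
          using elim c by (simp add: D_def p_def field_simps)
        finally have "\<phi> t * (p v / (1 - (1 - p v) * \<phi> t)) = c / D * (1 / (c * v) / ((1 + t\<^sup>2 * v) / v / D))"
          by (simp add: \<phi>_def D_def p_def)
        also have "\<dots> = 1 / (1 + t\<^sup>2 * v)"
          using elim c D by simp
        finally show ?case .
      qed
    qed auto
    finally have "\<phi> t * (\<integral>v. p v / (1 - (1 - p v) * \<phi> t) \<partial>K) = (\<integral>v. 1 / (1 + t\<^sup>2 * v) \<partial>K)" .
    thus ?thesis using powr_mult[of "\<phi> t" "\<integral>v. p v / (1 - (1 - p v) * \<phi> t) \<partial>K" s] by simp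
  qed
  ultimately show ?thesis by simp
qed

lemma real_char_laplace_mixture_root:
  assumes K: "real_distribution K" and V: "AE v in K. 0 \<le> v" and s: "0 < s"
    and cont: "isCont (\<lambda>t. \<integral>v. 1 / (1 + t\<^sup>2 * v) \<partial>K) 0"
  shows "real_char (\<lambda>t. (\<integral>v. 1 / (1 + t\<^sup>2 * v) \<partial>K) powr s)"
proof (rule real_char_limit)
  interpret K: real_distribution K by fact
  \<comment> \<open>The shift makes V at least 2 / c with c = n + 1, the form required by the
    bounded case.\<close>
  define V' where "V' n v = v + 2 / real (Suc n)" for n v
  define K' where "K' n = distr K borel (V' n)" for n
  have [measurable]: "V' n \<in> borel_measurable borel" for n unfolding V'_def by measurable
  show "real_char (\<lambda>t. (\<integral>v. 1 / (1 + t\<^sup>2 * v) \<partial>K' n) powr s)" for n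
  proof (rule real_char_laplace_mixture_root_bounded[OF _ _ _ s])
    show "real_distribution (K' n)" unfolding K'_def by (rule K.real_distribution_distr) simp
    show "AE v in K' n. 2 / real (Suc n) \<le> v"
      unfolding K'_def using V by (subst AE_distr_iff) (auto elim!: eventually_mono simp: V'_def)
  qed simp
  have pos: "0 < (\<integral>v. 1 / (1 + t\<^sup>2 * v) \<partial>K)" for t
  proof (rule K.integral_pos)
    show "integrable K (\<lambda>v. 1 / (1 + t\<^sup>2 * v))"
      by (rule K.integrable_const_bound[where B = 1])
         (use V in \<open>auto elim!: eventually_mono simp: divide_le_eq_1 add_pos_nonneg\<close>)
    show "AE v in K. 0 < 1 / (1 + t\<^sup>2 * v)"
      using V by eventually_elim (simp add: add_pos_nonneg)
  qed
  show "(\<lambda>n. (\<integral>v. 1 / (1 + t\<^sup>2 * v) \<partial>K' n) powr s) \<longlonglongrightarrow> (\<integral>v. 1 / (1 + t\<^sup>2 * v) \<partial>K) powr s" for t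
  proof (intro tendsto_powr tendsto_const)
    have "(\<lambda>n. \<integral>v. 1 / (1 + t\<^sup>2 * V' n v) \<partial>K) \<longlonglongrightarrow> (\<integral>v. 1 / (1 + t\<^sup>2 * v) \<partial>K)"
    proof (rule integral_dominated_convergence[where w = "\<lambda>_. 1"])
      show "AE v in K. (\<lambda>n. 1 / (1 + t\<^sup>2 * V' n v)) \<longlonglongrightarrow> 1 / (1 + t\<^sup>2 * v)"
        using V
      proof eventually_elim
        case (elim v)
        have "(\<lambda>n. v + 2 * inverse (real (Suc n))) \<longlonglongrightarrow> v + 2 * 0"
          by (intro tendsto_intros LIMSEQ_inverse_real_of_nat)
        hence "(\<lambda>n. V' n v) \<longlonglongrightarrow> v" by (simp add: V'_def divide_inverse)
        moreover have "1 + t\<^sup>2 * v \<noteq> 0" using elim by (smt (verit) mult_nonneg_nonneg zero_le_power2)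
        ultimately show ?case by (intro tendsto_intros)
      qed
      show "AE v in K. norm (1 / (1 + t\<^sup>2 * V' n v)) \<le> 1" for n
        using V
      proof eventually_elim
        case (elim v)
        have "0 \<le> t\<^sup>2 * V' n v" using elim by (simp add: V'_def)
        thus ?case by simp
      qed
    qed auto
    thus "(\<lambda>n. \<integral>v. 1 / (1 + t\<^sup>2 * v) \<partial>K' n) \<longlonglongrightarrow> (\<integral>v. 1 / (1 + t\<^sup>2 * v) \<partial>K)"
      unfolding K'_def by (subst integral_distr) auto
    show "(\<integral>v. 1 / (1 + t\<^sup>2 * v) \<partial>K) \<noteq> 0" using pos[of t] by simp
  qed
  show "isCont (\<lambda>t. (\<integral>v. 1 / (1 + t\<^sup>2 * v) \<partial>K) powr s) 0"
    using cont pos[of 0] by (intro continuous_intros) auto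
qed

lemma inf_divisible_laplace_mixture:
  assumes \<mu>: "real_distribution \<mu>" and K: "real_distribution K" and V: "AE v in K. 0 \<le> v"
    and char: "\<And>t. char \<mu> t = complex_of_real (\<integral>v. 1 / (1 + t\<^sup>2 * v) \<partial>K)"
  shows "inf_divisible \<mu>"
  unfolding inf_divisible_def
proof (intro allI impI)
  fix n :: nat assume n: "1 \<le> n"
  interpret \<mu>: real_distribution \<mu> by fact
  define g where "g t = (\<integral>v. 1 / (1 + t\<^sup>2 * v) \<partial>K)" for t
  \<comment> \<open>Continuity of g at 0, required by the limit argument, is inherited from the
    characteristic function of \<mu>.\<close>
  have "g = (\<lambda>t. Re (char \<mu> t))" by (simp add: char g_def[abs_def])
  moreover have "isCont (\<lambda>t. Re (char \<mu> t)) 0" using \<mu>.isCont_char[of 0] unfolding isCont_def by (intro tendsto_Re)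
  ultimately have "isCont g 0" by simp
  hence "real_char (\<lambda>t. g t powr (1 / real n))"
    unfolding g_def using n by (intro real_char_laplace_mixture_root[OF K V]) auto
  then obtain \<nu> where \<nu>: "real_distribution \<nu>" "\<And>t. char \<nu> t = complex_of_real (g t powr (1 / real n))"
    by (auto simp: real_char_def)
  have "0 \<le> g t" for t
    unfolding g_def using V by (intro integral_nonneg_AE) (auto elim!: eventually_mono)
  hence "(g t powr (1 / real n)) ^ n = g t" for t
    using n by (cases "g t = 0") (auto simp: powr_powr powr_realpow[symmetric] simp flip: powr_realpow)
  hence "char \<mu> t = char (conv_pow \<nu> n) t" for t
    by (simp add: char_conv_pow[OF \<nu>(1)] \<nu>(2) char g_def flip: of_real_power)
  hence "\<mu> = conv_pow \<nu> n"
    by (intro Levy_uniqueness[OF \<mu> real_distribution_conv_pow[OF \<nu>(1)]]) auto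
  thus "\<exists>\<nu>. real_distribution \<nu> \<and> \<mu> = conv_pow \<nu> n" using \<nu>(1) by blast
qed

section \<open>Generalized negative binomial laws and uniform convergence\<close>

text \<open>The generalized gamma density with scale parameter c^(-\<alpha>') belongs to c
  G^(1/\<alpha>') with G gamma of shape r. The substitution is decreasing for \<alpha>' < 0, which
  is why |\<alpha>'| stands in the density and |h'| in the proof.\<close>

lemma gen_gamma_change_of_variables:
  assumes r: "0 < r" and \<alpha>': "\<alpha>' \<noteq> 0" and c: "0 < c"
    and [measurable]: "\<phi> \<in> borel_measurable borel" and B: "\<And>z. 0 < z \<Longrightarrow> \<bar>\<phi> z\<bar> \<le> B"
  shows "(LINT z:{0<..}|lborel. \<phi> z * gen_gamma_density r \<alpha>' (c powr (- \<alpha>')) z) =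
    (\<integral>g. \<phi> (c * g powr (1 / \<alpha>')) \<partial>gamma_distr r)"
proof -
  interpret G: real_distribution "gamma_distr r" by (rule real_distribution_gamma_distr[OF r])
  define f where "f z = \<phi> z * gen_gamma_density r \<alpha>' (c powr (- \<alpha>')) z" for z
  define h where "h g = c * g powr (1 / \<alpha>')" for g :: real
  define h' where "h' g = c * (1 / \<alpha>' * g powr (1 / \<alpha>' - 1))" for g :: real
  have [measurable]: "f \<in> borel_measurable borel" "h \<in> borel_measurable borel" "h' \<in> borel_measurable borel"
    unfolding f_def h_def h'_def gen_gamma_density_def by measurable
  have image: "h ` {0<..} = {0<..}"
  proof safe
    fix z :: real assume z: "0 < z"
    have "h ((z / c) powr \<alpha>') = z" using z c \<alpha>' by (simp add: h_def powr_powr)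
    moreover have "(z / c) powr \<alpha>' \<in> {0<..}" using z c by simp
    ultimately show "z \<in> h ` {0<..}" by (metis imageI)
  qed (use c in \<open>auto simp: h_def\<close>)
  have inj: "inj_on h {0<..}"
  proof (rule inj_onI)
    fix x y :: real assume xy: "x \<in> {0<..}" "y \<in> {0<..}" "h x = h y"
    hence "(x powr (1 / \<alpha>')) powr \<alpha>' = (y powr (1 / \<alpha>')) powr \<alpha>'" using c by (simp add: h_def)
    thus "x = y" using xy \<alpha>' by (simp add: powr_powr)
  qed
  have deriv: "(h has_field_derivative h' x) (at x within {0<..})" if "x \<in> {0<..}" for x
    unfolding h_def h'_def using that by (auto intro!: derivative_eq_intros has_real_derivative_powr)
  have key: "\<bar>h' g\<bar> * f (h g) = gamma_pdf r g * \<phi> (h g)" if g: "0 < g" for g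
  proof -
    have lg: "ln (h g) = ln c + ln g / \<alpha>'" using g c by (simp add: h_def ln_mult ln_powr)
    have hpos: "0 < h g" using g c by (simp add: h_def)
    have "c powr (- \<alpha>') * h g powr \<alpha>' = g"
      using g c \<alpha>' hpos by (simp add: powr_def lg exp_add[symmetric] algebra_simps)
    hence e: "exp (- (c powr (- \<alpha>')) * h g powr \<alpha>') = exp (- g)" by simp
    \<comment> \<open>Jacobian and density combine to the gamma power: after taking logarithms the
      multiples of ln c cancel and those of ln g add up to r - 1.\<close>
    have "c * g powr (1 / \<alpha>' - 1) * ((c powr (- \<alpha>')) powr r * h g powr (\<alpha>' * r - 1)) = g powr (r - 1)"
    proof -
      have "c * g powr (1 / \<alpha>' - 1) * ((c powr (- \<alpha>')) powr r * h g powr (\<alpha>' * r - 1)) =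
        exp (ln c + (1 / \<alpha>' - 1) * ln g + (- \<alpha>' * r) * ln c + (\<alpha>' * r - 1) * (ln c + ln g / \<alpha>'))"
      proof -
        have 1: "g powr (1 / \<alpha>' - 1) = exp ((1 / \<alpha>' - 1) * ln g)" using g by (simp add: powr_def)
        have 2: "(c powr (- \<alpha>')) powr r = exp ((- \<alpha>' * r) * ln c)" using c by (simp add: powr_powr powr_def)
        have 3: "h g powr (\<alpha>' * r - 1) = exp ((\<alpha>' * r - 1) * (ln c + ln g / \<alpha>'))" using hpos lg by (simp add: powr_def)
        show ?thesis unfolding 1 2 3 by (simp only: exp_add exp_ln[OF c] mult.assoc)
      qed
      also have "ln c + (1 / \<alpha>' - 1) * ln g + (- \<alpha>' * r) * ln c + (\<alpha>' * r - 1) * (ln c + ln g / \<alpha>') = (r - 1) * ln g"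
        using \<alpha>' by (simp add: field_simps)
      finally show ?thesis using g by (simp add: powr_def)
    qed
    moreover have "\<bar>h' g\<bar> * f (h g) = (c * g powr (1 / \<alpha>' - 1) * ((c powr (- \<alpha>')) powr r * h g powr (\<alpha>' * r - 1))) * exp (- g) / Gamma r * \<phi> (h g)"
      using c \<alpha>' unfolding f_def gen_gamma_density_def e h'_def by (simp add: abs_mult)
    ultimately show ?thesis using g by (simp add: gamma_pdf_def)
  qed
  have intG: "integrable (gamma_distr r) (\<lambda>g. \<phi> (h g))"
  proof (rule G.integrable_const_bound[where B = B])
    show "AE g in gamma_distr r. norm (\<phi> (h g)) \<le> B"
      using AE_gamma_distr_pos[of r] by eventually_elim (use B c in \<open>auto simp: h_def\<close>)
  qed simp
  have lb: "integrable lborel (\<lambda>g. gamma_pdf r g * \<phi> (h g))" "(\<integral>g. gamma_pdf r g * \<phi> (h g) \<partial>lborel) = (\<integral>g. \<phi> (h g) \<partial>gamma_distr r)"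
    using intG r unfolding gamma_distr_eq by (simp_all add: integrable_density integral_density gamma_pdf_nonneg)
  have ind: "indicator {0<..} g *\<^sub>R (\<bar>h' g\<bar> * f (h g)) = gamma_pdf r g * \<phi> (h g)" for g
    using key[of g] by (auto simp: indicator_def gamma_pdf_def)
  have si: "set_integrable lborel {0<..} (\<lambda>g. \<bar>h' g\<bar> * f (h g))"
    unfolding set_integrable_def ind by (rule lb)
  have I1: "integral {0<..} (\<lambda>g. \<bar>h' g\<bar> * f (h g)) = (\<integral>g. \<phi> (h g) \<partial>gamma_distr r)"
    using set_borel_integral_eq_integral(2)[OF si] lb(2) unfolding set_lebesgue_integral_def ind by simp
  \<comment> \<open>The substitution theorem speaks of Lebesgue measure; for Borel functions
    integrability passes to the completion and back.\<close>
  have "(\<lambda>g. \<bar>h' g\<bar> * f (h g)) absolutely_integrable_on {0<..}"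
    using si unfolding set_integrable_def by (subst integrable_completion) auto
  with I1 have "f absolutely_integrable_on (h ` {0<..}) \<and> integral (h ` {0<..}) f = (\<integral>g. \<phi> (h g) \<partial>gamma_distr r)"
    using has_absolute_integral_change_of_variables_1'[of "{0<..}" h h' f "\<integral>g. \<phi> (h g) \<partial>gamma_distr r"] deriv inj by auto
  hence f: "f absolutely_integrable_on {0<..}" "integral {0<..} f = (\<integral>g. \<phi> (h g) \<partial>gamma_distr r)"
    unfolding image by auto
  have "set_integrable lborel {0<..} f"
    using f(1) unfolding set_integrable_def by (subst (asm) integrable_completion) auto
  thus ?thesis
    using f(2) set_borel_integral_eq_integral(2)[of "{0<..}" f] by (simp add: f_def h_def)
qed

text \<open>The law is mixed Poisson with random parameter c G^(1/\<alpha>'). The bound z^k \<le> k!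
  e^z, from a single term of the exponential series, makes the integrand admissible for the
  substitution.\<close>

lemma gen_negbin_pmf_eq:
  assumes r: "0 < r" and \<alpha>': "\<alpha>' \<noteq> 0" and c: "0 < c"
  shows "gen_negbin_pmf r \<alpha>' (c powr (- \<alpha>')) k =
    (\<integral>g. exp (- (c * g powr (1 / \<alpha>'))) * (c * g powr (1 / \<alpha>')) ^ k / fact k \<partial>gamma_distr r)"
proof -
  have bound: "\<bar>exp (- z) * z ^ k\<bar> \<le> fact k" if "0 < z" for z :: real
  proof -
    have "z ^ k / fact k \<le> (\<Sum>k. z ^ k /\<^sub>R fact k)"
      using that sum_le_suminf[OF summable_exp_generic[of z], of "{k}"] by (auto simp: divide_inverse mult.commute)
    hence "z ^ k / fact k \<le> exp z" by (simp add: exp_def)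
    thus ?thesis using that by (simp add: exp_minus field_simps)
  qed
  have "gen_negbin_pmf r \<alpha>' (c powr (- \<alpha>')) k =
    (1 / fact k) * (\<integral>g. exp (- (c * g powr (1 / \<alpha>'))) * (c * g powr (1 / \<alpha>')) ^ k \<partial>gamma_distr r)"
    unfolding gen_negbin_pmf_def
    by (subst gen_gamma_change_of_variables[OF r \<alpha>' c, of "\<lambda>z. exp (- z) * z ^ k" "fact k"]) (use bound in auto)
  thus ?thesis by simp
qed

text \<open>Given the parameter Z the index is Poisson, with generating function exp(-(1 - w) Z).
  Its partial sums lie between 0 and 1, so the mixture may be summed term by term.\<close>

lemma gen_negbin_pgf_sums:
  assumes r: "0 < r" and \<alpha>': "\<alpha>' \<noteq> 0" and c: "0 < c" and w: "0 \<le> w" "w \<le> 1"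
  shows "(\<lambda>k. gen_negbin_pmf r \<alpha>' (c powr (- \<alpha>')) k * w ^ k) sums
    (\<integral>g. exp (- ((1 - w) * (c * g powr (1 / \<alpha>')))) \<partial>gamma_distr r)"
proof -
  interpret G: real_distribution "gamma_distr r" by (rule real_distribution_gamma_distr[OF r])
  define Z where "Z g = c * g powr (1 / \<alpha>')" for g :: real
  have [measurable]: "Z \<in> borel_measurable borel" unfolding Z_def by measurable
  have Z: "0 \<le> Z g" for g using c by (simp add: Z_def)
  have ser: "(\<lambda>k. exp (- Z g) * Z g ^ k / fact k * w ^ k) sums exp (- ((1 - w) * Z g))" for g
  proof -
    have "(\<lambda>k. exp (- Z g) * ((w * Z g) ^ k /\<^sub>R fact k)) sums (exp (- Z g) * exp (w * Z g))"
      by (intro sums_mult exp_converges)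
    thus ?thesis by (simp add: mult_exp_exp algebra_simps power_mult_distrib divide_inverse)
  qed
  have partial: "\<bar>\<Sum>k<n. exp (- Z g) * Z g ^ k / fact k * w ^ k\<bar> \<le> 1" for n g
  proof -
    have "(\<Sum>k<n. exp (- Z g) * Z g ^ k / fact k * w ^ k) \<le> exp (- ((1 - w) * Z g))"
      unfolding sums_unique[OF ser] by (intro sum_le_suminf sums_summable[OF ser]) (use Z[of g] w in auto)
    also have "\<dots> \<le> 1" using Z[of g] w by simp
    finally show ?thesis using Z[of g] w by (simp add: abs_of_nonneg sum_nonneg)
  qed
  have term_int: "integrable (gamma_distr r) (\<lambda>g. exp (- Z g) * Z g ^ k / fact k)" for k
  proof (rule G.integrable_const_bound[where B = 1])
    show "AE g in gamma_distr r. norm (exp (- Z g) * Z g ^ k / fact k) \<le> 1"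
    proof (rule AE_I2)
      fix g
      have "Z g ^ k / fact k \<le> (\<Sum>k. Z g ^ k /\<^sub>R fact k)"
        using Z[of g] sum_le_suminf[OF summable_exp_generic[of "Z g"], of "{k}"] by (auto simp: divide_inverse mult.commute)
      hence "Z g ^ k / fact k \<le> exp (Z g)" by (simp add: exp_def)
      thus "norm (exp (- Z g) * Z g ^ k / fact k) \<le> 1"
        using Z[of g] by (simp add: exp_minus field_simps)
    qed
  qed simp
  have "(\<lambda>n. \<integral>g. (\<Sum>k<n. exp (- Z g) * Z g ^ k / fact k * w ^ k) \<partial>gamma_distr r) \<longlonglongrightarrow>
    (\<integral>g. exp (- ((1 - w) * Z g)) \<partial>gamma_distr r)"
    by (rule integral_dominated_convergence[where w = "\<lambda>_. 1"])
       (use ser partial in \<open>auto simp: sums_def\<close>)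
  moreover have "(\<integral>g. (\<Sum>k<n. exp (- Z g) * Z g ^ k / fact k * w ^ k) \<partial>gamma_distr r) =
    (\<Sum>k<n. gen_negbin_pmf r \<alpha>' (c powr (- \<alpha>')) k * w ^ k)" for n
    unfolding gen_negbin_pmf_eq[OF r \<alpha>' c] Z_def[symmetric]
    by (subst Bochner_Integration.integral_sum, intro integrable_mult_left term_int)
       (simp only: integral_mult_left_zero)
  ultimately show ?thesis unfolding sums_def Z_def by simp
qed

section \<open>Random indices and uniform convergence of distribution functions\<close>

lemma (in prob_space) nat_random_variable_sums:
  fixes f :: "nat \<Rightarrow> real"
  assumes N[measurable]: "N \<in> measurable M (count_space UNIV)" and B: "\<And>k. \<bar>f k\<bar> \<le> B"
  shows "(\<lambda>k. prob {\<omega> \<in> space M. N \<omega> = k} * f k) sums (\<integral>\<omega>. f (N \<omega>) \<partial>M)"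
proof -
  have [measurable]: "{\<omega> \<in> space M. N \<omega> = k} \<in> sets M" for k by measurable
  have eq: "(\<Sum>k<n. indicator {\<omega> \<in> space M. N \<omega> = k} \<omega> * f k) = (if N \<omega> < n then f (N \<omega>) else 0)"
    if "\<omega> \<in> space M" for \<omega> n
    using that by (simp add: indicator_def if_distrib[of "\<lambda>x. x * _"] cong: if_cong)
  have "(\<lambda>n. \<integral>\<omega>. (\<Sum>k<n. indicator {\<omega> \<in> space M. N \<omega> = k} \<omega> * f k) \<partial>M) \<longlonglongrightarrow> (\<integral>\<omega>. f (N \<omega>) \<partial>M)"
  proof (rule integral_dominated_convergence[where w = "\<lambda>_. B"])
    show "AE \<omega> in M. (\<lambda>n. \<Sum>k<n. indicator {\<omega> \<in> space M. N \<omega> = k} \<omega> * f k) \<longlonglongrightarrow> f (N \<omega>)"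
    proof (rule AE_I2)
      fix \<omega> assume "\<omega> \<in> space M"
      have "eventually (\<lambda>n. (if N \<omega> < n then f (N \<omega>) else 0) = f (N \<omega>)) sequentially"
        using eventually_gt_at_top[of "N \<omega>"] by eventually_elim simp
      thus "(\<lambda>n. \<Sum>k<n. indicator {\<omega> \<in> space M. N \<omega> = k} \<omega> * f k) \<longlonglongrightarrow> f (N \<omega>)"
        unfolding eq[OF \<open>\<omega> \<in> space M\<close>] by (rule tendsto_eventually)
    qed
    show "AE \<omega> in M. norm (\<Sum>k<n. indicator {\<omega> \<in> space M. N \<omega> = k} \<omega> * f k) \<le> B" for n
    proof (rule AE_I2)
      fix \<omega> assume "\<omega> \<in> space M"
      show "norm (\<Sum>k<n. indicator {\<omega> \<in> space M. N \<omega> = k} \<omega> * f k) \<le> B"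
        unfolding eq[OF \<open>\<omega> \<in> space M\<close>] using B[of "N \<omega>"] order_trans[OF abs_ge_zero B] by simp
    qed
  qed (auto intro!: measurable_compose[OF N])
  moreover have "(\<integral>\<omega>. (\<Sum>k<n. indicator {\<omega> \<in> space M. N \<omega> = k} \<omega> * f k) \<partial>M) = (\<Sum>k<n. prob {\<omega> \<in> space M. N \<omega> = k} * f k)" for n
    by (subst Bochner_Integration.integral_sum)
       (auto simp: integrable_mult_left_iff intro!: integrable_real_indicator simp: emeasure_eq_measure)
  ultimately show ?thesis by (simp add: sums_def)
qed

text \<open>Polya's theorem. A continuous limit F has points with F (X j) = j / q; convergence at
  these finitely many points spreads to all x by monotonicity.\<close>

lemma polya_uniform:
  assumes \<mu>: "\<And>n. real_distribution (\<mu> n)" and M: "real_distribution M" and conv: "weak_conv_m \<mu> M"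
    and atoms: "\<And>x. measure M {x} = 0" and \<epsilon>: "0 < \<epsilon>"
  shows "eventually (\<lambda>n. \<forall>x. \<bar>measure (\<mu> n) {..<x} - measure M {..<x}\<bar> \<le> \<epsilon>) sequentially"
proof -
  interpret \<mu>: real_distribution "\<mu> n" for n by (rule \<mu>)
  interpret M: real_distribution M by (rule M)
  define F where "F x = cdf M x" for x
  have cont: "isCont F x" for x unfolding F_def by (simp add: M.isCont_cdf atoms)
  have mono: "F x \<le> F y" if "x \<le> y" for x y unfolding F_def using that by (rule M.cdf_nondecreasing)
  have F01: "0 \<le> F x" "F x \<le> 1" for x unfolding F_def by (auto intro: M.cdf_nonneg M.cdf_bounded_prob)
  have F_less: "measure M {..<x} = F x" for x
  proof -
    have "measure M {..x} = measure M {..<x} + measure M {x}"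
      by (subst M.finite_measure_Union[symmetric]) (auto intro!: arg_cong[where f = "measure M"])
    thus ?thesis by (simp add: F_def cdf_def atoms)
  qed
  have ivt: "\<exists>x. F x = y" if y: "0 < y" "y < 1" for y
  proof -
    have "eventually (\<lambda>x. F x < y) at_bot"
      unfolding F_def by (rule order_tendstoD(2)[OF M.cdf_lim_at_bot y(1)])
    then obtain a where a: "F a < y" by (auto simp: eventually_at_bot_linorder)
    have "eventually (\<lambda>x. y < F x) at_top"
      unfolding F_def by (rule order_tendstoD(1)[OF M.cdf_lim_at_top_prob y(2)])
    then obtain b where b: "y < F b" by (auto simp: eventually_at_top_linorder)
    have "a \<le> b" using a b mono[of b a] by (cases "a \<le> b") auto
    from IVT[of F a y b] this a b cont show ?thesis by (auto simp: less_imp_le)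
  qed
  \<comment> \<open>The grid step is at most \<epsilon> / 4. The lower estimate loses up to two
    steps and the convergence error \<epsilon> / 4, hence 3/4 of \<epsilon>; the upper one loses
    less.\<close>
  obtain q :: nat where q: "4 / \<epsilon> < real q" using reals_Archimedean2 by blast
  have q0: "0 < real q" using q \<epsilon> by (meson divide_pos_pos less_trans zero_less_numeral)
  have q\<epsilon>: "1 / real q \<le> \<epsilon> / 4" using q q0 \<epsilon> by (simp add: field_simps)
  have "\<exists>x. F x = real j / real q" if "j \<in> {1..<q}" for j
    using that q0 by (intro ivt) auto
  then obtain X where X: "\<And>j. j \<in> {1..<q} \<Longrightarrow> F (X j) = real j / real q"
    by metis
  have "eventually (\<lambda>n. \<forall>j\<in>{1..<q}. \<bar>cdf (\<mu> n) (X j) - F (X j)\<bar> < \<epsilon> / 4) sequentially"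
  proof (intro eventually_ball_finite ballI)
    fix j
    have "(\<lambda>n. cdf (\<mu> n) (X j)) \<longlonglongrightarrow> F (X j)"
      using conv cont[of "X j"] unfolding weak_conv_m_def weak_conv_def F_def by auto
    from tendstoD[OF this, of "\<epsilon> / 4"] \<epsilon>
    show "eventually (\<lambda>n. \<bar>cdf (\<mu> n) (X j) - F (X j)\<bar> < \<epsilon> / 4) sequentially"
      by (simp add: dist_real_def)
  qed simp
  thus ?thesis
  proof eventually_elim
    case (elim n)
    show ?case
    proof
      fix x
      define j where "j = nat \<lfloor>real q * F x\<rfloor>"
      have "0 \<le> real q * F x" using q0 F01 by simp
      hence j: "real j \<le> real q * F x" "real q * F x < real j + 1" unfolding j_def by linarith+
      have j': "real j / real q \<le> F x" "F x < (real j + 1) / real q"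
        using j q0 by (simp_all add: field_simps)
      have up: "measure (\<mu> n) {..<x} \<le> F x + \<epsilon>"
      proof (cases "Suc j < q")
        case True
        have "F (X (Suc j)) = (real j + 1) / real q" using X[of "Suc j"] True by simp
        hence "x \<le> X (Suc j)" using j'(2) mono[of "X (Suc j)" x] by (cases "x \<le> X (Suc j)") auto
        hence "measure (\<mu> n) {..<x} \<le> cdf (\<mu> n) (X (Suc j))"
          unfolding cdf_def by (intro \<mu>.finite_measure_mono) auto
        also have "\<dots> \<le> (real j + 1) / real q + \<epsilon> / 4"
        proof -
          have "Suc j \<in> {1..<q}" using True by simp
          with elim have "\<bar>cdf (\<mu> n) (X (Suc j)) - F (X (Suc j))\<bar> < \<epsilon> / 4" by blast
          thus ?thesis using \<open>F (X (Suc j)) = (real j + 1) / real q\<close> by linarith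
        qed
        also have "\<dots> \<le> F x + \<epsilon>"
          using j'(1) q\<epsilon> \<epsilon> by (simp add: add_divide_distrib)
        finally show ?thesis .
      next
        case False
        have "measure (\<mu> n) {..<x} \<le> 1" by (rule \<mu>.prob_le_1)
        also have "1 \<le> (real j + 1) / real q" using False q0 by (simp add: field_simps)
        also have "\<dots> \<le> F x + \<epsilon>" using j'(1) q\<epsilon> \<epsilon> by (simp add: add_divide_distrib)
        finally show ?thesis .
      qed
      have lo: "F x - \<epsilon> \<le> measure (\<mu> n) {..<x}"
      \<comment> \<open>From below the point j - 1 is used: F (X j) \<le> F x does not exclude x
        \<le> X j, while the strictly smaller value at j - 1 forces X (j - 1) < x, as the open
        half-line demands. For j < 2 there is no such point, but F x itself is then small.\<close>
      proof (cases "2 \<le> j")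
        case True
        have "real j \<le> real q" using j(1) F01(2)[of x] q0 by (meson mult_left_le order_trans less_imp_le)
        hence jj: "j - 1 \<in> {1..<q}" using True by auto
        have FX: "F (X (j - 1)) = (real j - 1) / real q" using X[OF jj] True by (simp add: of_nat_diff)
        have "(real j - 1) / real q < real j / real q" using q0 by (simp add: divide_strict_right_mono)
        hence "X (j - 1) < x" using FX j'(1) mono[of x "X (j - 1)"] by (cases "X (j - 1) < x") auto
        hence "cdf (\<mu> n) (X (j - 1)) \<le> measure (\<mu> n) {..<x}"
          unfolding cdf_def by (intro \<mu>.finite_measure_mono) auto
        moreover have "(real j - 1) / real q - \<epsilon> / 4 \<le> cdf (\<mu> n) (X (j - 1))"
        proof -
          from elim jj have "\<bar>cdf (\<mu> n) (X (j - 1)) - F (X (j - 1))\<bar> < \<epsilon> / 4" by blast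
          thus ?thesis using FX by linarith
        qed
        moreover have "F x - \<epsilon> \<le> (real j - 1) / real q - \<epsilon> / 4"
          using j'(2) q\<epsilon> \<epsilon> by (simp add: add_divide_distrib diff_divide_distrib)
        ultimately show ?thesis by linarith
      next
        case False
        hence "(real j + 1) / real q \<le> 2 / real q" using q0 by (intro divide_right_mono) auto
        hence "F x \<le> \<epsilon>" using j'(2) q\<epsilon> \<epsilon> by simp
        thus ?thesis using measure_nonneg[of "\<mu> n" "{..<x}"] by linarith
      qed
      show "\<bar>measure (\<mu> n) {..<x} - measure M {..<x}\<bar> \<le> \<epsilon>"
        unfolding F_less using up lo by linarith
    qed
  qed
qed

section \<open>Random sums\<close>

text \<open>Decomposition over the events N = k, each independent of the k-th partial sum. On the
  right the index and the sum are evaluated at separate points \<omega> and \<omega>', which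
  expresses this independence. The index type \<open>nat option\<close> puts N, as a real variable,
  into one independent family with the summands.\<close>

lemma (in prob_space) random_sum_prob:
  fixes X :: "nat \<Rightarrow> 'a \<Rightarrow> real"
  assumes X[measurable]: "\<And>i. X i \<in> borel_measurable M"
    and N[measurable]: "N \<in> measurable M (count_space UNIV)"
    and indep: "indep_vars (\<lambda>_. borel) (\<lambda>j \<omega>. case j of None \<Rightarrow> real (N \<omega>) | Some i \<Rightarrow> X i \<omega>) (UNIV :: nat option set)"
  shows "prob {\<omega> \<in> space M. (\<Sum>i<N \<omega>. X i \<omega>) < y} =
    (\<integral>\<omega>. prob {\<omega>' \<in> space M. (\<Sum>i<N \<omega>. X i \<omega>') < y} \<partial>M)"
proof -
  define D where "D k = prob {\<omega> \<in> space M. (\<Sum>i<k. X i \<omega>) < y}" for k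
  define A where "A k = {\<omega> \<in> space M. N \<omega> = k \<and> (\<Sum>i<k. X i \<omega>) < y}" for k
  have A[measurable]: "A k \<in> sets M" for k unfolding A_def by measurable
  have prob_A: "prob (A k) = prob {\<omega> \<in> space M. N \<omega> = k} * D k" for k
  proof -
    let ?Y = "\<lambda>j \<omega>. case j of None \<Rightarrow> real (N \<omega>) | Some i \<Rightarrow> X i \<omega>"
    have "indep_vars (\<lambda>_. borel) ?Y (insert None (Some ` {..<k}))"
      by (rule indep_vars_subset[OF indep]) simp
    from indep_vars_sum[OF _ _ this]
    have "indep_var borel (\<lambda>\<omega>. real (N \<omega>)) borel (\<lambda>\<omega>. \<Sum>i\<in>Some ` {..<k}. ?Y i \<omega>)" by simp
    hence "indep_var borel (\<lambda>\<omega>. real (N \<omega>)) borel (\<lambda>\<omega>. \<Sum>i<k. X i \<omega>)"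
      by (simp add: sum.reindex)
    from indep_varD[OF this, of "{real k}" "{..<y}"]
    have "prob ((\<lambda>\<omega>. (real (N \<omega>), \<Sum>i<k. X i \<omega>)) -` ({real k} \<times> {..<y}) \<inter> space M) =
      prob ((\<lambda>\<omega>. real (N \<omega>)) -` {real k} \<inter> space M) * prob ((\<lambda>\<omega>. \<Sum>i<k. X i \<omega>) -` {..<y} \<inter> space M)"
      by simp
    also have "(\<lambda>\<omega>. (real (N \<omega>), \<Sum>i<k. X i \<omega>)) -` ({real k} \<times> {..<y}) \<inter> space M = A k"
      by (auto simp: A_def)
    also have "(\<lambda>\<omega>. real (N \<omega>)) -` {real k} \<inter> space M = {\<omega> \<in> space M. N \<omega> = k}" by auto
    also have "(\<lambda>\<omega>. \<Sum>i<k. X i \<omega>) -` {..<y} \<inter> space M = {\<omega> \<in> space M. (\<Sum>i<k. X i \<omega>) < y}" by auto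
    finally show ?thesis by (simp add: D_def)
  qed
  have "(\<lambda>k. prob (A k)) sums prob (\<Union>k. A k)"
    by (rule finite_measure_UNION) (auto simp: disjoint_family_on_def A_def)
  also have "(\<Union>k. A k) = {\<omega> \<in> space M. (\<Sum>i<N \<omega>. X i \<omega>) < y}" by (auto simp: A_def)
  finally have 1: "(\<lambda>k. prob {\<omega> \<in> space M. N \<omega> = k} * D k) sums prob {\<omega> \<in> space M. (\<Sum>i<N \<omega>. X i \<omega>) < y}"
    by (simp only: prob_A)
  have 2: "(\<lambda>k. prob {\<omega> \<in> space M. N \<omega> = k} * D k) sums (\<integral>\<omega>. D (N \<omega>) \<partial>M)"
    by (rule nat_random_variable_sums[OF N, of _ 1]) (simp add: D_def)
  from sums_unique2[OF 1 2] show ?thesis by (simp add: D_def)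
qed

context
  fixes M :: "'a measure" and N :: "nat \<Rightarrow> 'a \<Rightarrow> nat" and r \<alpha>' :: real
  assumes M: "prob_space M" and r: "0 < r" and \<alpha>': "\<alpha>' \<noteq> 0"
    and N[measurable]: "\<And>n. N n \<in> measurable M (count_space UNIV)"
    and N_distr: "\<And>n k. n \<ge> 1 \<Longrightarrow>
       measure M {\<omega> \<in> space M. N n \<omega> = k} = gen_negbin_pmf r \<alpha>' (real n powr (- \<alpha>')) k"
begin

interpretation prob_space M by (rule M)
interpretation G: real_distribution "gamma_distr r" by (rule real_distribution_gamma_distr[OF r])

lemma gen_negbin_pgf:
  assumes n: "1 \<le> n" and w: "0 \<le> w" "w \<le> 1"
  shows "(\<integral>\<omega>. w ^ N n \<omega> \<partial>M) = (\<integral>g. exp (- ((1 - w) * (real n * g powr (1 / \<alpha>')))) \<partial>gamma_distr r)"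
proof (rule sums_unique2)
  show "(\<lambda>k. prob {\<omega> \<in> space M. N n \<omega> = k} * w ^ k) sums (\<integral>\<omega>. w ^ N n \<omega> \<partial>M)"
    by (rule nat_random_variable_sums[OF N, of _ 1]) (use w in \<open>auto intro: power_le_one\<close>)
  show "(\<lambda>k. prob {\<omega> \<in> space M. N n \<omega> = k} * w ^ k) sums
    (\<integral>g. exp (- ((1 - w) * (real n * g powr (1 / \<alpha>')))) \<partial>gamma_distr r)"
    unfolding N_distr[OF n] by (rule gen_negbin_pgf_sums[OF r \<alpha>' _ w]) (use n in simp)
qed

text \<open>N / n tends in law to G^(1/\<alpha>'): the generating function at w = exp(-T / n) has
  the exponent n (1 - w) G^(1/\<alpha>'), and n (1 - w) tends to T.\<close>

lemma gen_negbin_laplace_limit: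
  assumes T: "0 \<le> T"
  shows "(\<lambda>n. \<integral>\<omega>. exp (- (T * (real (N n \<omega>) / real n))) \<partial>M) \<longlonglongrightarrow> (\<integral>g. exp (- (T * g powr (1 / \<alpha>'))) \<partial>gamma_distr r)"
proof -
  define b where "b n = real n * (1 - exp (- (T / real n)))" for n
  have b: "b \<longlonglongrightarrow> T"
  proof -
    have "((\<lambda>s. exp (- (T * s))) has_field_derivative - T) (at 0)"
      by (auto intro!: derivative_eq_intros)
    hence d: "(\<lambda>s. (exp (- (T * s)) - 1) / s) \<midarrow>0\<rightarrow> - T"
      by (simp add: has_field_derivative_iff)
    have "filterlim (\<lambda>n. 1 / real n) (at 0) sequentially"
      unfolding filterlim_at
      using lim_1_over_n[where 'a = real] eventually_gt_at_top[of 0] by (auto elim!: eventually_mono)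
    from filterlim_compose[OF d this]
    have "(\<lambda>n. (exp (- (T * (1 / real n))) - 1) / (1 / real n)) \<longlonglongrightarrow> - T" .
    from tendsto_minus[OF this] show ?thesis
      by (simp add: b_def[abs_def] algebra_simps)
  qed
  have b0: "0 \<le> b n" for n using T by (simp add: b_def)
  have "(\<lambda>n. \<integral>g. exp (- (b n * g powr (1 / \<alpha>'))) \<partial>gamma_distr r) \<longlonglongrightarrow> (\<integral>g. exp (- (T * g powr (1 / \<alpha>'))) \<partial>gamma_distr r)"
    by (rule integral_dominated_convergence[where w = "\<lambda>_. 1"]) (auto intro!: tendsto_intros b simp: b0)
  moreover have "eventually (\<lambda>n. (\<integral>g. exp (- (b n * g powr (1 / \<alpha>'))) \<partial>gamma_distr r) =
    (\<integral>\<omega>. exp (- (T * (real (N n \<omega>) / real n))) \<partial>M)) sequentially"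
    using eventually_ge_at_top[of 1]
  proof eventually_elim
    case (elim n)
    have "(\<integral>\<omega>. exp (- (T * (real (N n \<omega>) / real n))) \<partial>M) = (\<integral>\<omega>. exp (- (T / real n)) ^ N n \<omega> \<partial>M)"
      by (simp add: mult.commute flip: exp_of_nat_mult)
    also have "\<dots> = (\<integral>g. exp (- ((1 - exp (- (T / real n))) * (real n * g powr (1 / \<alpha>')))) \<partial>gamma_distr r)"
      using T by (intro gen_negbin_pgf elim) auto
    finally show ?case by (simp add: b_def mult_ac)
  qed
  ultimately show ?thesis by (rule Lim_transform_eventually)
qed

text \<open>Markov's inequality in the form 1{N < k} \<le> e^k e^(-N); the expectation of e^(-N) is
  the generating function at 1/e and tends to 0 by dominated convergence, G being positive almost
  surely.\<close>

lemma gen_negbin_to_infinity: "(\<lambda>n. prob {\<omega> \<in> space M. N n \<omega> < k}) \<longlonglongrightarrow> 0"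
proof -
  define a where "a = 1 - exp (- 1 :: real)"
  have a: "0 < a" by (simp add: a_def)
  have "(\<lambda>n. \<integral>g. exp (- (a * (real n * g powr (1 / \<alpha>')))) \<partial>gamma_distr r) \<longlonglongrightarrow> (\<integral>g. 0 \<partial>gamma_distr r)"
  proof (rule integral_dominated_convergence[where w = "\<lambda>_. 1"])
    show "AE g in gamma_distr r. (\<lambda>n. exp (- (a * (real n * g powr (1 / \<alpha>'))))) \<longlonglongrightarrow> 0"
      using AE_gamma_distr_pos[of r]
    proof eventually_elim
      case (elim g)
      have "filterlim (\<lambda>n. (a * g powr (1 / \<alpha>')) * real n) at_top sequentially"
        using a elim by (intro filterlim_tendsto_pos_mult_at_top[OF tendsto_const] filterlim_real_sequentially) auto
      hence "filterlim (\<lambda>n. - ((a * g powr (1 / \<alpha>')) * real n)) at_bot sequentially"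
        by (simp add: filterlim_uminus_at_bot)
      from filterlim_compose[OF exp_at_bot this] show ?case by (simp add: mult_ac)
    qed
  qed (use a in auto)
  hence lim: "(\<lambda>n. exp (real k) * (\<integral>g. exp (- (a * (real n * g powr (1 / \<alpha>')))) \<partial>gamma_distr r)) \<longlonglongrightarrow> exp (real k) * 0"
    by (intro tendsto_intros) simp
  show ?thesis
  proof (rule tendsto_sandwich[OF _ _ tendsto_const])
    show "(\<lambda>n. exp (real k) * (\<integral>g. exp (- (a * (real n * g powr (1 / \<alpha>')))) \<partial>gamma_distr r)) \<longlonglongrightarrow> 0"
      using lim by simp
    show "eventually (\<lambda>n. prob {\<omega> \<in> space M. N n \<omega> < k} \<le> exp (real k) * (\<integral>g. exp (- (a * (real n * g powr (1 / \<alpha>')))) \<partial>gamma_distr r)) sequentially"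
      using eventually_ge_at_top[of 1]
    proof eventually_elim
      case (elim n)
      have [measurable]: "{\<omega> \<in> space M. N n \<omega> < k} \<in> sets M" by measurable
      have int: "integrable M (\<lambda>\<omega>. exp (- 1) ^ N n \<omega> :: real)"
        by (rule integrable_const_bound[where B = 1]) (auto intro!: power_le_one)
      have "prob {\<omega> \<in> space M. N n \<omega> < k} = (\<integral>\<omega>. indicator {\<omega> \<in> space M. N n \<omega> < k} \<omega> \<partial>M)" by simp
      also have "\<dots> \<le> (\<integral>\<omega>. exp (real k) * exp (- 1) ^ N n \<omega> \<partial>M)"
      proof (rule integral_mono)
        show "integrable M (indicator {\<omega> \<in> space M. N n \<omega> < k} :: _ \<Rightarrow> real)"
          by (rule integrable_real_indicator) (auto simp: emeasure_eq_measure)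
        show "integrable M (\<lambda>\<omega>. exp (real k) * exp (- 1) ^ N n \<omega>)"
          using int by simp
        show "indicator {\<omega> \<in> space M. N n \<omega> < k} \<omega> \<le> exp (real k) * exp (- 1) ^ N n \<omega>" for \<omega>
          by (auto simp: indicator_def exp_of_nat_mult[symmetric] mult_exp_exp)
      qed
      also have "\<dots> = exp (real k) * (\<integral>\<omega>. exp (- 1) ^ N n \<omega> \<partial>M)" by simp
      also have "(\<integral>\<omega>. exp (- 1) ^ N n \<omega> \<partial>M) = (\<integral>g. exp (- (a * (real n * g powr (1 / \<alpha>')))) \<partial>gamma_distr r)"
        unfolding a_def by (rule gen_negbin_pgf[OF elim]) auto
      finally show ?case .
    qed
  qed simp
qed

text \<open>L n is the normalized random sum for summands that are exactly stable. Conditioning on N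
  gives the characteristic function E exp(-|t|^\<alpha> N / n), a Laplace transform whose limit is
  already known.\<close>

lemma stable_subordinated_weak_limit:
  assumes \<alpha>: "0 < \<alpha>" "\<alpha> < 2"
  defines "L \<equiv> \<lambda>n. distr (stable_sym \<alpha> \<Otimes>\<^sub>M M) borel (\<lambda>(s, \<omega>). s * (real (N n \<omega>) / real n) powr (1 / \<alpha>))"
  shows "real_distribution (L n)" and "weak_conv_m L (law_H r \<alpha> \<alpha>')"
    and "measure (L n) {..<x} = (\<integral>\<omega>. measure (stable_sym \<alpha>) {s. s * (real (N n \<omega>) / real n) powr (1 / \<alpha>) < x} \<partial>M)"
proof -
  interpret S: real_distribution "stable_sym \<alpha>" by (rule real_distribution_stable_sym[OF \<alpha>])
  have meas[measurable]: "(\<lambda>(s, \<omega>). s * (real (N n \<omega>) / real n) powr (1 / \<alpha>)) \<in> borel_measurable (stable_sym \<alpha> \<Otimes>\<^sub>M M)" for n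
    by measurable
  show L: "real_distribution (L n)" for n
    unfolding L_def by (rule real_distribution_pair_distr[OF S.prob_space_axioms M meas])
  show "weak_conv_m L (law_H r \<alpha> \<alpha>')"
  proof (rule levy_continuity[OF L real_distribution_law_H[OF r \<alpha>]])
    fix t
    have "char (L n) t = complex_of_real (\<integral>\<omega>. exp (- (\<bar>t\<bar> powr \<alpha> * (real (N n \<omega>) / real n))) \<partial>M)" for n
    proof -
      have "char (L n) t = (\<integral>\<omega>. char (stable_sym \<alpha>) (t * (real (N n \<omega>) / real n) powr (1 / \<alpha>)) \<partial>M)"
        unfolding L_def by (rule char_scale_mixture[OF S.real_distribution_axioms M]) simp
      also have "\<dots> = (\<integral>\<omega>. complex_of_real (exp (- (\<bar>t\<bar> powr \<alpha> * (real (N n \<omega>) / real n)))) \<partial>M)"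
        using \<alpha> by (simp add: char_stable_sym abs_mult powr_mult powr_powr)
      finally show ?thesis by simp
    qed
    moreover have "(\<lambda>n. \<integral>\<omega>. exp (- (\<bar>t\<bar> powr \<alpha> * (real (N n \<omega>) / real n))) \<partial>M) \<longlonglongrightarrow>
      (\<integral>g. exp (- (\<bar>t\<bar> powr \<alpha> * g powr (1 / \<alpha>'))) \<partial>gamma_distr r)"
      by (rule gen_negbin_laplace_limit) simp
    ultimately show "(\<lambda>n. char (L n) t) \<longlonglongrightarrow> char (law_H r \<alpha> \<alpha>') t"
      unfolding char_law_H[OF r \<alpha>] by (simp only: tendsto_of_real)
  qed
  interpret L: real_distribution "L n" by (rule L)
  have "measure (L n) {..<x} = (\<integral>z. indicator {..<x} z \<partial>L n)" by simp
  also have "\<dots> = (\<integral>\<omega>. \<integral>s. indicator {..<x} (s * (real (N n \<omega>) / real n) powr (1 / \<alpha>)) \<partial>stable_sym \<alpha> \<partial>M)"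
    unfolding L_def
    by (subst integral_distr_pair[OF S.prob_space_axioms M meas, where B = 1]) (auto simp: indicator_def)
  also have "\<dots> = (\<integral>\<omega>. measure (stable_sym \<alpha>) {s. s * (real (N n \<omega>) / real n) powr (1 / \<alpha>) < x} \<partial>M)"
  proof (intro Bochner_Integration.integral_cong refl)
    fix \<omega>
    have "(\<integral>s. indicat_real {..<x} (s * (real (N n \<omega>) / real n) powr (1 / \<alpha>)) \<partial>stable_sym \<alpha>) =
      (\<integral>s. indicator {s. s * (real (N n \<omega>) / real n) powr (1 / \<alpha>) < x} s \<partial>stable_sym \<alpha>)"
      by (intro Bochner_Integration.integral_cong) (auto simp: indicator_def)
    thus "(\<integral>s. indicat_real {..<x} (s * (real (N n \<omega>) / real n) powr (1 / \<alpha>)) \<partial>stable_sym \<alpha>) =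
      measure (stable_sym \<alpha>) {s. s * (real (N n \<omega>) / real n) powr (1 / \<alpha>) < x}" by simp
  qed
  finally show "measure (L n) {..<x} = (\<integral>\<omega>. measure (stable_sym \<alpha>) {s. s * (real (N n \<omega>) / real n) powr (1 / \<alpha>) < x} \<partial>M)" .
qed

text \<open>Three errors of size \<epsilon>/3: replacing the k-th partial sum by its stable limit
  for k \<ge> k1, the probability that N < k1, and the distance from L n to the limit law. The
  estimate holds for all real x, not only for x \<ge> 0.\<close>

lemma random_sum_uniform_limit:
  fixes X :: "nat \<Rightarrow> 'a \<Rightarrow> real"
  assumes \<alpha>: "0 < \<alpha>" "\<alpha> < 2"
    and X[measurable]: "\<And>i. X i \<in> borel_measurable M"
    and X_conv: "weak_conv_m (\<lambda>n. distr M borel (\<lambda>\<omega>. (\<Sum>i<n. X i \<omega>) / real n powr (1 / \<alpha>))) (stable_sym \<alpha>)"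
    and N_indep: "\<And>n. n \<ge> 1 \<Longrightarrow> indep_vars (\<lambda>_. borel)
         (\<lambda>j \<omega>. case j of None \<Rightarrow> real (N n \<omega>) | Some i \<Rightarrow> X i \<omega>) (UNIV :: nat option set)"
    and \<epsilon>: "0 < \<epsilon>"
  shows "eventually (\<lambda>n. \<forall>x. \<bar>prob {\<omega> \<in> space M. (\<Sum>i<N n \<omega>. X i \<omega>) < real n powr (1 / \<alpha>) * x} - H_fun x r \<alpha> \<alpha>'\<bar> \<le> \<epsilon>) sequentially"
proof -
  interpret S: real_distribution "stable_sym \<alpha>" by (rule real_distribution_stable_sym[OF \<alpha>])
  define L where "L n = distr (stable_sym \<alpha> \<Otimes>\<^sub>M M) borel (\<lambda>(s, \<omega>). s * (real (N n \<omega>) / real n) powr (1 / \<alpha>))" for n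
  note L = stable_subordinated_weak_limit[OF \<alpha>, folded L_def]
  let ?Q = "\<lambda>n. distr M borel (\<lambda>\<omega>. (\<Sum>i<n. X i \<omega>) / real n powr (1 / \<alpha>))"
  have Q: "real_distribution (?Q n)" for n by (rule real_distribution_distr) measurable
  have "\<epsilon> / 3 > 0" using \<epsilon> by simp
  from polya_uniform[OF Q S.real_distribution_axioms X_conv measure_stable_sym_singleton[OF \<alpha>] this]
  obtain k0 where k0: "\<And>k x. k \<ge> k0 \<Longrightarrow> \<bar>measure (?Q k) {..<x} - measure (stable_sym \<alpha>) {..<x}\<bar> \<le> \<epsilon> / 3"
    unfolding eventually_sequentially by blast
  \<comment> \<open>At least 1, because the empty sum has no normalization by
    k^(1/\<alpha>).\<close>
  define k1 where "k1 = max 1 k0"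
  have ev_L: "eventually (\<lambda>n. \<forall>x. \<bar>measure (L n) {..<x} - measure (law_H r \<alpha> \<alpha>') {..<x}\<bar> \<le> \<epsilon> / 3) sequentially"
    by (rule polya_uniform[OF L(1) real_distribution_law_H[OF r \<alpha>] L(2) measure_law_H_singleton[OF r \<alpha>]]) fact
  have ev_N: "eventually (\<lambda>n. prob {\<omega> \<in> space M. N n \<omega> < k1} < \<epsilon> / 3) sequentially"
    by (rule order_tendstoD(2)[OF gen_negbin_to_infinity]) fact
  from ev_L ev_N eventually_ge_at_top[of 1] show ?thesis
  proof eventually_elim
    case (elim n)
    have n: "0 < real n" using elim(3) by simp
    show ?case
    proof
      fix x
      define D where "D k = prob {\<omega> \<in> space M. (\<Sum>i<k. X i \<omega>) < real n powr (1 / \<alpha>) * x}" for k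
      define E where "E k = measure (stable_sym \<alpha>) {s. s * (real k / real n) powr (1 / \<alpha>) < x}" for k
      have DE: "\<bar>D k - E k\<bar> \<le> 1" for k
        using measure_nonneg[of M] measure_nonneg[of "stable_sym \<alpha>"] prob_le_1 S.prob_le_1
        unfolding D_def E_def by (smt (verit))
      have DE': "\<bar>D k - E k\<bar> \<le> \<epsilon> / 3" if "k1 \<le> k" for k
      proof -
        have k: "0 < real k" "k0 \<le> k" using that by (auto simp: k1_def)
        \<comment> \<open>Both events become half-lines ending at y after normalization by
          k^(1/\<alpha>). Since y varies with k and n, only the uniform convergence of the partial
          sums gives a common threshold k0.\<close>
        define y where "y = real n powr (1 / \<alpha>) * x / real k powr (1 / \<alpha>)"
        have "D k = measure (?Q k) {..<y}"
          unfolding D_def using k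
          by (subst measure_distr) (auto simp: y_def divide_less_cancel intro!: arg_cong[where f = prob])
        moreover have "E k = measure (stable_sym \<alpha>) {..<y}"
        proof -
          have c: "(real k / real n) powr (1 / \<alpha>) = real k powr (1 / \<alpha>) / real n powr (1 / \<alpha>)"
            using k n by (simp add: powr_divide)
          have "s * (real k / real n) powr (1 / \<alpha>) < x \<longleftrightarrow> s < y" for s
            unfolding c y_def using k n by (simp add: field_simps)
          hence "{s. s * (real k / real n) powr (1 / \<alpha>) < x} = {..<y}" by auto
          thus ?thesis by (simp add: E_def)
        qed
        ultimately show ?thesis using k0[OF k(2)] by simp
      qed
      have int: "integrable M (\<lambda>\<omega>. f (N n \<omega>))" if "\<And>k. \<bar>f k\<bar> \<le> 1" for f :: "nat \<Rightarrow> real"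
        by (rule integrable_const_bound[where B = 1]) (auto simp: that intro!: measurable_compose[OF N])
      have ND: "\<bar>D k\<bar> \<le> 1" "\<bar>E k\<bar> \<le> 1" for k
        unfolding D_def E_def by (auto intro: prob_le_1 S.prob_le_1)
      have [measurable]: "{\<omega> \<in> space M. N n \<omega> < k1} \<in> sets M" by measurable
      have "prob {\<omega> \<in> space M. (\<Sum>i<N n \<omega>. X i \<omega>) < real n powr (1 / \<alpha>) * x} = (\<integral>\<omega>. D (N n \<omega>) \<partial>M)"
        unfolding D_def by (rule random_sum_prob[OF X N N_indep[OF elim(3)]])
      moreover have "measure (L n) {..<x} = (\<integral>\<omega>. E (N n \<omega>) \<partial>M)"
        unfolding E_def by (rule L(3))
      ultimately have "\<bar>prob {\<omega> \<in> space M. (\<Sum>i<N n \<omega>. X i \<omega>) < real n powr (1 / \<alpha>) * x} - measure (L n) {..<x}\<bar> =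
        \<bar>\<integral>\<omega>. D (N n \<omega>) - E (N n \<omega>) \<partial>M\<bar>"
        by (simp add: Bochner_Integration.integral_diff int ND)
      also have "\<dots> \<le> (\<integral>\<omega>. \<bar>D (N n \<omega>) - E (N n \<omega>)\<bar> \<partial>M)" by (rule integral_abs_bound)
      also have "\<dots> \<le> (\<integral>\<omega>. \<epsilon> / 3 + indicator {\<omega> \<in> space M. N n \<omega> < k1} \<omega> \<partial>M)"
      proof (rule integral_mono)
        show "integrable M (\<lambda>\<omega>. \<bar>D (N n \<omega>) - E (N n \<omega>)\<bar>)"
          by (rule int[of "\<lambda>k. \<bar>D k - E k\<bar>"]) (use DE in simp)
        show "integrable M (\<lambda>\<omega>. \<epsilon> / 3 + indicator {\<omega> \<in> space M. N n \<omega> < k1} \<omega>)"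
          by (intro Bochner_Integration.integrable_add integrable_real_indicator) (auto simp: emeasure_eq_measure)
        show "\<bar>D (N n \<omega>) - E (N n \<omega>)\<bar> \<le> \<epsilon> / 3 + indicator {\<omega> \<in> space M. N n \<omega> < k1} \<omega>" if "\<omega> \<in> space M" for \<omega>
          using DE[of "N n \<omega>"] DE'[of "N n \<omega>"] \<epsilon> that by (cases "N n \<omega> < k1") auto
      qed
      also have "\<dots> = \<epsilon> / 3 + prob {\<omega> \<in> space M. N n \<omega> < k1}"
        by (subst Bochner_Integration.integral_add)
           (auto simp: prob_space emeasure_eq_measure intro!: integrable_real_indicator)
      finally show "\<bar>prob {\<omega> \<in> space M. (\<Sum>i<N n \<omega>. X i \<omega>) < real n powr (1 / \<alpha>) * x} - H_fun x r \<alpha> \<alpha>'\<bar> \<le> \<epsilon>"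
        using elim(1)[rule_format, of x] elim(2) unfolding H_fun_def by linarith
    qed
  qed
qed

end

lemma inf_divisible_law_H:
  assumes r: "0 < r" "r < 1" and \<alpha>: "0 < \<alpha>" "\<alpha> < 2" and \<alpha>': "0 < \<alpha>'" "\<alpha>' \<le> 1"
  shows "inf_divisible (law_H r \<alpha> \<alpha>')"
proof -
  let ?P = "stable_mixing_space r \<alpha> \<alpha>'"
  interpret P: prob_space ?P by (rule prob_space_stable_mixing_space[OF r \<alpha> \<alpha>'])
  have h: "0 < \<alpha> / 2" "\<alpha> / 2 < 1" "0 < \<alpha> * \<alpha>' / 2" "\<alpha> * \<alpha>' / 2 < 1"
    using stable_index_bounds[OF \<alpha> \<alpha>'] by auto
  define f where "f = (\<lambda>(x, y, s1, s2). 1 / ((x + y) / x) powr (1 / (\<alpha> * \<alpha>')) * sqrt (s1 / s2) :: real)"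
  interpret X: real_distribution "gamma_distr r" by (rule real_distribution_gamma_distr[OF r(1)])
  interpret Y: real_distribution "gamma_distr (1 - r)" by (rule real_distribution_gamma_distr) (use r in simp)
  interpret S: real_distribution "stable_pos (\<alpha> / 2)" by (rule real_distribution_stable_pos[OF h(1,2)])
  interpret T: real_distribution "stable_pos (\<alpha> * \<alpha>' / 2)" by (rule real_distribution_stable_pos[OF h(3,4)])
  have f[measurable]: "f \<in> borel_measurable ?P"
    unfolding f_def stable_mixing_space_def by measurable
  \<comment> \<open>The law of the squared scale: the Laplace characteristic function depends on t
    and the scale only through t^2 times this square.\<close>
  define K where "K = distr ?P borel (\<lambda>z. (f z)\<^sup>2)"
  show ?thesis
  proof (rule inf_divisible_laplace_mixture[OF real_distribution_law_H[OF r(1) \<alpha>]])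
    show "real_distribution K" unfolding K_def by (rule P.real_distribution_distr) simp
    show "AE v in K. 0 \<le> v" unfolding K_def by (subst AE_distr_iff) auto
    fix t
    have "char (law_H r \<alpha> \<alpha>') t = (\<integral>z. char laplace_distr (t * f z) \<partial>?P)"
      unfolding law_H_laplace_mixture[OF r \<alpha> \<alpha>'] f_def[symmetric]
      by (rule char_scale_mixture[OF real_distribution_laplace_distr P.prob_space_axioms f])
    also have "\<dots> = (\<integral>z. complex_of_real (1 / (1 + t\<^sup>2 * (f z)\<^sup>2)) \<partial>?P)"
      by (simp only: char_laplace_distr power_mult_distrib)
    also have "\<dots> = complex_of_real (\<integral>z. 1 / (1 + t\<^sup>2 * (f z)\<^sup>2) \<partial>?P)" by (rule integral_complex_of_real)
    also have "(\<integral>z. 1 / (1 + t\<^sup>2 * (f z)\<^sup>2) \<partial>?P) = (\<integral>v. 1 / (1 + t\<^sup>2 * v) \<partial>K)"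
      unfolding K_def by (subst integral_distr) auto
    finally show "char (law_H r \<alpha> \<alpha>') t = complex_of_real (\<integral>v. 1 / (1 + t\<^sup>2 * v) \<partial>K)" .
  qed
qed

theorem theorem7:
  fixes M :: "'a measure" and X :: "nat \<Rightarrow> 'a \<Rightarrow> real" and N :: "nat \<Rightarrow> 'a \<Rightarrow> nat"
    and \<alpha> r \<alpha>' :: real
  assumes M: "prob_space M"
    and \<alpha>: "0 < \<alpha>" "\<alpha> < 2"
    and X_meas: "\<And>i. X i \<in> borel_measurable M"
    and X_indep: "prob_space.indep_vars M (\<lambda>_. borel) X UNIV"
    and X_ident: "\<And>i. distr M borel (X i) = distr M borel (X 0)"
    and X_conv: "weak_conv_m (\<lambda>n. distr M borel (\<lambda>\<omega>. (\<Sum>i<n. X i \<omega>) / real n powr (1 / \<alpha>)))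
                    (stable_sym \<alpha>)"
    and r: "0 < r" and \<alpha>': "\<alpha>' \<noteq> 0"
    and N_meas: "\<And>n. N n \<in> measurable M (count_space UNIV)"
    and N_distr: "\<And>n k. n \<ge> 1 \<Longrightarrow>
       measure M {\<omega> \<in> space M. N n \<omega> = k} = gen_negbin_pmf r \<alpha>' (real n powr (- \<alpha>')) k"
    and N_indep: "\<And>n. n \<ge> 1 \<Longrightarrow>
       prob_space.indep_vars M (\<lambda>_. borel)
         (\<lambda>j \<omega>. case j of None \<Rightarrow> real (N n \<omega>) | Some i \<Rightarrow> X i \<omega>) (UNIV :: nat option set)"
  shows
    "(\<lambda>n. SUP x\<in>{0..}. \<bar>measure M {\<omega> \<in> space M. (\<Sum>i<N n \<omega>. X i \<omega>) < real n powr (1 / \<alpha>) * x}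
                         - H_fun x r \<alpha> \<alpha>'\<bar>) \<longlonglongrightarrow> 0
     \<and> (\<forall>x. H_fun x r \<alpha> \<alpha>' = (\<integral>z. Phi (x / sqrt (2 * z)) \<partial>law_A r (\<alpha> / 2) \<alpha>'))
     \<and> (r < 1 \<and> 0 < \<alpha>' \<and> \<alpha>' \<le> 1 \<longrightarrow>
          inf_divisible (law_H r \<alpha> \<alpha>')
          \<and> law_H r \<alpha> \<alpha>' =
             distr (laplace_distr \<Otimes>\<^sub>M (gamma_distr r \<Otimes>\<^sub>M (gamma_distr (1 - r) \<Otimes>\<^sub>M
                      (stable_pos (\<alpha> / 2) \<Otimes>\<^sub>M stable_pos (\<alpha> * \<alpha>' / 2))))) borel
               (\<lambda>(l, g1, g2, s1, s2). l / ((g1 + g2) / g1) powr (1 / (\<alpha> * \<alpha>')) * sqrt (s1 / s2)))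
     \<and> (r < 1 \<and> \<alpha>' = 1 \<longrightarrow>
          law_H r \<alpha> 1 =
             distr (laplace_distr \<Otimes>\<^sub>M (gamma_distr r \<Otimes>\<^sub>M (gamma_distr (1 - r) \<Otimes>\<^sub>M
                      (stable_pos (\<alpha> / 2) \<Otimes>\<^sub>M stable_pos (\<alpha> / 2))))) borel
               (\<lambda>(l, g1, g2, s1, s2). l * sqrt (s1 / s2) / ((g1 + g2) / g1) powr (1 / \<alpha>))
          \<and> law_H r \<alpha> 1 =
             distr (std_normal_distr \<Otimes>\<^sub>M (gamma_distr r \<Otimes>\<^sub>M (gamma_distr (1 - r) \<Otimes>\<^sub>M
                      mittag_leffler (\<alpha> / 2)))) borel
               (\<lambda>(x, g1, g2, m). x * sqrt (2 * m) / ((g1 + g2) / g1) powr (1 / \<alpha>))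
          \<and> law_H r \<alpha> 1 =
             distr (linnik \<alpha> \<Otimes>\<^sub>M (gamma_distr r \<Otimes>\<^sub>M gamma_distr (1 - r))) borel
               (\<lambda>(l, g1, g2). l / ((g1 + g2) / g1) powr (1 / \<alpha>)))"
proof -
  interpret prob_space M by (rule M)
  define d where "d n x = \<bar>measure M {\<omega> \<in> space M. (\<Sum>i<N n \<omega>. X i \<omega>) < real n powr (1 / \<alpha>) * x}
                         - H_fun x r \<alpha> \<alpha>'\<bar>" for n x
  have part1: "(\<lambda>n. SUP x\<in>{0..}. d n x) \<longlonglongrightarrow> 0"
  proof (rule tendstoI)
    fix e :: real assume e: "0 < e"
    have "eventually (\<lambda>n. \<forall>x. d n x \<le> e / 2) sequentially"
      unfolding d_def
      by (rule random_sum_uniform_limit[OF M r \<alpha>' N_meas N_distr \<alpha> X_meas X_conv N_indep]) (use e in auto)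
    thus "eventually (\<lambda>n. dist (SUP x\<in>{0..}. d n x) 0 < e) sequentially"
    proof eventually_elim
      case (elim n)
      have "(SUP x\<in>{0..}. d n x) \<le> e / 2" by (rule cSUP_least) (use elim in auto)
      \<comment> \<open>The bound by e / 2 also guarantees that the real supremum is a genuine one;
        d n 0 \<ge> 0 then bounds it from below.\<close>
      moreover have "d n 0 \<le> (SUP x\<in>{0..}. d n x)"
        by (rule cSUP_upper) (use elim in \<open>auto intro!: bdd_aboveI2[where M = "e / 2"]\<close>)
      moreover have "0 \<le> d n 0" by (simp add: d_def)
      ultimately show ?case using e by (simp add: dist_real_def)
    qed
  qed
  have rep: "law_H r \<alpha> \<alpha>' =
      distr (laplace_distr \<Otimes>\<^sub>M (gamma_distr r \<Otimes>\<^sub>M (gamma_distr (1 - r) \<Otimes>\<^sub>M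
              (stable_pos (\<alpha> / 2) \<Otimes>\<^sub>M stable_pos (\<alpha> * \<alpha>' / 2))))) borel
        (\<lambda>(l, g1, g2, s1, s2). l / ((g1 + g2) / g1) powr (1 / (\<alpha> * \<alpha>')) * sqrt (s1 / s2))"
    if "r < 1" "0 < \<alpha>'" "\<alpha>' \<le> 1"
    using law_H_laplace_mixture[OF r that(1) \<alpha> that(2,3)]
    unfolding stable_mixing_space_def by (simp add: split_beta')
  \<comment> \<open>At \<alpha>' = 1 both stable indices are \<alpha>/2, so the quotient of the
    stable factors is R with parameter \<alpha>/2.\<close>
  have rep1: "law_H r \<alpha> 1 =
      distr (laplace_distr \<Otimes>\<^sub>M (gamma_distr r \<Otimes>\<^sub>M (gamma_distr (1 - r) \<Otimes>\<^sub>M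
              (stable_pos (\<alpha> / 2) \<Otimes>\<^sub>M stable_pos (\<alpha> / 2))))) borel
        (\<lambda>(l, g1, g2, s1, s2). l * sqrt (s1 / s2) / ((g1 + g2) / g1) powr (1 / \<alpha>))"
    if "r < 1"
    using law_H_laplace_mixture[OF r that \<alpha> zero_less_one order_refl]
    unfolding stable_mixing_space_def by (simp add: split_beta')
  show ?thesis
    unfolding d_def[symmetric]
    using part1 H_fun_eq[OF r \<alpha>] inf_divisible_law_H[OF r _ \<alpha>] rep rep1
      law_H_mittag_leffler[OF r _ \<alpha>] law_H_linnik[OF r _ \<alpha>] by blast
qed

end
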